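(* Let $\theta:\mathbb{R}^m\to(-\infty,\infty]$ be convex piecewise linear, and let $\varphi_0:\mathbb{R}^n\times\mathbb{R}^d\to\mathbb{R}$ and $\Phi:\mathbb{R}^n\times\mathbb{R}^d\to\mathbb{R}^m$ be $\mathcal{C}^2$-smooth. Let $\bar w\in\mathbb{R}^d$, let $\bar x\in\mathbb{R}^n$ satisfy $\bar z:=\Phi(\bar x,\bar w)\in\operatorname{dom}\theta$, let $\bar v=0\in\nabla_x\varphi_0(\bar x,\bar w)+\nabla_x\Phi(\bar x,\bar w)^*\partial\theta(\bar z)$, and let $\bar\lambda\in\partial\theta(\bar z)$ satisfy $\nabla_x\varphi_0(\bar x,\bar w)+\nabla_x\Phi(\bar x,\bar w)^*\bar\lambda=0$. Assume that the first-order qualification condition $\partial^\infty\theta(\bar z)\cap\ker\nabla_x\Phi(\bar x,\bar w)^*=\{0\}$ holds. Then the following are equivalent: (i) $\bar x$ is a fully stable locally optimal solution to $\mathcal{P}(\bar w,0)$ and the nondegeneracy condition ND holds at $(\bar x,\bar w)$. (ii) $\bar x\in M_\gamma(\bar w,0)$ for some $\gamma>0$, and $(\bar x,\bar\lambda)$ is a strongly regular solution of the KKT system of $\mathcal{P}(\bar w,0)$.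
   Context: **Convex piecewise linear (CPWL).** $\theta$ is CPWL if $\operatorname{dom}\theta$ is a nonempty convex polyhedron and $\theta$ equals on $\operatorname{dom}\theta$ a maximum of finitely many affine functions (and $\infty$ outside). $\partial\theta$ is the subdifferential of convex analysis; $\partial^\infty\theta(\bar z)=\{v:(v,0)\in N((\bar z,\theta(\bar z));\operatorname{epi}\theta)\}=N(\bar z;\operatorname{dom}\theta)$ is the singular subdifferential. **Standing assumption.** $0\in\operatorname{aff}\partial\theta(\bar z)$. **Nondegeneracy condition ND** at $(\bar x,\bar w)$: $S(\bar z)\cap\ker\nabla_x\Phi(\bar x,\bar w)^*=\{0\}$ (equivalently $\nabla_x\Phi(\bar x,\bar w)\mathbb{R}^n+S(\bar z)^\perp=\mathbb{R}^m$), where $S(\bar z)$ is the linear subspace of $\mathbb{R}^m$ parallel to $\operatorname{aff}\partial\theta(\bar z)$. **Problem $\mathcal{P}(w,v)$**, $(w,v)\in\mathbb{R}^d\times\mathbb{R}^n$: minimize $\varphi_0(x,w)+\theta(\Phi(x,w))-\langle v,x\rangle$ over $x\in\mathbb{R}^n$. For $\gamma>0$, $m_\gamma(w,v):=\inf_{\|x-\bar x\|\le\gamma}\{\varphi_0(x,w)+\theta(\Phi(x,w))-\langle v,x\rangle\}$ and $M_\gamma(w,v)$ is the corresponding set of minimizers over $\|x-\bar x\|\le\gamma$ ($:=\emptyset$ if the expression is identically $\infty$). **Full stability.** $\bar x$ is a fully stable locally optimal solution to $\mathcal{P}(\bar w,\bar v)$ if there are $\gamma>0$ and neighborhoods $W$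 of $\bar w$ and $V$ of $\bar v$ such that on $W\times V$ the mapping $M_\gamma$ is single-valued and Lipschitz continuous with $M_\gamma(\bar w,\bar v)=\{\bar x\}$, and $m_\gamma$ is Lipschitz continuous. **KKT system and strong regularity.** Let $L(x,w,\lambda):=\varphi_0(x,w)+\langle\lambda,\Phi(x,w)\rangle$. The KKT system of $\mathcal{P}(w,v)$ is $v=\nabla_xL(x,w,\lambda)$, $0\in-\Phi(x,w)+(\partial\theta)^{-1}(\lambda)$. A solution $(\bar x,\bar\lambda)$ of this system for $(w,v)=(\bar w,0)$ is strongly regular if the solution map $(v_1,v_2)\mapsto\{(x,\lambda)\}$ of the linearized system $$v_1=\nabla^2_{xx}L(\bar x,\bar w,\bar\lambda)(x-\bar x)+\nabla_x\Phi(\bar x,\bar w)^*(\lambda-\bar\lambda),\qquad v_2\in-\Phi(\bar x,\bar w)-\nabla_x\Phi(\bar x,\bar w)(x-\bar x)+(\partial\theta)^{-1}(\lambda)$$ admits a Lipschitzian single-valued graphical localization around $(0,0,\bar x,\bar\lambda)$, i.e. there are neighborhoods $U$ of $(0,0)\in\mathbb{R}^n\times\mathbb{R}^m$ and $V$ of $(\bar x,\bar\lambda)$ such that the graph of the solution map intersected with $U\times V$ is the graph of a Lipschitz continuous single-valued mapping from $U$ to $V$. *)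

theory Defs
  imports "HOL-Analysis.Analysis"
begin

definition C2_smooth :: "('a::real_normed_vector \<Rightarrow> 'b::real_normed_vector) \<Rightarrow> bool" where
  "C2_smooth f \<longleftrightarrow>
     (\<exists>(D :: 'a \<Rightarrow> 'a \<Rightarrow>\<^sub>L 'b) (D2 :: 'a \<Rightarrow> 'a \<Rightarrow>\<^sub>L ('a \<Rightarrow>\<^sub>L 'b)).
        (\<forall>p. (f has_derivative blinfun_apply (D p)) (at p)) \<and>
        (\<forall>p. (D has_derivative blinfun_apply (D2 p)) (at p)) \<and>
        continuous_on UNIV D2)"

definition gradient :: "('a::real_inner \<Rightarrow> real) \<Rightarrow> 'a \<Rightarrow> 'a" where
  "gradient f x = (THE g. GDERIV f x :> g)"

definition hessian :: "('a::real_inner \<Rightarrow> real) \<Rightarrow> 'a \<Rightarrow> 'a \<Rightarrow> 'a" where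
  "hessian f x = frechet_derivative (gradient f) (at x)"

definition partial_x :: "('x::real_normed_vector \<times> 'w \<Rightarrow> 'z::real_normed_vector) \<Rightarrow> 'x \<Rightarrow> 'w \<Rightarrow> 'x \<Rightarrow> 'z" where
  "partial_x \<Phi> x w = frechet_derivative (\<lambda>x. \<Phi> (x, w)) (at x)"

definition ker_partial_x_adj :: "('x::euclidean_space \<times> 'w \<Rightarrow> 'z::euclidean_space) \<Rightarrow> 'x \<Rightarrow> 'w \<Rightarrow> 'z set" where
  "ker_partial_x_adj \<Phi> x w = {l. adjoint (partial_x \<Phi> x w) l = 0}"

definition edom :: "('a \<Rightarrow> ereal) \<Rightarrow> 'a set" where
  "edom \<theta> = {z. \<theta> z < \<infinity>}"

definition epi :: "('a \<Rightarrow> ereal) \<Rightarrow> ('a \<times> real) set" where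
  "epi \<theta> = {(z, r). \<theta> z \<le> ereal r}"

text \<open>A pair \<open>(a, b)\<close> in \<open>A\<close> stands for the affine function mapping \<open>z\<close> to \<open>a \<bullet> z + b\<close>.\<close>

definition CPWL :: "('a::euclidean_space \<Rightarrow> ereal) \<Rightarrow> bool" where
  "CPWL \<theta> \<longleftrightarrow> edom \<theta> \<noteq> {} \<and> polyhedron (edom \<theta>) \<and>
     (\<exists>A :: ('a \<times> real) set. finite A \<and> A \<noteq> {} \<and>
        (\<forall>z \<in> edom \<theta>. \<theta> z = ereal (Max ((\<lambda>(a, b). a \<bullet> z + b) ` A))))"

definition subdifferential :: "('a::real_inner \<Rightarrow> ereal) \<Rightarrow> 'a \<Rightarrow> 'a set" where
  "subdifferential \<theta> z =
     {v. \<bar>\<theta> z\<bar> \<noteq> \<infinity> \<and> (\<forall>y. \<theta> z + ereal (v \<bullet> (y - z)) \<le> \<theta> y)}"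

definition inv_subdifferential :: "('a::real_inner \<Rightarrow> ereal) \<Rightarrow> 'a \<Rightarrow> 'a set" where
  "inv_subdifferential \<theta> l = {z. l \<in> subdifferential \<theta> z}"

definition normal_cone :: "'a::real_inner set \<Rightarrow> 'a \<Rightarrow> 'a set" where
  "normal_cone C x = {v. x \<in> C \<and> (\<forall>y \<in> C. v \<bullet> (y - x) \<le> 0)}"

definition singular_subdifferential :: "('a::real_inner \<Rightarrow> ereal) \<Rightarrow> 'a \<Rightarrow> 'a set" where
  "singular_subdifferential \<theta> z =
     {v. (v, 0) \<in> normal_cone (epi \<theta>) (z, real_of_ereal (\<theta> z))}"

text \<open>The linear subspace parallel to a nonempty affine set exists and is unique by
  the lemma \<open>affine_parallel_subspace\<close>.\<close>

definition parallel_space :: "'a::real_vector set \<Rightarrow> 'a set" where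
  "parallel_space A = (THE L. subspace L \<and> affine_parallel A L)"

definition S_space :: "('a::real_inner \<Rightarrow> ereal) \<Rightarrow> 'a \<Rightarrow> 'a set" where
  "S_space \<theta> z = parallel_space (affine hull (subdifferential \<theta> z))"

definition nondegenerate :: "('z::euclidean_space \<Rightarrow> ereal) \<Rightarrow> ('x::euclidean_space \<times> 'w \<Rightarrow> 'z) \<Rightarrow> 'x \<Rightarrow> 'w \<Rightarrow> bool" where
  "nondegenerate \<theta> \<Phi> x w \<longleftrightarrow> S_space \<theta> (\<Phi> (x, w)) \<inter> ker_partial_x_adj \<Phi> x w = {0}"

definition objective ::
  "('x::real_inner \<times> 'w \<Rightarrow> real) \<Rightarrow> ('z \<Rightarrow> ereal) \<Rightarrow> ('x \<times> 'w \<Rightarrow> 'z) \<Rightarrow> 'w \<Rightarrow> 'x \<Rightarrow> 'x \<Rightarrow> ereal" where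
  "objective \<phi>\<^sub>0 \<theta> \<Phi> w v x = ereal (\<phi>\<^sub>0 (x, w)) + \<theta> (\<Phi> (x, w)) - ereal (v \<bullet> x)"

definition m_val ::
  "('x::real_inner \<times> 'w \<Rightarrow> real) \<Rightarrow> ('z \<Rightarrow> ereal) \<Rightarrow> ('x \<times> 'w \<Rightarrow> 'z) \<Rightarrow> 'x \<Rightarrow> real \<Rightarrow> 'w \<Rightarrow> 'x \<Rightarrow> ereal" where
  "m_val \<phi>\<^sub>0 \<theta> \<Phi> xb \<gamma> w v = (INF x \<in> cball xb \<gamma>. objective \<phi>\<^sub>0 \<theta> \<Phi> w v x)"

definition M_set ::
  "('x::real_inner \<times> 'w \<Rightarrow> real) \<Rightarrow> ('z \<Rightarrow> ereal) \<Rightarrow> ('x \<times> 'w \<Rightarrow> 'z) \<Rightarrow> 'x \<Rightarrow> real \<Rightarrow> 'w \<Rightarrow> 'x \<Rightarrow> 'x set" where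
  "M_set \<phi>\<^sub>0 \<theta> \<Phi> xb \<gamma> w v =
     {x \<in> cball xb \<gamma>. objective \<phi>\<^sub>0 \<theta> \<Phi> w v x = m_val \<phi>\<^sub>0 \<theta> \<Phi> xb \<gamma> w v \<and>
                      objective \<phi>\<^sub>0 \<theta> \<Phi> w v x < \<infinity>}"

text \<open>The infimum \<open>m_val\<close> is required to be finite near the reference parameters, so that its
  Lipschitz continuity can be stated for the associated real-valued function.\<close>

definition fully_stable ::
  "('x::real_inner \<times> 'w::real_normed_vector \<Rightarrow> real) \<Rightarrow> ('z \<Rightarrow> ereal) \<Rightarrow> ('x \<times> 'w \<Rightarrow> 'z) \<Rightarrow> 'x \<Rightarrow> 'w \<Rightarrow> 'x \<Rightarrow> bool" where
  "fully_stable \<phi>\<^sub>0 \<theta> \<Phi> xb wb vb \<longleftrightarrow>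
     (\<exists>\<gamma> > 0. \<exists>W V. open W \<and> wb \<in> W \<and> open V \<and> vb \<in> V \<and>
        (\<exists>s. (\<forall>w \<in> W. \<forall>v \<in> V. M_set \<phi>\<^sub>0 \<theta> \<Phi> xb \<gamma> w v = {s (w, v)}) \<and>
             (\<exists>K. K-lipschitz_on (W \<times> V) s)) \<and>
        M_set \<phi>\<^sub>0 \<theta> \<Phi> xb \<gamma> wb vb = {xb} \<and>
        (\<forall>w \<in> W. \<forall>v \<in> V. \<bar>m_val \<phi>\<^sub>0 \<theta> \<Phi> xb \<gamma> w v\<bar> \<noteq> \<infinity>) \<and>
        (\<exists>K. K-lipschitz_on (W \<times> V) (\<lambda>(w, v). real_of_ereal (m_val \<phi>\<^sub>0 \<theta> \<Phi> xb \<gamma> w v))))"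

definition Lagr ::
  "('x \<times> 'w \<Rightarrow> real) \<Rightarrow> ('x \<times> 'w \<Rightarrow> 'z::real_inner) \<Rightarrow> 'x \<Rightarrow> 'w \<Rightarrow> 'z \<Rightarrow> real" where
  "Lagr \<phi>\<^sub>0 \<Phi> x w l = \<phi>\<^sub>0 (x, w) + l \<bullet> \<Phi> (x, w)"

definition KKT_solutions ::
  "('x::real_inner \<times> 'w \<Rightarrow> real) \<Rightarrow> ('z::real_inner \<Rightarrow> ereal) \<Rightarrow> ('x \<times> 'w \<Rightarrow> 'z) \<Rightarrow> 'w \<Rightarrow> 'x \<Rightarrow> ('x \<times> 'z) set" where
  "KKT_solutions \<phi>\<^sub>0 \<theta> \<Phi> w v =
     {(x, l). v = gradient (\<lambda>x. Lagr \<phi>\<^sub>0 \<Phi> x w l) x \<and>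
              0 \<in> (\<lambda>z. - \<Phi> (x, w) + z) ` inv_subdifferential \<theta> l}"

definition linearized_KKT_solutions ::
  "('x::euclidean_space \<times> 'w \<Rightarrow> real) \<Rightarrow> ('z::euclidean_space \<Rightarrow> ereal) \<Rightarrow> ('x \<times> 'w \<Rightarrow> 'z) \<Rightarrow>
     'x \<Rightarrow> 'w \<Rightarrow> 'z \<Rightarrow> 'x \<times> 'z \<Rightarrow> ('x \<times> 'z) set" where
  "linearized_KKT_solutions \<phi>\<^sub>0 \<theta> \<Phi> xb wb lb = (\<lambda>(v1, v2).
     {(x, l). v1 = hessian (\<lambda>x. Lagr \<phi>\<^sub>0 \<Phi> x wb lb) xb (x - xb)
                   + adjoint (partial_x \<Phi> xb wb) (l - lb) \<and>
              v2 \<in> (\<lambda>z. - \<Phi> (xb, wb) - partial_x \<Phi> xb wb (x - xb) + z) ` inv_subdifferential \<theta> l})"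

definition lipschitz_localization ::
  "('a::metric_space \<Rightarrow> 'b::metric_space set) \<Rightarrow> 'a \<Rightarrow> 'b \<Rightarrow> bool" where
  "lipschitz_localization T p q \<longleftrightarrow>
     (\<exists>U V. open U \<and> p \<in> U \<and> open V \<and> q \<in> V \<and>
        (\<exists>s. s ` U \<subseteq> V \<and> (\<exists>K. K-lipschitz_on U s) \<and>
             {(u, y). y \<in> T u} \<inter> (U \<times> V) = {(u, s u) | u. u \<in> U}))"

definition strongly_regular ::
  "('x::euclidean_space \<times> 'w \<Rightarrow> real) \<Rightarrow> ('z::euclidean_space \<Rightarrow> ereal) \<Rightarrow> ('x \<times> 'w \<Rightarrow> 'z) \<Rightarrow>
     'x \<Rightarrow> 'w \<Rightarrow> 'z \<Rightarrow> bool" where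
  "strongly_regular \<phi>\<^sub>0 \<theta> \<Phi> xb wb lb \<longleftrightarrow>
     (xb, lb) \<in> KKT_solutions \<phi>\<^sub>0 \<theta> \<Phi> wb 0 \<and>
     lipschitz_localization (linearized_KKT_solutions \<phi>\<^sub>0 \<theta> \<Phi> xb wb lb) (0, 0) (xb, lb)"

end

theory Submission
  imports Defs
begin

text \<open>Let \<open>S\<close> be the affine hull of \<open>\<partial>\<theta>(zb)\<close>, a subspace since it contains 0. Because \<open>\<theta>\<close> is piecewise
  linear, near \<open>zb\<close> it does not change in directions orthogonal to \<open>S\<close>. Nondegeneracy gives a linear
  right inverse \<open>R\<close> of \<open>A = \<nabla>\<^sub>x\<Phi>(xb, wb)\<close> modulo the orthogonal complement of \<open>S\<close>, and with it a local
  chart \<open>\<Psi>\<close> in which \<open>\<Phi>\<close> may be replaced by its linearization. In this chart the nonlinear KKT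
  system and its linearization are smooth equations on the same set which have the same
  strict derivative, so by a contraction argument one has a Lipschitzian localization iff the other
  has. The shift by \<open>R v\<^sub>2\<close> removes the second canonical parameter of the linearized system.

  Given a localization of the KKT system, minimizers exist by compactness and satisfy the KKT
  conditions with multipliers close to \<open>lb\<close>, hence coincide with the localized solutions. Conversely, full
  stability makes the argmin map \<open>s\<close> single-valued, and a KKT point \<open>(x, l)\<close> for the tilt \<open>v\<close> is
  compared with the minimizer for a tilt \<open>v'\<close> satisfying \<open>v' + r s(v') = v + r x\<close>, which exists since \<open>s\<close>
  is minus the gradient of the concave optimal value function; as the objective is prox-regular, \<open>x = s(v)\<close>.\<close>

section \<open>Lipschitzian localizations\<close>

text \<open>The obstacle is that the two systems have different parameters, the tilt and
  \<open>w\<close> on one side and two canonical perturbations on the other, and read the nonsmooth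
  relation at different points. Flatness of \<theta> orthogonally to \<open>S\<close> lets both be
  written as smooth equations over one fixed set, so that all nonsmoothness sits in this set and
  only smooth maps are compared. Equal strict derivatives make the difference of two maps Lipschitz
  with an arbitrarily small constant near the base point, and the comparison is symmetric. The chart
  rests on nondegeneracy, so on the regularity side nondegeneracy has to be read off the linearized
  system before any chart exists. Multipliers at minimizers are not known in advance to be near
  \<open>lb\<close>; an a priori estimate on \<open>S\<close> provides this, together with Lipschitz
  dependence of the multiplier. In the converse the constant r strictly exceeds the prox-regularity
  constant, which forces the two points being compared to coincide.\<close>

definition lip_near :: "('a::metric_space \<Rightarrow> 'b::metric_space) \<Rightarrow> 'a \<Rightarrow> bool" where
  "lip_near f p \<longleftrightarrow> (\<exists>K U. open U \<and> p \<in> U \<and> K-lipschitz_on U f)"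

lemma lip_near_eventually:
  assumes "lip_near f p" "eventually P (nhds p)"
  obtains U K where "open U" "p \<in> U" "K > 0" "K-lipschitz_on U f" "\<And>u. u \<in> U \<Longrightarrow> P u"
proof -
  obtain K U where U: "open U" "p \<in> U" "K-lipschitz_on U f"
    using assms(1) unfolding lip_near_def by blast
  obtain U' where U': "open U'" "p \<in> U'" "\<And>u. u \<in> U' \<Longrightarrow> P u"
    using assms(2) unfolding eventually_nhds by blast
  show thesis
  proof (rule that[of "U \<inter> U'" "max K 1"])
    show "(max K 1)-lipschitz_on (U \<inter> U') f"
      by (rule lipschitz_on_mono[OF U(3)]) auto
  qed (use U U' in auto)
qed

lemma isCont_filterlim_nhds: "isCont f p \<Longrightarrow> filterlim f (nhds (f p)) (nhds p)"
  by (simp add: isCont_def tendsto_at_iff_tendsto_nhds)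

lemma lip_near_isCont: "lip_near f p \<Longrightarrow> isCont f p"
  unfolding lip_near_def
  by (meson continuous_on_eq_continuous_at lipschitz_on_continuous_on)

lemma lip_near_filterlim: "lip_near f p \<Longrightarrow> filterlim f (nhds (f p)) (nhds p)"
  by (intro isCont_filterlim_nhds lip_near_isCont)

lemma lip_near_compose:
  assumes f: "lip_near f p" and g: "lip_near g (f p)"
  shows "lip_near (\<lambda>x. g (f x)) p"
proof -
  obtain K V where V: "open V" "f p \<in> V" "K-lipschitz_on V g"
    using g unfolding lip_near_def by blast
  have "eventually (\<lambda>x. f x \<in> V) (nhds p)"
    using eventually_compose_filterlim[OF eventually_nhds_in_open[OF V(1,2)] lip_near_filterlim[OF f]] .
  then obtain U L where U: "open U" "p \<in> U" "L > 0" "L-lipschitz_on U f" "\<And>u. u \<in> U \<Longrightarrow> f u \<in> V"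
    by (rule lip_near_eventually[OF f]) (rule that)
  have "(K * L)-lipschitz_on U (\<lambda>x. g (f x))"
    using U(5) by (intro lipschitz_on_compose2[OF U(4) lipschitz_on_subset[OF V(3)]]) auto
  then show ?thesis
    unfolding lip_near_def using U by blast
qed

lemma lip_near_Pair:
  assumes f: "lip_near f p" and g: "lip_near g p"
  shows "lip_near (\<lambda>x. (f x, g x)) p"
proof -
  obtain K U where U: "open U" "p \<in> U" "K-lipschitz_on U f"
    using f unfolding lip_near_def by blast
  obtain L V where V: "open V" "p \<in> V" "L-lipschitz_on V g"
    using g unfolding lip_near_def by blast
  have "(sqrt (K\<^sup>2 + L\<^sup>2))-lipschitz_on (U \<inter> V) (\<lambda>x. (f x, g x))"
    using U V by (intro lipschitz_on_Pair) (auto intro: lipschitz_on_subset)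
  then show ?thesis
    unfolding lip_near_def using U V by (meson IntI open_Int)
qed

lemma lip_near_bounded_linear: "bounded_linear f \<Longrightarrow> lip_near f p"
  unfolding lip_near_def by (metis UNIV_I bounded_linear.lipschitz_boundE open_UNIV)

lemma lip_near_id: "lip_near (\<lambda>x. x) p"
  unfolding lip_near_def by (metis UNIV_I lipschitz_on_id open_UNIV)

lemma lip_near_const: "lip_near (\<lambda>x. c) p"
  unfolding lip_near_def by (metis UNIV_I lipschitz_on_constant open_UNIV)

lemma lip_near_add:
  fixes f g :: "'a::metric_space \<Rightarrow> 'b::real_normed_vector"
  assumes "lip_near f p" "lip_near g p"
  shows "lip_near (\<lambda>x. f x + g x) p"
  using lip_near_compose[OF lip_near_Pair[OF assms] lip_near_bounded_linear[of "\<lambda>z. fst z + snd z"]]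
  by (simp add: bounded_linear_add bounded_linear_fst bounded_linear_snd)

lemma lip_near_diff:
  fixes f g :: "'a::metric_space \<Rightarrow> 'b::real_normed_vector"
  assumes "lip_near f p" "lip_near g p"
  shows "lip_near (\<lambda>x. f x - g x) p"
  using lip_near_compose[OF lip_near_Pair[OF assms] lip_near_bounded_linear[of "\<lambda>z. fst z - snd z"]]
  by (simp add: bounded_linear_sub bounded_linear_fst bounded_linear_snd)

lemma lip_near_fst: "lip_near f p \<Longrightarrow> lip_near (\<lambda>x. fst (f x)) p"
  for f :: "_ \<Rightarrow> 'b::real_normed_vector \<times> 'c::real_normed_vector"
  by (rule lip_near_compose) (auto intro: lip_near_bounded_linear bounded_linear_fst)

lemma lip_near_snd: "lip_near f p \<Longrightarrow> lip_near (\<lambda>x. snd (f x)) p"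
  for f :: "_ \<Rightarrow> 'b::real_normed_vector \<times> 'c::real_normed_vector"
  by (rule lip_near_compose) (auto intro: lip_near_bounded_linear bounded_linear_snd)

lemma lip_near_linear:
  fixes h :: "'b::euclidean_space \<Rightarrow> 'c::real_normed_vector"
  shows "linear h \<Longrightarrow> lip_near f p \<Longrightarrow> lip_near (\<lambda>x. h (f x)) p"
  by (rule lip_near_compose) (auto intro: lip_near_bounded_linear linear_conv_bounded_linear[THEN iffD1])

text \<open>Filter form of a localization: existence near \<open>p\<close>, uniqueness near
  \<open>(p, q)\<close>. The target neighborhood comes from uniqueness and is fixed before the
  source neighborhood; continuity of \<open>s\<close> then makes \<open>s\<close> map the latter
  into the former, as the graph identity demands.\<close>

lemma lipschitz_localizationI:
  assumes lip: "lip_near s p" and sp: "s p = q"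
    and ex: "\<forall>\<^sub>F u in nhds p. s u \<in> T u"
    and uniq: "\<forall>\<^sub>F z in nhds (p, q). snd z \<in> T (fst z) \<longrightarrow> snd z = s (fst z)"
  shows "lipschitz_localization T p q"
proof -
  obtain N where N: "open N" "(p, q) \<in> N" "\<And>z. z \<in> N \<Longrightarrow> snd z \<in> T (fst z) \<Longrightarrow> snd z = s (fst z)"
    using uniq unfolding eventually_nhds by blast
  obtain A B where "open A" "open B" "(p, q) \<in> A \<times> B" "A \<times> B \<subseteq> N"
    by (rule open_prod_elim[OF N(1,2)])
  then have AB: "open A" "p \<in> A" "open B" "q \<in> B"
      "\<And>u y. u \<in> A \<Longrightarrow> y \<in> B \<Longrightarrow> y \<in> T u \<Longrightarrow> y = s u"
    using N(3) by force+
  have "eventually (\<lambda>u. s u \<in> B) (nhds p)"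
    using eventually_compose_filterlim[OF eventually_nhds_in_open[OF AB(3,4), folded sp] lip_near_filterlim[OF lip]] .
  then have "eventually (\<lambda>u. s u \<in> T u \<and> s u \<in> B \<and> u \<in> A) (nhds p)"
    using ex AB(1,2) by (auto intro!: eventually_conj eventually_nhds_in_open)
  then obtain U K where U: "open U" "p \<in> U" "K > 0" "K-lipschitz_on U s"
      "\<And>u. u \<in> U \<Longrightarrow> s u \<in> T u \<and> s u \<in> B \<and> u \<in> A"
    by (rule lip_near_eventually[OF lip]) (rule that)
  show ?thesis
    unfolding lipschitz_localization_def
  proof (intro exI conjI)
    show "{(u, y). y \<in> T u} \<inter> U \<times> B = {(u, s u) |u. u \<in> U}"
      using U(5) AB(5) by auto
  qed (use U AB in auto)
qed

text \<open>The assumption \<open>q \<in> T p\<close> anchors the localized map: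
  \<open>(p, q)\<close> lies in the localized graph, hence \<open>s p = q\<close>.\<close>

lemma lipschitz_localizationE:
  assumes "lipschitz_localization T p q" "q \<in> T p"
  obtains s where "lip_near s p" "s p = q" "\<forall>\<^sub>F u in nhds p. s u \<in> T u"
    "\<forall>\<^sub>F z in nhds (p, q). snd z \<in> T (fst z) \<longrightarrow> snd z = s (fst z)"
proof -
  obtain U V s K where U: "open U" "p \<in> U" "open V" "q \<in> V" "s ` U \<subseteq> V" "K-lipschitz_on U s"
     and eq: "{(u, y). y \<in> T u} \<inter> (U \<times> V) = {(u, s u) | u. u \<in> U}"
    using assms(1) unfolding lipschitz_localization_def by blast
  have 1: "s u \<in> T u" if "u \<in> U" for u
    using that eq by blast
  have 2: "y = s u" if "u \<in> U" "y \<in> V" "y \<in> T u" for u y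
    using that eq by blast
  show thesis
  proof (rule that)
    show "lip_near s p" unfolding lip_near_def using U by blast
    show "s p = q" using 2 U assms(2) by metis
    show "\<forall>\<^sub>F u in nhds p. s u \<in> T u" using 1 U by (auto simp: eventually_nhds)
    show "\<forall>\<^sub>F z in nhds (p, q). snd z \<in> T (fst z) \<longrightarrow> snd z = s (fst z)"
      unfolding eventually_nhds using U 2
      by (intro exI[of _ "U \<times> V"]) (auto intro: open_Times)
  qed
qed

text \<open>The map \<open>b u\<close> takes solutions of the old problem at \<open>a u\<close> to solutions of the new problem
  at \<open>u\<close>, with inverse \<open>c u\<close>.\<close>

lemma lipschitz_localization_transport:
  assumes loc: "lipschitz_localization T p q" "q \<in> T p"
    and a: "lip_near a p'" "a p' = p"
    and b: "lip_near (\<lambda>z. b (fst z) (snd z)) (p', q)" "b p' q = q'"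
    and c: "isCont (\<lambda>z. c (fst z) (snd z)) (p', q')" "c p' q' = q"
    and bT: "\<forall>\<^sub>F z in nhds (p', q). snd z \<in> T (a (fst z)) \<longrightarrow> b (fst z) (snd z) \<in> T' (fst z)"
    and cT: "\<forall>\<^sub>F z in nhds (p', q'). snd z \<in> T' (fst z) \<longrightarrow>
               c (fst z) (snd z) \<in> T (a (fst z)) \<and> b (fst z) (c (fst z) (snd z)) = snd z"
  shows "lipschitz_localization T' p' q'"
proof -
  obtain s where s: "lip_near s p" "s p = q" "\<forall>\<^sub>F u in nhds p. s u \<in> T u"
    "\<forall>\<^sub>F z in nhds (p, q). snd z \<in> T (fst z) \<longrightarrow> snd z = s (fst z)"
    using lipschitz_localizationE[OF loc] .
  have sa: "lip_near (\<lambda>u. s (a u)) p'"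
    using lip_near_compose[OF a(1)] a(2) s(1) by simp
  have pair: "lip_near (\<lambda>u. (u, s (a u))) p'"
    by (intro lip_near_Pair lip_near_id sa)
  have pair_lim: "filterlim (\<lambda>u. (u, s (a u))) (nhds (p', q)) (nhds p')"
    using lip_near_filterlim[OF pair] a(2) s(2) by simp
  have a_lim: "filterlim a (nhds p) (nhds p')"
    using lip_near_filterlim[OF a(1)] a(2) by simp
  \<comment> \<open>\<open>c\<close> only has to carry nearby new solutions into the region where
    the old uniqueness holds, so continuity is enough; \<open>b\<close> is composed with
    \<open>s\<close> and has to be Lipschitz.\<close>
  have c_lim: "filterlim (\<lambda>z. c (fst z) (snd z)) (nhds q) (nhds (p', q'))"
    using isCont_filterlim_nhds[OF c(1)] c(2) by simp
  have ac_lim: "filterlim (\<lambda>z. (a (fst z), c (fst z) (snd z))) (nhds (p, q)) (nhds (p', q'))"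
    unfolding nhds_prod[of p q]
  proof (intro filterlim_Pair c_lim)
    show "filterlim (\<lambda>z. a (fst z)) (nhds p) (nhds (p', q'))"
      unfolding nhds_prod
      by (rule filterlim_compose[OF a_lim filterlim_fst])
  qed
  show ?thesis
  proof (rule lipschitz_localizationI)
    show "lip_near (\<lambda>u. b u (s (a u))) p'"
      using lip_near_compose[OF pair, of "\<lambda>z. b (fst z) (snd z)"] b(1) a(2) s(2) by simp
    show "b p' (s (a p')) = q'"
      using a b s by simp
    show "\<forall>\<^sub>F u in nhds p'. b u (s (a u)) \<in> T' u"
      using eventually_compose_filterlim[OF bT pair_lim] eventually_compose_filterlim[OF s(3) a_lim]
      by eventually_elim auto
    show "\<forall>\<^sub>F z in nhds (p', q'). snd z \<in> T' (fst z) \<longrightarrow> snd z = b (fst z) (s (a (fst z)))"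
      using cT eventually_compose_filterlim[OF s(4) ac_lim]
      by eventually_elim (metis fst_conv snd_conv)
  qed
qed

lemma isCont_within_ball:
  fixes f :: "'a::metric_space \<Rightarrow> 'b::metric_space"
  assumes "isCont f p" "e > 0"
  shows "\<forall>\<^sub>F x in nhds p. dist (f x) (f p) < e"
  using isCont_filterlim_nhds[OF assms(1)] assms(2) by (simp add: tendsto_iff)

text \<open>With \<open>e = g - f\<close> and \<open>s\<close> the localized inverse of \<open>f\<close> on \<open>Q\<close>, the equation \<open>g q = p\<close>
  becomes the fixed point equation \<open>y = p - e (s y)\<close> for \<open>y = f q\<close>.\<close>

lemma lipschitz_localization_perturb:
  fixes f g :: "'a::real_normed_vector \<Rightarrow> 'b::banach"
  assumes loc: "lipschitz_localization (\<lambda>p. {q \<in> Q. f q = p}) (f q0) q0" and q0: "q0 \<in> Q"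
    and f: "isCont f q0"
    and small: "\<And>\<epsilon>. \<epsilon> > 0 \<Longrightarrow> \<exists>\<delta>>0. \<forall>a\<in>ball q0 \<delta>. \<forall>b\<in>ball q0 \<delta>.
        norm ((g a - g b) - (f a - f b)) \<le> \<epsilon> * norm (a - b)"
  shows "lipschitz_localization (\<lambda>p. {q \<in> Q. g q = p}) (g q0) q0"
proof -
  define e where "e q = g q - f q" for q
  obtain s where s: "lip_near s (f q0)" "s (f q0) = q0" "\<forall>\<^sub>F u in nhds (f q0). s u \<in> {q \<in> Q. f q = u}"
    "\<forall>\<^sub>F z in nhds (f q0, q0). snd z \<in> {q \<in> Q. f q = fst z} \<longrightarrow> snd z = s (fst z)"
    using lipschitz_localizationE[OF loc] q0 by auto
  obtain U K where U: "open U" "f q0 \<in> U" "K > 0" "K-lipschitz_on U s"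
      "\<And>u. u \<in> U \<Longrightarrow> s u \<in> {q \<in> Q. f q = u}"
    by (rule lip_near_eventually[OF s(1,3)]) (rule that)
  \<comment> \<open>The constant 1/(2 K) is matched to the Lipschitz constant K of \<open>s\<close>,
    so that \<open>e\<close> after \<open>s\<close> is Lipschitz with constant 1/2.\<close>
  obtain \<delta> where \<delta>: "\<delta> > 0" and e_lip: "\<And>a b. a \<in> ball q0 \<delta> \<Longrightarrow> b \<in> ball q0 \<delta> \<Longrightarrow>
      norm (e a - e b) \<le> 1 / (2 * K) * norm (a - b)"
    using small[of "1 / (2 * K)"] U(3) by (force simp: e_def algebra_simps)
  obtain \<rho>0 where \<rho>0: "\<rho>0 > 0" "cball (f q0) \<rho>0 \<subseteq> U"
    using U(1,2) open_contains_cball by metis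
  \<comment> \<open>The second bound yields \<open>K * \<rho> < \<delta>\<close>: \<open>s\<close>
    then maps the ball of radius \<rho> into the ball where \<open>e\<close> has its small Lipschitz
    constant.\<close>
  define \<rho> where "\<rho> = min \<rho>0 (\<delta> / (2 * K))"
  have \<rho>: "\<rho> > 0" "cball (f q0) \<rho> \<subseteq> U" "K * \<rho> < \<delta>"
  proof -
    show "\<rho> > 0" using \<rho>0 \<delta> U(3) by (simp add: \<rho>_def)
    show "cball (f q0) \<rho> \<subseteq> U" using \<rho>0 by (force simp: \<rho>_def)
    have "K * \<rho> \<le> K * (\<delta> / (2 * K))" using U(3) by (intro mult_left_mono) (auto simp: \<rho>_def)
    also have "\<dots> < \<delta>" using U(3) \<delta> by simp
    finally show "K * \<rho> < \<delta>" .
  qed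
  let ?B = "cball (f q0) \<rho>"
  have s_dist: "dist (s y) (s z) \<le> K * dist y z" if "y \<in> ?B" "z \<in> ?B" for y z
    using lipschitz_onD[OF U(4)] that \<rho>(2) by blast
  have s_ball: "s y \<in> ball q0 \<delta>" if "y \<in> ?B" for y
  proof -
    have "dist (s y) (s (f q0)) \<le> K * dist y (f q0)" using that \<rho> by (intro s_dist) auto
    also have "\<dots> \<le> K * \<rho>" using that U(3) by (intro mult_left_mono) (auto simp: dist_commute)
    finally show ?thesis using \<rho>(3) s(2) by (simp add: dist_commute)
  qed
  have es: "norm (e (s y) - e (s z)) \<le> 1/2 * norm (y - z)" if "y \<in> ?B" "z \<in> ?B" for y z
  proof -
    have "norm (e (s y) - e (s z)) \<le> 1 / (2 * K) * norm (s y - s z)"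
      using that by (intro e_lip s_ball)
    also have "\<dots> \<le> 1 / (2 * K) * (K * norm (y - z))"
      using s_dist[OF that] U(3) by (intro mult_left_mono) (auto simp: dist_norm)
    finally show ?thesis using U(3) by simp
  qed
  \<comment> \<open>The ball is mapped into itself: \<rho>/2 comes from \<open>p\<close> and at most
    \<rho>/2 from the half-contraction.\<close>
  have ex: "\<exists>!y\<in>?B. p - e (s y) = y" if p: "p \<in> ball (g q0) (\<rho>/2)" for p
  proof (rule Banach_fix)
    show "complete ?B" by (simp add: complete_eq_closed)
    show "?B \<noteq> {}" using \<rho> by auto
    show "(\<lambda>y. p - e (s y)) ` ?B \<subseteq> ?B"
    proof clarify
      fix y assume y: "y \<in> ?B"
      have "norm (p - e (s y) - f q0) = norm ((p - g q0) - (e (s y) - e (s (f q0))))"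
        using s(2) by (simp add: e_def algebra_simps)
      also have "\<dots> \<le> norm (p - g q0) + norm (e (s y) - e (s (f q0)))"
        by (rule norm_triangle_ineq4)
      also have "\<dots> \<le> \<rho>/2 + 1/2 * norm (y - f q0)"
        using es[OF y, of "f q0"] \<rho> p by (intro add_mono) (auto simp: dist_norm norm_minus_commute)
      also have "\<dots> \<le> \<rho>" using y by (auto simp: dist_norm norm_minus_commute)
      finally show "p - e (s y) \<in> ?B" by (simp add: dist_norm norm_minus_commute)
    qed
    show "dist (p - e (s y)) (p - e (s z)) \<le> 1/2 * dist y z" if "y \<in> ?B" "z \<in> ?B" for y z
      using es[OF that] by (simp add: dist_norm norm_minus_commute)
  qed auto
  define Y where "Y p = (THE y. y \<in> ?B \<and> p - e (s y) = y)" for p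
  have Y: "Y p \<in> ?B \<and> p - e (s (Y p)) = Y p" if "p \<in> ball (g q0) (\<rho>/2)" for p
    unfolding Y_def by (rule theI'[OF ex[OF that]])
  have Y_eq: "y = Y p" if "p \<in> ball (g q0) (\<rho>/2)" "y \<in> ?B" "p - e (s y) = y" for p y
    using ex[OF that(1)] Y[OF that(1)] that by blast
  have Y_lip: "dist (Y p) (Y p') \<le> 2 * dist p p'"
    if "p \<in> ball (g q0) (\<rho>/2)" "p' \<in> ball (g q0) (\<rho>/2)" for p p'
  proof -
    have "norm (Y p - Y p') = norm ((p - p') - (e (s (Y p)) - e (s (Y p'))))"
    proof -
      have "Y p = p - e (s (Y p))" "Y p' = p' - e (s (Y p'))"
        using Y[OF that(1)] Y[OF that(2)] by metis+
      then have "Y p - Y p' = (p - e (s (Y p))) - (p' - e (s (Y p')))"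
        by (rule arg_cong2)
      also have "\<dots> = (p - p') - (e (s (Y p)) - e (s (Y p')))"
        by (simp add: algebra_simps)
      finally show ?thesis by (rule arg_cong)
    qed
    also have "\<dots> \<le> norm (p - p') + norm (e (s (Y p)) - e (s (Y p')))"
      by (rule norm_triangle_ineq4)
    also have "\<dots> \<le> norm (p - p') + 1/2 * norm (Y p - Y p')"
      using es Y that by simp
    finally show ?thesis by (simp add: dist_norm)
  qed
  have Yq0: "Y (g q0) = f q0"
    using Y_eq[of "g q0" "f q0"] \<rho> s(2) by (simp add: e_def)
  have Y_near: "lip_near Y (g q0)"
    unfolding lip_near_def
    using \<rho> Y_lip by (intro exI[of _ 2] exI[of _ "ball (g q0) (\<rho>/2)"]) (auto intro: lipschitz_onI)
  have ev: "\<forall>\<^sub>F p in nhds (g q0). p \<in> ball (g q0) (\<rho>/2)"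
    using \<rho> by (intro eventually_nhds_in_open) auto
  show ?thesis
  proof (rule lipschitz_localizationI)
    show "lip_near (\<lambda>p. s (Y p)) (g q0)"
      using lip_near_compose[OF Y_near] Yq0 s(1) by simp
    show "s (Y (g q0)) = q0" using Yq0 s(2) by simp
    show "\<forall>\<^sub>F p in nhds (g q0). s (Y p) \<in> {q \<in> Q. g q = p}"
      using ev
    proof eventually_elim
      case (elim p)
      have "s (Y p) \<in> Q" "f (s (Y p)) = Y p" using U(5) \<rho>(2) Y[OF elim] by blast+
      moreover have "g (s (Y p)) = f (s (Y p)) + e (s (Y p))" by (simp add: e_def)
      moreover have "Y p + e (s (Y p)) = p" using Y[OF elim] by (simp only: diff_eq_eq)
      ultimately show ?case by simp
    qed
    have lim: "filterlim (\<lambda>z. (f (snd z), snd z)) (nhds (f q0, q0)) (nhds (g q0, q0))"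
      unfolding nhds_prod
      by (intro filterlim_Pair filterlim_snd filterlim_compose[OF _ filterlim_snd] isCont_filterlim_nhds f)
    have fB: "\<forall>\<^sub>F z in nhds (g q0, q0). f (snd z) \<in> ?B"
    proof -
      have "\<forall>\<^sub>F q in nhds q0. f q \<in> ?B"
        using isCont_within_ball[OF f \<rho>(1)] by eventually_elim (simp add: dist_commute)
      then show ?thesis
        unfolding nhds_prod by (rule eventually_compose_filterlim[OF _ filterlim_snd])
    qed
    have ev': "\<forall>\<^sub>F z in nhds (g q0, q0). fst z \<in> ball (g q0) (\<rho>/2)"
      unfolding nhds_prod using eventually_compose_filterlim[OF ev filterlim_fst] .
    show "\<forall>\<^sub>F z in nhds (g q0, q0). snd z \<in> {q \<in> Q. g q = fst z} \<longrightarrow> snd z = s (Y (fst z))"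
      using eventually_compose_filterlim[OF s(4) lim] fB ev'
    proof eventually_elim
      case (elim z)
      show ?case
      proof
        assume z: "snd z \<in> {q \<in> Q. g q = fst z}"
        \<comment> \<open>Uniqueness for \<open>f\<close> recovers the point from its value under
          \<open>f\<close>, and this value is a fixed point of the contraction, of which there is
          only one.\<close>
        then have sz: "snd z = s (f (snd z))" using elim(1) by auto
        have "fst z - e (snd z) = f (snd z)"
          using z by (simp add: e_def)
        then have "f (snd z) = Y (fst z)"
          using Y_eq[OF elim(3,2)] sz by metis
        then show "snd z = s (Y (fst z))"
          using sz by metis
      qed
    qed
  qed
qed

section \<open>Strict derivatives\<close>

text \<open>The estimate is uniform over all pairs of points near \<open>a\<close>, not only over
  pairs that contain \<open>a\<close>; this is what a contraction argument needs.\<close>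

definition strict_deriv :: "('a::real_normed_vector \<Rightarrow> 'b::real_normed_vector) \<Rightarrow> ('a \<Rightarrow> 'b) \<Rightarrow> 'a \<Rightarrow> bool" where
  "strict_deriv f f' a \<longleftrightarrow> bounded_linear f' \<and>
     (\<forall>\<epsilon>>0. \<exists>\<delta>>0. \<forall>x\<in>ball a \<delta>. \<forall>y\<in>ball a \<delta>. norm (f x - f y - f' (x - y)) \<le> \<epsilon> * norm (x - y))"

lemma strict_deriv_bounded_linear: "strict_deriv f f' a \<Longrightarrow> bounded_linear f'"
  by (simp add: strict_deriv_def)

lemma strict_derivD:
  assumes "strict_deriv f f' a" "\<epsilon> > 0"
  obtains \<delta> where "\<delta> > 0"
    "\<And>x y. x \<in> ball a \<delta> \<Longrightarrow> y \<in> ball a \<delta> \<Longrightarrow> norm (f x - f y - f' (x - y)) \<le> \<epsilon> * norm (x - y)"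
  using assms unfolding strict_deriv_def by meson

lemma strict_deriv_lip_near:
  assumes "strict_deriv f f' a"
  shows "lip_near f a"
proof -
  interpret bounded_linear f' using strict_deriv_bounded_linear[OF assms] .
  obtain K where K: "\<And>x. norm (f' x) \<le> norm x * K" using bounded by blast
  obtain \<delta> where \<delta>: "\<delta> > 0"
    "\<And>x y. x \<in> ball a \<delta> \<Longrightarrow> y \<in> ball a \<delta> \<Longrightarrow> norm (f x - f y - f' (x - y)) \<le> 1 * norm (x - y)"
    by (rule strict_derivD[OF assms zero_less_one]) (rule that)
  have "dist (f x) (f y) \<le> (\<bar>K\<bar> + 1) * dist x y" if "x \<in> ball a \<delta>" "y \<in> ball a \<delta>" for x y
  proof -
    have "norm (f x - f y) \<le> norm (f' (x - y)) + norm (f x - f y - f' (x - y))"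
      by (rule norm_triangle_sub)
    also have "\<dots> \<le> norm (x - y) * K + 1 * norm (x - y)"
      using K \<delta>(2)[OF that] by (intro add_mono)
    also have "\<dots> \<le> (\<bar>K\<bar> + 1) * norm (x - y)"
      using mult_right_mono[OF abs_ge_self[of K] norm_ge_zero[of "x - y"]] by (simp add: algebra_simps)
    finally show ?thesis by (simp add: dist_norm)
  qed
  then show ?thesis
    unfolding lip_near_def using \<delta>(1)
    by (intro exI[of _ "\<bar>K\<bar> + 1"] exI[of _ "ball a \<delta>"]) (auto intro!: lipschitz_onI)
qed

lemma strict_deriv_has_derivative:
  assumes "strict_deriv f f' a"
  shows "(f has_derivative f') (at a)"
  unfolding has_derivative_at_alt
proof (intro conjI allI impI)
  show "bounded_linear f'" using strict_deriv_bounded_linear[OF assms] .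
  fix e :: real assume "e > 0"
  then obtain \<delta> where "\<delta> > 0"
    "\<And>x y. x \<in> ball a \<delta> \<Longrightarrow> y \<in> ball a \<delta> \<Longrightarrow> norm (f x - f y - f' (x - y)) \<le> e * norm (x - y)"
    using strict_derivD[OF assms] by blast
  then show "\<exists>d>0. \<forall>y. norm (y - a) < d \<longrightarrow> norm (f y - f a - f' (y - a)) \<le> e * norm (y - a)"
    by (intro exI[of _ \<delta>]) (auto simp: dist_norm norm_minus_commute)
qed

lemma strict_deriv_linear: "bounded_linear f \<Longrightarrow> strict_deriv f f a"
  unfolding strict_deriv_def by (auto simp: linear_simps(2)[of f] intro: zero_less_one)

lemma strict_deriv_compose:
  assumes f: "strict_deriv f f' a" and g: "strict_deriv g g' (f a)"
  shows "strict_deriv (\<lambda>x. g (f x)) (\<lambda>x. g' (f' x)) a"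
proof -
  interpret F: bounded_linear f' using strict_deriv_bounded_linear[OF f] .
  interpret G: bounded_linear g' using strict_deriv_bounded_linear[OF g] .
  obtain K where K: "K > 0" "\<And>x. norm (g' x) \<le> norm x * K" using G.pos_bounded by blast
  obtain L U where L: "open U" "a \<in> U" "L-lipschitz_on U f"
    using strict_deriv_lip_near[OF f] unfolding lip_near_def by blast
  show ?thesis
    unfolding strict_deriv_def
  proof (intro conjI allI impI)
    show "bounded_linear (\<lambda>x. g' (f' x))"
      using bounded_linear_compose[OF G.bounded_linear_axioms F.bounded_linear_axioms] .
    fix \<epsilon> :: real assume \<epsilon>: "\<epsilon> > 0"
    \<comment> \<open>Each of the two factors receives half of \<epsilon>; the added 1 keeps the
      divisor positive when L = 0.\<close>
    have "\<epsilon> / (2 * (\<bar>L\<bar> + 1)) > 0" using \<epsilon> by (simp add: add_nonneg_pos)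
    then obtain \<delta>1 where \<delta>1: "\<delta>1 > 0" "\<And>x y. x \<in> ball (f a) \<delta>1 \<Longrightarrow> y \<in> ball (f a) \<delta>1 \<Longrightarrow>
        norm (g x - g y - g' (x - y)) \<le> \<epsilon> / (2 * (\<bar>L\<bar> + 1)) * norm (x - y)"
      using strict_derivD[OF g] by blast
    obtain \<delta>2 where \<delta>2: "\<delta>2 > 0" "\<And>x y. x \<in> ball a \<delta>2 \<Longrightarrow> y \<in> ball a \<delta>2 \<Longrightarrow>
        norm (f x - f y - f' (x - y)) \<le> \<epsilon> / (2 * K) * norm (x - y)"
      using strict_derivD[OF f, of "\<epsilon> / (2 * K)"] \<epsilon> K(1) by auto
    have "\<forall>\<^sub>F x in nhds a. x \<in> U \<and> f x \<in> ball (f a) \<delta>1 \<and> x \<in> ball a \<delta>2"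
      using isCont_within_ball[OF lip_near_isCont[OF strict_deriv_lip_near[OF f]] \<delta>1(1)] L \<delta>2(1)
      by (intro eventually_conj eventually_nhds_in_open) (auto simp: dist_commute)
    then obtain \<delta> where \<delta>: "\<delta> > 0" "\<And>x. x \<in> ball a \<delta> \<Longrightarrow> x \<in> U \<and> f x \<in> ball (f a) \<delta>1 \<and> x \<in> ball a \<delta>2"
      unfolding eventually_nhds_metric by (auto simp: dist_commute)
    have "norm (g (f x) - g (f y) - g' (f' (x - y))) \<le> \<epsilon> * norm (x - y)"
      if xy: "x \<in> ball a \<delta>" "y \<in> ball a \<delta>" for x y
    proof -
      have "g (f x) - g (f y) - g' (f' (x - y)) =
         (g (f x) - g (f y) - g' (f x - f y)) + g' (f x - f y - f' (x - y))"
        by (simp add: G.diff)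
      then have "norm (g (f x) - g (f y) - g' (f' (x - y))) \<le>
         norm (g (f x) - g (f y) - g' (f x - f y)) + norm (g' (f x - f y - f' (x - y)))"
        by (metis norm_triangle_ineq)
      also have "\<dots> \<le> \<epsilon> / (2 * (\<bar>L\<bar> + 1)) * norm (f x - f y) + norm (f x - f y - f' (x - y)) * K"
        using \<delta>1(2) \<delta>(2) xy K(2) by (intro add_mono) auto
      also have "\<dots> \<le> \<epsilon> / (2 * (\<bar>L\<bar> + 1)) * ((\<bar>L\<bar> + 1) * norm (x - y))
          + (\<epsilon> / (2 * K) * norm (x - y)) * K"
      proof (intro add_mono mult_left_mono mult_right_mono)
        have "norm (f x - f y) \<le> L * norm (x - y)"
          using lipschitz_onD[OF L(3)] \<delta>(2) xy by (simp add: dist_norm)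
        also have "\<dots> \<le> (\<bar>L\<bar> + 1) * norm (x - y)" by (intro mult_right_mono) auto
        finally show "norm (f x - f y) \<le> (\<bar>L\<bar> + 1) * norm (x - y)" .
        show "norm (f x - f y - f' (x - y)) \<le> \<epsilon> / (2 * K) * norm (x - y)"
          using \<delta>2(2) \<delta>(2) xy by blast
      qed (use \<epsilon> K in auto)
      also have "\<dots> = \<epsilon> * norm (x - y)"
        using K(1) by (simp add: field_simps abs_add_one_gt_zero[THEN less_imp_neq, symmetric])
      finally show ?thesis .
    qed
    then show "\<exists>\<delta>>0. \<forall>x\<in>ball a \<delta>. \<forall>y\<in>ball a \<delta>.
        norm (g (f x) - g (f y) - g' (f' (x - y))) \<le> \<epsilon> * norm (x - y)"
      using \<delta>(1) by blast
  qed
qed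

lemma strict_deriv_add:
  assumes f: "strict_deriv f f' a" and g: "strict_deriv g g' a"
  shows "strict_deriv (\<lambda>x. f x + g x) (\<lambda>x. f' x + g' x) a"
  unfolding strict_deriv_def
proof (intro conjI allI impI)
  show "bounded_linear (\<lambda>x. f' x + g' x)"
    using assms by (intro bounded_linear_add) (auto dest: strict_deriv_bounded_linear)
  fix \<epsilon> :: real assume \<epsilon>: "\<epsilon> > 0"
  then have e2: "\<epsilon> / 2 > 0" by simp
  obtain \<delta>1 where \<delta>1: "\<delta>1 > 0" "\<And>x y. x \<in> ball a \<delta>1 \<Longrightarrow> y \<in> ball a \<delta>1 \<Longrightarrow>
        norm (f x - f y - f' (x - y)) \<le> \<epsilon> / 2 * norm (x - y)"
    using strict_derivD[OF f e2] by blast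
  obtain \<delta>2 where \<delta>2: "\<delta>2 > 0" "\<And>x y. x \<in> ball a \<delta>2 \<Longrightarrow> y \<in> ball a \<delta>2 \<Longrightarrow>
        norm (g x - g y - g' (x - y)) \<le> \<epsilon> / 2 * norm (x - y)"
    using strict_derivD[OF g e2] by blast
  have "norm (f x + g x - (f y + g y) - (f' (x - y) + g' (x - y))) \<le> \<epsilon> * norm (x - y)"
    if "x \<in> ball a (min \<delta>1 \<delta>2)" "y \<in> ball a (min \<delta>1 \<delta>2)" for x y
  proof -
    have "norm (f x + g x - (f y + g y) - (f' (x - y) + g' (x - y)))
      = norm ((f x - f y - f' (x - y)) + (g x - g y - g' (x - y)))"
      by (simp add: algebra_simps)
    also have "\<dots> \<le> \<epsilon> / 2 * norm (x - y) + \<epsilon> / 2 * norm (x - y)"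
      using that \<delta>1(2)[of x y] \<delta>2(2)[of x y]
      by (intro order_trans[OF norm_triangle_ineq] add_mono) auto
    finally show ?thesis by simp
  qed
  then show "\<exists>\<delta>>0. \<forall>x\<in>ball a \<delta>. \<forall>y\<in>ball a \<delta>.
        norm (f x + g x - (f y + g y) - (f' (x - y) + g' (x - y))) \<le> \<epsilon> * norm (x - y)"
    using \<delta>1(1) \<delta>2(1) by (intro exI[of _ "min \<delta>1 \<delta>2"]) auto
qed

lemma strict_deriv_const: "strict_deriv (\<lambda>x. c) (\<lambda>x. 0) a"
  unfolding strict_deriv_def by (auto intro: zero_less_one)

lemma strict_deriv_Pair:
  assumes f: "strict_deriv f f' a" and g: "strict_deriv g g' a"
  shows "strict_deriv (\<lambda>x. (f x, g x)) (\<lambda>x. (f' x, g' x)) a"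
proof -
  have 1: "bounded_linear (\<lambda>x. (x, 0))" "bounded_linear (\<lambda>x. (0, x))"
    by (auto intro!: bounded_linear_Pair bounded_linear_ident bounded_linear_zero)
  show ?thesis
    using strict_deriv_add[OF strict_deriv_compose[OF f strict_deriv_linear[OF 1(1)]]
        strict_deriv_compose[OF g strict_deriv_linear[OF 1(2)]]] by simp
qed

text \<open>The mean value inequality on the segment between the two points bounds the error by the
  supremum of the operator norms of \<open>D z - D a\<close> over a ball, which is small by
  continuity of \<open>D\<close>.\<close>

lemma strict_deriv_C1:
  fixes f :: "'a::real_normed_vector \<Rightarrow> 'b::real_normed_vector" and D :: "'a \<Rightarrow> 'a \<Rightarrow>\<^sub>L 'b"
  assumes U: "open U" "a \<in> U"
    and D: "\<And>p. p \<in> U \<Longrightarrow> (f has_derivative blinfun_apply (D p)) (at p)"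
    and cont: "continuous_on U D"
  shows "strict_deriv f (blinfun_apply (D a)) a"
  unfolding strict_deriv_def
proof (intro conjI allI impI)
  show "bounded_linear (blinfun_apply (D a))" by (rule blinfun.bounded_linear_right)
  fix \<epsilon> :: real assume \<epsilon>: "\<epsilon> > 0"
  have "isCont D a" using cont U by (simp add: continuous_on_eq_continuous_at)
  from isCont_within_ball[OF this \<epsilon>] eventually_nhds_in_open[OF U]
  have "\<forall>\<^sub>F x in nhds a. dist (D x) (D a) < \<epsilon> \<and> x \<in> U" by (rule eventually_conj)
  then obtain \<delta> where \<delta>: "\<delta> > 0" "\<And>x. x \<in> ball a \<delta> \<Longrightarrow> dist (D x) (D a) < \<epsilon> \<and> x \<in> U"
    unfolding eventually_nhds_metric by (auto simp: dist_commute)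
  have "norm (f x - f y - D a (x - y)) \<le> \<epsilon> * norm (x - y)"
    if xy: "x \<in> ball a \<delta>" "y \<in> ball a \<delta>" for x y
  proof -
    have "norm (f x - f y - D a (x - y)) \<le> norm (x - y) * \<epsilon>"
    proof (rule differentiable_bound_linearization)
      show "y + t *\<^sub>R (x - y) \<in> ball a \<delta>" if "t \<in> {0..1}" for t
        using convexD_alt[OF convex_ball xy(2,1), of t] that by (simp add: algebra_simps)
      show "(f has_derivative D z) (at z within ball a \<delta>)" if "z \<in> ball a \<delta>" for z
        using D \<delta>(2) that by (blast intro: has_derivative_at_withinI)
      show "onorm (blinfun_apply (D z) - blinfun_apply (D a)) \<le> \<epsilon>" if "z \<in> ball a \<delta>" for z
      proof -
        have "blinfun_apply (D z) - blinfun_apply (D a) = blinfun_apply (D z - D a)"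
          by (auto simp: fun_eq_iff blinfun.diff_left)
        then show ?thesis using \<delta>(2)[OF that] by (simp add: norm_blinfun.rep_eq[symmetric] dist_norm)
      qed
      show "a \<in> ball a \<delta>" using \<delta>(1) by simp
    qed
    then show ?thesis by (simp add: mult.commute)
  qed
  then show "\<exists>\<delta>>0. \<forall>x\<in>ball a \<delta>. \<forall>y\<in>ball a \<delta>. norm (f x - f y - D a (x - y)) \<le> \<epsilon> * norm (x - y)"
    using \<delta>(1) by blast
qed

lemma strict_deriv_bilinear:
  assumes h: "bounded_bilinear h" and f: "strict_deriv f f' a" and g: "strict_deriv g g' a"
  shows "strict_deriv (\<lambda>x. h (f x) (g x)) (\<lambda>x. h (f a) (g' x) + h (f' x) (g a)) a"
proof -
  interpret bounded_bilinear h by (rule h)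
  obtain K where K: "K > 0" "\<And>x y. norm (h x y) \<le> norm x * norm y * K" using pos_bounded by blast
  have "strict_deriv (\<lambda>z. h (fst z) (snd z)) (\<lambda>u. h (f a) (snd u) + h (fst u) (g a)) (f a, g a)"
    unfolding strict_deriv_def
  proof (intro conjI allI impI)
    show "bounded_linear (\<lambda>u. h (f a) (snd u) + h (fst u) (g a))"
      by (intro bounded_linear_add bounded_linear_compose[OF bounded_linear_right bounded_linear_snd]
          bounded_linear_compose[OF bounded_linear_left bounded_linear_fst])
    fix \<epsilon> :: real assume \<epsilon>: "\<epsilon> > 0"
    define \<delta> where "\<delta> = \<epsilon> / (2 * K)"
    have \<delta>: "\<delta> > 0" "\<delta> * K * 2 = \<epsilon>" using \<epsilon> K by (auto simp: \<delta>_def)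
    have "norm (h (fst x) (snd x) - h (fst y) (snd y)
          - (h (f a) (snd (x - y)) + h (fst (x - y)) (g a))) \<le> \<epsilon> * norm (x - y)"
      if xy: "x \<in> ball (f a, g a) \<delta>" "y \<in> ball (f a, g a) \<delta>" for x y
    proof -
      have b: "norm (fst x - f a) \<le> \<delta>" "norm (snd y - g a) \<le> \<delta>"
        using xy norm_fst_le[of "f a - fst x" "g a - snd x"] norm_snd_le[of "g a - snd y" "f a - fst y"]
        by (auto simp: dist_norm norm_minus_commute[of _ "f a"] norm_minus_commute[of _ "g a"] minus_prod_def)
      have n: "norm (fst (x - y)) \<le> norm (x - y)" "norm (snd (x - y)) \<le> norm (x - y)"
        by (metis norm_fst_le norm_snd_le prod.collapse)+
      \<comment> \<open>Telescoping through the mixed term of first slot \<open>x\<close> and second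
        slot \<open>y\<close>; each remainder then contains a factor that is small near the base
        point.\<close>
      have "h (fst x) (snd x) - h (fst y) (snd y) - (h (f a) (snd (x - y)) + h (fst (x - y)) (g a))
        = h (fst x - f a) (snd (x - y)) + h (fst (x - y)) (snd y - g a)"
        by (simp add: diff_left diff_right algebra_simps)
      then have "norm (h (fst x) (snd x) - h (fst y) (snd y)
          - (h (f a) (snd (x - y)) + h (fst (x - y)) (g a)))
        \<le> norm (h (fst x - f a) (snd (x - y))) + norm (h (fst (x - y)) (snd y - g a))"
        by (metis norm_triangle_ineq)
      also have "\<dots> \<le> norm (fst x - f a) * norm (snd (x - y)) * K
           + norm (fst (x - y)) * norm (snd y - g a) * K"
        by (intro add_mono K)
      also have "\<dots> \<le> \<delta> * norm (x - y) * K + norm (x - y) * \<delta> * K"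
        using b n K(1) \<delta> by (intro add_mono mult_right_mono mult_mono) auto
      also have "\<dots> = (\<delta> * K * 2) * norm (x - y)" by (simp add: algebra_simps)
      finally show ?thesis using \<delta> by simp
    qed
    then show "\<exists>\<delta>>0. \<forall>x\<in>ball (f a, g a) \<delta>. \<forall>y\<in>ball (f a, g a) \<delta>.
      norm (h (fst x) (snd x) - h (fst y) (snd y)
          - (h (f a) (snd (x - y)) + h (fst (x - y)) (g a))) \<le> \<epsilon> * norm (x - y)"
      using \<delta>(1) by blast
  qed
  from strict_deriv_compose[OF strict_deriv_Pair[OF f g] this] show ?thesis by simp
qed

lemma strict_deriv_sum:
  assumes "\<And>i. i \<in> I \<Longrightarrow> strict_deriv (f i) (f' i) a"
  shows "strict_deriv (\<lambda>x. \<Sum>i\<in>I. f i x) (\<lambda>x. \<Sum>i\<in>I. f' i x) a"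
  using assms
proof (induction I rule: infinite_finite_induct)
  case (insert i I)
  then show ?case using strict_deriv_add[of "f i" "f' i" a] by simp
qed (simp_all add: strict_deriv_const)

section \<open>Surjectivity of the identity plus a multiple of a supergradient map\<close>

text \<open>Minimize the strongly convex function \<open>-m(v) + \<parallel>y - v\<parallel>\<^sup>2 / 2r\<close>: the bound on \<open>y\<close> keeps the
  minimizer off the sphere, and its stationarity condition is the claim.\<close>

lemma minty_surjective:
  fixes m :: "'a::euclidean_space \<Rightarrow> real" and s :: "'a \<Rightarrow> 'a"
  assumes \<rho>: "\<rho> > 0" and r: "r > 0"
    and m: "continuous_on (cball 0 \<rho>) m" and s: "continuous_on (cball 0 \<rho>) s"
    and super: "\<And>v v'. v \<in> cball 0 \<rho> \<Longrightarrow> v' \<in> cball 0 \<rho> \<Longrightarrow> m v' \<le> m v - (v' - v) \<bullet> s v"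
    and y: "norm (y - r *\<^sub>R s 0) < \<rho> / 2"
  shows "\<exists>v\<in>ball 0 \<rho>. v + r *\<^sub>R s v = y"
proof -
  define J where "J v = (norm (y - v))\<^sup>2 - 2 * r * m v" for v
  have expand: "(norm (y - v))\<^sup>2 = (norm y)\<^sup>2 - 2 * (y \<bullet> v) + (norm v)\<^sup>2" for v
    by (simp add: power2_norm_eq_inner inner_diff inner_commute algebra_simps)
  have "continuous_on (cball 0 \<rho>) J"
    unfolding J_def by (intro continuous_intros m)
  then obtain v where v: "v \<in> cball 0 \<rho>" "\<And>u. u \<in> cball 0 \<rho> \<Longrightarrow> J v \<le> J u"
    using continuous_attains_inf[of "cball 0 \<rho>" J] \<rho> by auto
  have "norm v \<noteq> \<rho>"
  proof
    assume nv: "norm v = \<rho>"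
    \<comment> \<open>On the sphere, comparison with 0 through the supergradient \<open>s 0\<close>
      would give |v|^2 < \<rho> |v|; the radius \<rho>/2 in the hypothesis is what makes this
      contradictory.\<close>
    have "J v \<le> J 0" using v(2) \<rho> by simp
    then have "(norm v)\<^sup>2 - 2 * (y \<bullet> v) \<le> 2 * r * (m v - m 0)"
      by (simp add: J_def expand algebra_simps)
    also have "\<dots> \<le> 2 * r * (- (v \<bullet> s 0))"
      using super[of 0 v] v(1) \<rho> r by (intro mult_left_mono) auto
    finally have "(norm v)\<^sup>2 \<le> 2 * ((y - r *\<^sub>R s 0) \<bullet> v)"
      by (simp add: inner_diff_left inner_commute algebra_simps)
    also have "\<dots> \<le> 2 * (norm (y - r *\<^sub>R s 0) * norm v)"
      by (intro mult_left_mono norm_cauchy_schwarz) auto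
    also have "\<dots> < 2 * (\<rho> / 2 * norm v)"
      using y \<rho> nv by (intro mult_strict_left_mono mult_strict_right_mono) auto
    finally show False using nv by (simp add: power2_eq_square)
  qed
  then have vb: "v \<in> ball 0 \<rho>" using v(1) by simp
  \<comment> \<open>The supergradient is taken at the moved point, where it bounds
    \<open>m v - m ?u\<close> from above; continuity of \<open>s\<close> brings it back to
    \<open>v\<close> as t tends to 0.\<close>
  have key: "0 \<le> d \<bullet> (r *\<^sub>R s v - (y - v))" for d
  proof -
    have scont: "isCont s v"
      using s vb by (meson ball_subset_cball continuous_on_eq_continuous_at continuous_on_subset open_ball)
    have path: "((\<lambda>t. v + t *\<^sub>R d) \<longlongrightarrow> v) (at_right 0)"
      by (rule tendsto_eq_intros | simp)+
    have ev: "\<forall>\<^sub>F t in at_right 0. v + t *\<^sub>R d \<in> ball 0 \<rho>"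
      using topological_tendstoD[OF path open_ball vb] .
    have "\<forall>\<^sub>F t in at_right 0. 0 \<le> 2 * r * (d \<bullet> s (v + t *\<^sub>R d)) + t * (norm d)\<^sup>2 - 2 * ((y - v) \<bullet> d)"
      using ev eventually_at_right_less[of "0::real"]
    proof eventually_elim
      case (elim t)
      let ?u = "v + t *\<^sub>R d"
      have u: "?u \<in> cball 0 \<rho>" using elim by auto
      have "J v \<le> J ?u" using v(2) u by blast
      then have "0 \<le> (norm (y - ?u))\<^sup>2 - (norm (y - v))\<^sup>2 + 2 * r * (m v - m ?u)"
        by (simp add: J_def algebra_simps)
      also have "\<dots> \<le> (norm (y - ?u))\<^sup>2 - (norm (y - v))\<^sup>2 + 2 * r * (- ((v - ?u) \<bullet> s ?u))"
        using super[OF u v(1)] r by (intro add_left_mono mult_left_mono) auto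
      also have "(norm (y - ?u))\<^sup>2 - (norm (y - v))\<^sup>2 = t\<^sup>2 * (norm d)\<^sup>2 - 2 * t * ((y - v) \<bullet> d)"
        unfolding expand by (simp only: power2_norm_eq_inner)
          (simp add: inner_diff inner_add inner_commute algebra_simps power2_eq_square)
      finally have "0 \<le> t * (2 * r * (d \<bullet> s ?u) + t * (norm d)\<^sup>2 - 2 * ((y - v) \<bullet> d))"
        by (simp add: algebra_simps power2_eq_square)
      then show ?case using elim(2) by (simp add: zero_le_mult_iff)
    qed
    moreover have "((\<lambda>t. 2 * r * (d \<bullet> s (v + t *\<^sub>R d)) + t * (norm d)\<^sup>2 - 2 * ((y - v) \<bullet> d))
       \<longlongrightarrow> 2 * r * (d \<bullet> s v) + 0 * (norm d)\<^sup>2 - 2 * ((y - v) \<bullet> d)) (at_right 0)"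
      by (intro tendsto_intros isCont_tendsto_compose[OF scont path])
    ultimately have "0 \<le> 2 * r * (d \<bullet> s v) + 0 * (norm d)\<^sup>2 - 2 * ((y - v) \<bullet> d)"
      by (intro tendsto_lowerbound) auto
    then show ?thesis by (simp add: inner_diff_right inner_commute algebra_simps)
  qed
  have "(r *\<^sub>R s v - (y - v)) \<bullet> (r *\<^sub>R s v - (y - v)) \<le> 0"
    using key[of "- (r *\<^sub>R s v - (y - v))"] by (simp only: inner_minus_left neg_0_le_iff_le)
  then have "r *\<^sub>R s v - (y - v) = 0" by (metis inner_ge_zero inner_eq_zero_iff order_antisym)
  then have "v + r *\<^sub>R s v = y" by (simp add: algebra_simps)
  then show ?thesis using vb by blast
qed

section \<open>Convex piecewise linear functions\<close>

text \<open>The maximum of the affine pieces is finite on the whole space, so \<theta> splits into a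
  globally Lipschitz convex function and the indicator of a closed convex set. Continuity arguments
  can then use \<tau> across the boundary of the domain.\<close>

lemma CPWL_rep:
  fixes \<theta> :: "'a::euclidean_space \<Rightarrow> ereal"
  assumes "CPWL \<theta>"
  obtains \<tau> L where "convex_on UNIV \<tau>" "L-lipschitz_on UNIV \<tau>" "closed (edom \<theta>)" "convex (edom \<theta>)"
    "\<And>z. \<theta> z = (if z \<in> edom \<theta> then ereal (\<tau> z) else \<infinity>)"
proof -
  obtain A :: "('a \<times> real) set" where A: "finite A" "A \<noteq> {}"
      "\<And>z. z \<in> edom \<theta> \<Longrightarrow> \<theta> z = ereal (Max ((\<lambda>(a, b). a \<bullet> z + b) ` A))"
    and poly: "polyhedron (edom \<theta>)"
    using assms unfolding CPWL_def by blast
  define \<tau> where "\<tau> z = Max ((\<lambda>(a, b). a \<bullet> z + b) ` A)" for z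
  \<comment> \<open>The sum of the slope norms dominates the slope of every single piece.\<close>
  define L where "L = (\<Sum>p\<in>A. norm (fst p))"
  have ge: "fst p \<bullet> z + snd p \<le> \<tau> z" if "p \<in> A" for p z
    unfolding \<tau>_def using that A(1) by (intro Max_ge) (auto simp: case_prod_beta)
  have le: "\<tau> z \<le> c" if "\<And>p. p \<in> A \<Longrightarrow> fst p \<bullet> z + snd p \<le> c" for z c
    unfolding \<tau>_def using that A(1,2) by (subst Max_le_iff) (auto simp: case_prod_beta)
  show thesis
  proof (rule that)
    show "convex_on UNIV \<tau>"
    proof (rule convex_onI)
      fix t :: real and x y :: 'a assume t: "0 < t" "t < 1"
      show "\<tau> ((1 - t) *\<^sub>R x + t *\<^sub>R y) \<le> (1 - t) * \<tau> x + t * \<tau> y"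
      proof (rule le)
        fix p assume p: "p \<in> A"
        have "fst p \<bullet> ((1 - t) *\<^sub>R x + t *\<^sub>R y) + snd p
            = (1 - t) * (fst p \<bullet> x + snd p) + t * (fst p \<bullet> y + snd p)"
          by (simp add: inner_add algebra_simps)
        also have "\<dots> \<le> (1 - t) * \<tau> x + t * \<tau> y"
          using t by (intro add_mono mult_left_mono ge p) auto
        finally show "fst p \<bullet> ((1 - t) *\<^sub>R x + t *\<^sub>R y) + snd p \<le> (1 - t) * \<tau> x + t * \<tau> y" .
      qed
    qed auto
    have *: "\<tau> x \<le> \<tau> y + L * dist x y" for x y
    proof (rule le)
      fix p assume p: "p \<in> A"
      have "fst p \<bullet> x + snd p = (fst p \<bullet> y + snd p) + fst p \<bullet> (x - y)"
        by (simp add: inner_diff)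
      also have "\<dots> \<le> \<tau> y + norm (fst p) * norm (x - y)"
        by (intro add_mono ge p norm_cauchy_schwarz)
      also have "\<dots> \<le> \<tau> y + L * norm (x - y)"
        unfolding L_def using A(1) p
        by (intro add_left_mono mult_right_mono member_le_sum) auto
      finally show "fst p \<bullet> x + snd p \<le> \<tau> y + L * dist x y" by (simp add: dist_norm)
    qed
    show "L-lipschitz_on UNIV \<tau>"
    proof (rule lipschitz_onI)
      show "dist (\<tau> x) (\<tau> y) \<le> L * dist x y" for x y
        using *[of x y] *[of y x] by (simp add: dist_real_def abs_le_iff dist_commute)
      show "0 \<le> L" unfolding L_def by (simp add: sum_nonneg)
    qed
    show "closed (edom \<theta>)" "convex (edom \<theta>)"
      using poly by (auto intro: polyhedron_imp_closed polyhedron_imp_convex)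
    show "\<theta> z = (if z \<in> edom \<theta> then ereal (\<tau> z) else \<infinity>)" for z
      using A(3) by (auto simp: \<tau>_def edom_def)
  qed
qed

text \<open>An active affine piece \<open>a\<close> is a subgradient, and so is \<open>a + g\<close> for every active
  constraint normal \<open>g\<close> of the domain; hence directions orthogonal to the subdifferential change
  neither the active pieces nor the active constraints.\<close>

lemma CPWL_locally_constant_orthogonal:
  fixes \<theta> :: "'a::euclidean_space \<Rightarrow> ereal"
  assumes "CPWL \<theta>" and zb: "zb \<in> edom \<theta>"
  shows "\<exists>\<epsilon>>0. \<forall>z\<in>ball zb \<epsilon>. \<forall>z'\<in>ball zb \<epsilon>.
    (\<forall>c\<in>subdifferential \<theta> zb. c \<bullet> (z - z') = 0) \<longrightarrow> \<theta> z = \<theta> z'"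
proof -
  obtain A :: "('a \<times> real) set" where A: "finite A" "A \<noteq> {}"
      "\<And>z. z \<in> edom \<theta> \<Longrightarrow> \<theta> z = ereal (Max ((\<lambda>(a, b). a \<bullet> z + b) ` A))"
    and poly: "polyhedron (edom \<theta>)"
    using assms unfolding CPWL_def by blast
  define \<tau> where "\<tau> z = Max ((\<lambda>(a, b). a \<bullet> z + b) ` A)" for z
  have \<theta>: "\<theta> z = ereal (\<tau> z)" if "z \<in> edom \<theta>" for z
    using A(3)[OF that] by (simp add: \<tau>_def)
  have \<theta>_inf: "\<theta> z = \<infinity>" if "z \<notin> edom \<theta>" for z
    using that by (simp add: edom_def)
  have ge: "fst p \<bullet> z + snd p \<le> \<tau> z" if "p \<in> A" for p z
    unfolding \<tau>_def using that A(1) by (intro Max_ge) (auto simp: case_prod_beta)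
  have att: "\<exists>p\<in>A. \<tau> z = fst p \<bullet> z + snd p" for z
  proof -
    have "\<tau> z \<in> (\<lambda>(a, b). a \<bullet> z + b) ` A"
      unfolding \<tau>_def using A(1,2) by (intro Max_in) auto
    then show ?thesis by (auto simp: case_prod_beta)
  qed
  obtain F where F: "finite F" "edom \<theta> = \<Inter>F" "\<forall>h\<in>F. \<exists>a b. a \<noteq> 0 \<and> h = {x. a \<bullet> x \<le> b}"
    using poly unfolding polyhedron_def by blast
  then obtain g \<beta> where gb: "\<And>h. h \<in> F \<Longrightarrow> h = {x. g h \<bullet> x \<le> \<beta> h}" by metis
  have dom: "z \<in> edom \<theta> \<longleftrightarrow> (\<forall>h\<in>F. g h \<bullet> z \<le> \<beta> h)" for z
    using F(2) gb by blast
  obtain p0 where p0: "p0 \<in> A" "\<tau> zb = fst p0 \<bullet> zb + snd p0" using att by blast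
  \<comment> \<open>Inactive pieces are compared with one active piece \<open>p0\<close> instead of
    the maximum, which is an open condition on \<open>z\<close> for each of finitely many
    pieces.\<close>
  have ev1: "\<forall>\<^sub>F z in nhds zb. \<forall>p\<in>A. fst p \<bullet> zb + snd p < \<tau> zb \<longrightarrow> fst p \<bullet> z + snd p < fst p0 \<bullet> z + snd p0"
  proof (intro eventually_ball_finite A(1) ballI)
    fix p
    have "open {z. fst p \<bullet> z + snd p < fst p0 \<bullet> z + snd p0}"
      by (intro open_Collect_less continuous_intros)
    then show "\<forall>\<^sub>F z in nhds zb. fst p \<bullet> zb + snd p < \<tau> zb \<longrightarrow> fst p \<bullet> z + snd p < fst p0 \<bullet> z + snd p0"
      using p0(2) by (cases "fst p \<bullet> zb + snd p < \<tau> zb") (auto dest: eventually_nhds_in_open[where x=zb])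
  qed
  have ev2: "\<forall>\<^sub>F z in nhds zb. \<forall>h\<in>F. g h \<bullet> zb < \<beta> h \<longrightarrow> g h \<bullet> z < \<beta> h"
  proof (intro eventually_ball_finite F(1) ballI)
    fix h
    have "open {z. g h \<bullet> z < \<beta> h}"
      by (intro open_Collect_less continuous_intros)
    then show "\<forall>\<^sub>F z in nhds zb. g h \<bullet> zb < \<beta> h \<longrightarrow> g h \<bullet> z < \<beta> h"
      by (cases "g h \<bullet> zb < \<beta> h") (auto dest: eventually_nhds_in_open[where x=zb])
  qed
  obtain \<epsilon> where \<epsilon>: "\<epsilon> > 0"
    and inact: "\<And>z p. z \<in> ball zb \<epsilon> \<Longrightarrow> p \<in> A \<Longrightarrow> fst p \<bullet> zb + snd p < \<tau> zb \<Longrightarrow> fst p \<bullet> z + snd p < fst p0 \<bullet> z + snd p0"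
    and inact': "\<And>z h. z \<in> ball zb \<epsilon> \<Longrightarrow> h \<in> F \<Longrightarrow> g h \<bullet> zb < \<beta> h \<Longrightarrow> g h \<bullet> z < \<beta> h"
    using eventually_conj[OF ev1 ev2] unfolding eventually_nhds_metric by (auto simp: dist_commute)
  have sub: "a \<in> subdifferential \<theta> zb" if "\<And>y. y \<in> edom \<theta> \<Longrightarrow> \<tau> zb + a \<bullet> (y - zb) \<le> \<tau> y" for a
  proof -
    have "\<theta> zb + ereal (a \<bullet> (y - zb)) \<le> \<theta> y" for y
      using that[of y] \<theta>[OF zb] \<theta>[of y] \<theta>_inf[of y] by (cases "y \<in> edom \<theta>") auto
    then show ?thesis unfolding subdifferential_def using \<theta>[OF zb] by simp
  qed
  have act: "fst p \<in> subdifferential \<theta> zb" if "p \<in> A" "fst p \<bullet> zb + snd p = \<tau> zb" for p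
    using ge[OF that(1)] that(2) by (intro sub) (simp add: inner_diff algebra_simps, smt (verit))
  \<comment> \<open>The normal \<open>g h\<close> alone need not be a subgradient, but its sum with
    an active slope is one. Since the sum and the slope are both orthogonal to \<open>z - z'\<close>
    below, so is \<open>g h\<close>.\<close>
  have act': "fst p0 + g h \<in> subdifferential \<theta> zb" if "h \<in> F" "g h \<bullet> zb = \<beta> h" for h
  proof (rule sub)
    fix y assume "y \<in> edom \<theta>"
    then have "g h \<bullet> y \<le> \<beta> h" using that(1) dom by blast
    then show "\<tau> zb + (fst p0 + g h) \<bullet> (y - zb) \<le> \<tau> y"
      using ge[OF p0(1), of y] p0(2) that(2) by (simp add: inner_add inner_diff)
  qed
  have step: "z' \<in> edom \<theta> \<and> \<tau> z \<le> \<tau> z'"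
    if z: "z \<in> ball zb \<epsilon>" "z' \<in> ball zb \<epsilon>" "z \<in> edom \<theta>"
      and orth: "\<forall>c\<in>subdifferential \<theta> zb. c \<bullet> (z - z') = 0" for z z'
  proof
    have o0: "fst p0 \<bullet> (z - z') = 0" using orth act[OF p0(1)] p0(2) by simp
    show "z' \<in> edom \<theta>"
      unfolding dom
    proof
      fix h assume h: "h \<in> F"
      show "g h \<bullet> z' \<le> \<beta> h"
      proof (cases "g h \<bullet> zb < \<beta> h")
        case True then show ?thesis using inact'[OF z(2) h] by simp
      next
        case False
        then have "g h \<bullet> zb = \<beta> h" using zb dom h by (meson antisym_conv2)
        then have "(fst p0 + g h) \<bullet> (z - z') = 0" using orth act'[OF h] by blast
        then have "g h \<bullet> z = g h \<bullet> z'" using o0 by (simp add: inner_add_left inner_diff_right)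
        then show ?thesis using z(3) dom h by metis
      qed
    qed
    obtain p where p: "p \<in> A" "\<tau> z = fst p \<bullet> z + snd p" using att by blast
    \<comment> \<open>A piece attaining the maximum at \<open>z\<close> was already active at
      \<open>zb\<close>; otherwise \<open>p0\<close> would exceed it at \<open>z\<close>.\<close>
    have "fst p \<bullet> zb + snd p = \<tau> zb"
      using inact[OF z(1) p(1)] ge[OF p0(1), of z] ge[OF p(1), of zb] p(2) by linarith
    then have "fst p \<bullet> (z - z') = 0" using orth act[OF p(1)] by simp
    then show "\<tau> z \<le> \<tau> z'" using ge[OF p(1), of z'] p(2) by (simp add: inner_diff_right)
  qed
  have "\<theta> z = \<theta> z'" if z: "z \<in> ball zb \<epsilon>" "z' \<in> ball zb \<epsilon>"
      and orth: "\<forall>c\<in>subdifferential \<theta> zb. c \<bullet> (z - z') = 0" for z z'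
  proof -
    have orth': "\<forall>c\<in>subdifferential \<theta> zb. c \<bullet> (z' - z) = 0"
      using orth by (simp add: inner_diff_right)
    show ?thesis
      using step[OF z _ orth] step[OF z(2,1) _ orth'] \<theta> \<theta>_inf
      by (cases "z \<in> edom \<theta>"; cases "z' \<in> edom \<theta>") (auto intro: antisym)
  qed
  then show ?thesis using \<epsilon> by blast
qed

text \<open>The kernel condition is dual to the statement that the range of \<open>A\<close> and the
  orthogonal complement of \<open>S\<close> span the space. With \<open>P\<close> the orthogonal
  projection onto \<open>S\<close>, solve A x + y = P u linearly in u with y in this complement and
  keep x. The result depends on u only through \<open>P u\<close>, so it vanishes on the
  complement.\<close>

lemma right_inverse_modulo_orthogonal:
  fixes A :: "'x::euclidean_space \<Rightarrow> 'z::euclidean_space"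
  assumes A: "linear A" and S: "subspace S" and ker: "S \<inter> {l. adjoint A l = 0} \<subseteq> {0}"
  obtains R where "linear R" "\<And>u c. c \<in> S \<Longrightarrow> c \<bullet> (A (R u) - u) = 0"
    "\<And>u. (\<And>c. c \<in> S \<Longrightarrow> c \<bullet> u = 0) \<Longrightarrow> R u = 0"
proof -
  obtain B where B: "B \<subseteq> S" "pairwise orthogonal B" "\<And>x. x \<in> B \<Longrightarrow> norm x = 1"
     "independent B" "span B = S"
    using orthonormal_basis_subspace[OF S] by metis
  have fin: "finite B" using B(4) by (rule independent_imp_finite)
  define P where "P z = (\<Sum>b\<in>B. (b \<bullet> z) *\<^sub>R b)" for z
  have linP: "linear P"
    unfolding P_def by (intro linear_compose_sum ballI linearI) (auto simp: inner_add_right algebra_simps)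
  have PS: "P z \<in> S" for z
    unfolding P_def B(5)[symmetric] by (intro span_sum span_scale span_base)
  have Pb: "b \<bullet> (z - P z) = 0" if b: "b \<in> B" for b z
  proof -
    have "b \<bullet> P z = (\<Sum>b'\<in>B. if b' = b then b \<bullet> z else 0)"
      unfolding P_def inner_sum_right
    proof (rule sum.cong[OF refl])
      fix b' assume b': "b' \<in> B"
      show "b \<bullet> ((b' \<bullet> z) *\<^sub>R b') = (if b' = b then b \<bullet> z else 0)"
        using B(3)[OF b] B(2) b b' by (auto simp: pairwise_def orthogonal_def norm_eq_1)
    qed
    also have "\<dots> = b \<bullet> z" using fin b by simp
    finally show ?thesis by (simp add: inner_diff_right)
  qed
  have PP: "c \<bullet> (z - P z) = 0" if "c \<in> S" for c z
    using that unfolding B(5)[symmetric]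
    by (induction rule: span_induct_alt) (auto simp: inner_add_left Pb)
  have P0: "P u = 0" if "\<And>c. c \<in> S \<Longrightarrow> c \<bullet> u = 0" for u
    unfolding P_def using that B(1) by (intro sum.neutral) auto
  define \<Lambda> where "\<Lambda> q = A (fst q) + (snd q - P (snd q))" for q
  have lin\<Lambda>: "linear \<Lambda>"
    unfolding \<Lambda>_def
    by (rule linearI) (auto simp: linear_add[OF A] linear_add[OF linP] linear_cmul[OF A] linear_cmul[OF linP] algebra_simps)
  have "surj \<Lambda>"
  proof (rule ccontr)
    assume "\<not> surj \<Lambda>"
    moreover have sr: "subspace (range \<Lambda>)" using lin\<Lambda> by (intro linear_subspace_image) auto
    ultimately have "dim (range \<Lambda>) < DIM('z)"
      by (metis dim_eq_full dim_subset_UNIV le_neq_implies_less span_eq_iff)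
    \<comment> \<open>A vector orthogonal to the range is annihilated by the adjoint of
      \<open>A\<close>, and it lies in \<open>S\<close> because it is orthogonal to every difference
      \<open>u - P u\<close>.\<close>
    then obtain s where s: "s \<noteq> 0" "\<And>y. y \<in> span (range \<Lambda>) \<Longrightarrow> orthogonal s y"
      by (rule orthogonal_to_subspace_exists) (rule that)
    have so: "s \<bullet> \<Lambda> q = 0" for q
      using s(2)[OF span_base, of "\<Lambda> q"] by (simp add: orthogonal_def)
    have "s \<bullet> A x = 0" for x
      using so[of "(x, 0)"] linear_0[OF linP] by (simp add: \<Lambda>_def)
    then have "adjoint A s \<bullet> x = 0" for x
      by (simp add: adjoint_clauses(2)[OF A])
    then have "adjoint A s = 0" by (metis inner_eq_zero_iff)
    moreover have "s \<bullet> (s - P s) = 0"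
      using so[of "(0, s)"] linear_0[OF A] by (simp add: \<Lambda>_def)
    then have "(s - P s) \<bullet> (s - P s) = 0"
      using PP[OF PS[of s], of s] by (simp add: inner_diff_left)
    then have "s \<in> S" using PS[of s] by simp
    ultimately show False using ker s(1) by blast
  qed
  then obtain g where g: "linear g" "\<Lambda> \<circ> g = id"
    using linear_surjective_right_inverse[OF lin\<Lambda>] by blast
  show thesis
  proof (rule that[of "\<lambda>z. fst (g (P z))"])
    show "linear (\<lambda>z. fst (g (P z)))"
      using linear_compose[OF linear_compose[OF linP g(1)] linear_fst] by (simp add: o_def)
    show "c \<bullet> (A (fst (g (P u))) - u) = 0" if c: "c \<in> S" for c u
    proof -
      have "\<Lambda> (g (P u)) = P u" using g(2) by (metis comp_apply id_apply)
      then have "A (fst (g (P u))) - u = (P u - u) - (snd (g (P u)) - P (snd (g (P u))))"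
        by (simp add: \<Lambda>_def algebra_simps)
      then have "c \<bullet> (A (fst (g (P u))) - u) =
        - (c \<bullet> (u - P u)) - c \<bullet> (snd (g (P u)) - P (snd (g (P u))))"
        by (simp add: inner_diff_right)
      then show ?thesis using PP[OF c] by simp
    qed
    show "fst (g (P u)) = 0" if "\<And>c. c \<in> S \<Longrightarrow> c \<bullet> u = 0" for u
      using P0[OF that] linear_0[OF g(1)] by simp
  qed
qed

section \<open>The KKT system in a local chart\<close>

text \<open>Riesz representation in coordinates; it is the source of gradients and, later, of the
  multiplier at a minimizer.\<close>

lemma sum_Basis_inner:
  fixes f :: "'a::euclidean_space \<Rightarrow> real"
  assumes "linear f"
  shows "(\<Sum>b\<in>Basis. f b *\<^sub>R b) \<bullet> a = f a"
proof -
  have "f a = f (\<Sum>b\<in>Basis. (a \<bullet> b) *\<^sub>R b)" by (simp add: euclidean_representation)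
  also have "\<dots> = (\<Sum>b\<in>Basis. (a \<bullet> b) * f b)"
    by (simp add: linear_sum[OF assms] linear_cmul[OF assms])
  finally show ?thesis by (simp add: inner_sum_left inner_commute[of a] mult.commute)
qed

text \<open>For d = g x - g y the derivative \<open>f'\<close> sends d close to x - y, and the left
  inverse \<open>h\<close> turns this into a bound on d - h (x - y) by a small multiple of |d|,
  which is then absorbed.\<close>

lemma strict_deriv_inverse:
  assumes f: "strict_deriv f f' a" and h: "bounded_linear h" "\<And>x. h (f' x) = x"
    and g: "isCont g (f a)" "g (f a) = a" "\<forall>\<^sub>F y in nhds (f a). f (g y) = y"
  shows "strict_deriv g h (f a)"
  unfolding strict_deriv_def
proof (intro conjI allI impI)
  interpret h: bounded_linear h by (rule h(1))
  show "bounded_linear h" by (rule h(1))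
  fix \<epsilon> :: real assume \<epsilon>: "\<epsilon> > 0"
  obtain K where K: "K > 0" "\<And>x. norm (h x) \<le> norm x * K" using h.pos_bounded by blast
  \<comment> \<open>The first bound absorbs half of |d| and gives |d| \<le> 2 K |x - y|; the second
    turns the remaining error into \<epsilon> |x - y|.\<close>
  define \<eta> where "\<eta> = min (1 / (2 * K)) (\<epsilon> / (2 * K * K))"
  have \<eta>: "\<eta> > 0" "\<eta> * K \<le> 1/2" "\<eta> * K * K * 2 \<le> \<epsilon>"
  proof -
    show "\<eta> > 0" using K \<epsilon> by (simp add: \<eta>_def)
    have "\<eta> * K \<le> (1 / (2 * K)) * K" using K by (intro mult_right_mono) (auto simp: \<eta>_def)
    then show "\<eta> * K \<le> 1/2" using K by simp
    have "\<eta> * (K * K * 2) \<le> (\<epsilon> / (2 * K * K)) * (K * K * 2)"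
      using K by (intro mult_right_mono) (auto simp: \<eta>_def)
    then show "\<eta> * K * K * 2 \<le> \<epsilon>" using K by (simp add: mult.assoc)
  qed
  obtain \<delta>1 where \<delta>1: "\<delta>1 > 0" "\<And>x y. x \<in> ball a \<delta>1 \<Longrightarrow> y \<in> ball a \<delta>1 \<Longrightarrow>
        norm (f x - f y - f' (x - y)) \<le> \<eta> * norm (x - y)"
    using strict_derivD[OF f \<eta>(1)] by blast
  have "\<forall>\<^sub>F y in nhds (f a). f (g y) = y \<and> dist (g y) a < \<delta>1"
    using g(3) isCont_within_ball[OF g(1) \<delta>1(1)] g(2) by (intro eventually_conj) auto
  then obtain \<delta> where \<delta>: "\<delta> > 0" "\<And>y. y \<in> ball (f a) \<delta> \<Longrightarrow> f (g y) = y \<and> g y \<in> ball a \<delta>1"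
    unfolding eventually_nhds_metric by (auto simp: dist_commute)
  have "norm (g x - g y - h (x - y)) \<le> \<epsilon> * norm (x - y)"
    if xy: "x \<in> ball (f a) \<delta>" "y \<in> ball (f a) \<delta>" for x y
  proof -
    let ?d = "g x - g y"
    have e: "norm (x - y - f' ?d) \<le> \<eta> * norm ?d"
      using \<delta>1(2)[of "g x" "g y"] \<delta>(2) xy by auto
    have eq: "?d - h (x - y) = - h (x - y - f' ?d)"
      by (simp add: h.diff h(2))
    have n1: "norm (?d - h (x - y)) \<le> (\<eta> * norm ?d) * K"
      unfolding eq norm_minus_cancel
      using K(1) by (intro order_trans[OF K(2)] mult_right_mono e) auto
    have "norm ?d \<le> norm (h (x - y)) + norm (?d - h (x - y))"
      by (rule norm_triangle_sub)
    also have "\<dots> \<le> norm (x - y) * K + (\<eta> * norm ?d) * K"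
      by (intro add_mono K n1)
    also have "\<dots> \<le> norm (x - y) * K + norm ?d / 2"
      using mult_right_mono[OF \<eta>(2) norm_ge_zero[of ?d]] by (simp add: algebra_simps)
    finally have "norm ?d \<le> 2 * K * norm (x - y)" by (simp add: algebra_simps)
    then have "(\<eta> * K) * norm ?d \<le> (\<eta> * K) * (2 * K * norm (x - y))"
      using \<eta>(1) K(1) by (intro mult_left_mono) auto
    also have "\<dots> = (\<eta> * K * K * 2) * norm (x - y)" by (simp add: algebra_simps)
    also have "\<dots> \<le> \<epsilon> * norm (x - y)" by (intro mult_right_mono \<eta>) auto
    finally show ?thesis using n1 by (simp add: algebra_simps)
  qed
  then show "\<exists>\<delta>>0. \<forall>x\<in>ball (f a) \<delta>. \<forall>y\<in>ball (f a) \<delta>. norm (g x - g y - h (x - y)) \<le> \<epsilon> * norm (x - y)"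
    using \<delta>(1) by blast
qed

lemma linear_imp_bounded_linear: "linear f \<Longrightarrow> bounded_linear f" for f :: "'p::euclidean_space \<Rightarrow> 'q::real_normed_vector"
  by (simp add: linear_conv_bounded_linear)

text \<open>The definite description in \<open>gradient\<close> is legitimate because derivatives
  are unique and a vector is determined by its inner products.\<close>

lemma gradient_inner:
  fixes f :: "'a::euclidean_space \<Rightarrow> real"
  assumes "(f has_derivative D) (at x)"
  shows "gradient f x \<bullet> a = D a"
proof -
  define g where "g = (\<Sum>b\<in>Basis. D b *\<^sub>R b)"
  have g: "g \<bullet> a = D a" for a
    unfolding g_def by (rule sum_Basis_inner[OF has_derivative_linear[OF assms]])
  have 1: "GDERIV f x :> g"
    using assms g by (simp add: gderiv_def inner_commute[of _ g])
  have "gradient f x = g"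
    unfolding gradient_def
  proof (rule the_equality[of "\<lambda>g. GDERIV f x :> g", OF 1])
    fix g' assume "GDERIV f x :> g'"
    then have "(\<lambda>a. a \<bullet> g') = (\<lambda>a. a \<bullet> g)"
      using 1 unfolding gderiv_def by (rule has_derivative_unique)
    then show "g' = g" by (metis vector_eq_ldot)
  qed
  then show ?thesis by (simp add: g)
qed

section \<open>Subdifferentials near the reference point and the gradient of the Lagrangian\<close>

text \<open>Piecewise linearity is recorded as \<open>flat\<close>: near \<open>zb\<close> the value
  of \<theta> depends on the point only modulo the orthogonal complement of \<open>S\<close>.
  Stationarity is stated on test directions, so that no adjoint has to be handled here.\<close>

locale problem_data =
  fixes \<theta> :: "'z::euclidean_space \<Rightarrow> ereal" and \<tau> :: "'z \<Rightarrow> real" and L\<tau> :: real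
    and \<phi> :: "'x::euclidean_space \<times> 'w::euclidean_space \<Rightarrow> real" and \<Phi> :: "'x \<times> 'w \<Rightarrow> 'z"
    and D\<phi> D2\<phi> D\<Phi> D2\<Phi> and xb :: 'x and wb :: 'w and lb :: 'z
    and S :: "'z set" and \<epsilon> :: real
  assumes \<tau>_convex: "convex_on UNIV \<tau>" and \<tau>_lip: "L\<tau>-lipschitz_on UNIV \<tau>"
    and dom_closed: "closed (edom \<theta>)" and dom_convex: "convex (edom \<theta>)"
    and \<theta>_eq: "\<And>z. \<theta> z = (if z \<in> edom \<theta> then ereal (\<tau> z) else \<infinity>)"
    and D\<phi>: "\<And>p. (\<phi> has_derivative blinfun_apply (D\<phi> p)) (at p)"
    and D2\<phi>: "\<And>p. (D\<phi> has_derivative blinfun_apply (D2\<phi> p)) (at p)"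
    and D2\<phi>_cont: "continuous_on UNIV D2\<phi>"
    and D\<Phi>: "\<And>p. (\<Phi> has_derivative blinfun_apply (D\<Phi> p)) (at p)"
    and D2\<Phi>: "\<And>p. (D\<Phi> has_derivative blinfun_apply (D2\<Phi> p)) (at p)"
    and D2\<Phi>_cont: "continuous_on UNIV D2\<Phi>"
    and S: "subspace S" and \<epsilon>: "\<epsilon> > 0"
    and flat: "\<And>z z'. z \<in> ball (\<Phi> (xb, wb)) \<epsilon> \<Longrightarrow> z' \<in> ball (\<Phi> (xb, wb)) \<epsilon> \<Longrightarrow>
        (\<And>c. c \<in> S \<Longrightarrow> c \<bullet> (z - z') = 0) \<Longrightarrow> \<theta> z = \<theta> z'"
    and lb: "lb \<in> subdifferential \<theta> (\<Phi> (xb, wb))"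
    and stationary: "\<And>a. D\<phi> (xb, wb) (a, 0) + lb \<bullet> D\<Phi> (xb, wb) (a, 0) = 0"
begin

abbreviation "zb \<equiv> \<Phi> (xb, wb)"
abbreviation "p0 \<equiv> (xb, wb)"

definition A :: "'x \<Rightarrow> 'z" where "A a = D\<Phi> p0 (a, 0)"
definition B :: "'w \<Rightarrow> 'z" where "B b = D\<Phi> p0 (0, b)"

lemma D\<Phi>_p0: "D\<Phi> p0 (a, b) = A a + B b"
  by (simp add: A_def B_def blinfun.add_right[symmetric])

lemma linear_A: "linear A"
  unfolding A_def by (rule linearI) (auto simp: blinfun.add_right[symmetric] blinfun.scaleR_right[symmetric])

lemma linear_B: "linear B"
  unfolding B_def by (rule linearI) (auto simp: blinfun.add_right[symmetric] blinfun.scaleR_right[symmetric])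

lemma sub_iff: "l \<in> subdifferential \<theta> z \<longleftrightarrow>
    z \<in> edom \<theta> \<and> (\<forall>y\<in>edom \<theta>. \<tau> z + l \<bullet> (y - z) \<le> \<tau> y)"
  unfolding subdifferential_def by (subst (1 2 3) \<theta>_eq) (auto split: if_splits)

text \<open>For convex data a subgradient inequality near \<open>z\<close> is global: apply it at z
  + t (y - z) for small t, bound \<tau> there by the chord and divide by t.\<close>

lemma sub_localI:
  assumes z: "z \<in> edom \<theta>" and ev: "\<forall>\<^sub>F y in nhds z. y \<in> edom \<theta> \<longrightarrow> \<tau> z + l \<bullet> (y - z) \<le> \<tau> y"
  shows "l \<in> subdifferential \<theta> z"
  unfolding sub_iff
proof (intro conjI ballI z)
  fix y assume y: "y \<in> edom \<theta>"
  have lim: "((\<lambda>t. z + t *\<^sub>R (y - z)) \<longlongrightarrow> z) (at_right 0)"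
    by (rule tendsto_eq_intros | simp)+
  have "\<forall>\<^sub>F t in at_right 0. z + t *\<^sub>R (y - z) \<in> edom \<theta> \<longrightarrow>
      \<tau> z + l \<bullet> (z + t *\<^sub>R (y - z) - z) \<le> \<tau> (z + t *\<^sub>R (y - z))"
    using eventually_compose_filterlim[OF ev lim] .
  moreover have "\<forall>\<^sub>F t in at_right (0::real). t < 1"
    using eventually_at_right[of 0 1 "\<lambda>t::real. t < 1"] by (auto intro!: exI[of _ 1])
  ultimately have "\<forall>\<^sub>F t in at_right (0::real). \<tau> z + l \<bullet> (y - z) \<le> \<tau> y"
    using eventually_at_right_less[of "0::real"]
  proof eventually_elim
    case (elim t)
    have eq: "z + t *\<^sub>R (y - z) = (1 - t) *\<^sub>R z + t *\<^sub>R y" by (simp add: algebra_simps)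
    have "z + t *\<^sub>R (y - z) \<in> edom \<theta>"
      unfolding eq using convexD_alt[OF dom_convex z y, of t] elim by simp
    then have "\<tau> z + t * (l \<bullet> (y - z)) \<le> \<tau> (z + t *\<^sub>R (y - z))"
      using elim(1) by simp
    also have "\<dots> \<le> (1 - t) * \<tau> z + t * \<tau> y"
      unfolding eq using convex_onD[OF \<tau>_convex, of t z y] elim by simp
    finally have "t * (\<tau> z + l \<bullet> (y - z)) \<le> t * \<tau> y" by (simp add: algebra_simps)
    then show ?case using elim(3) by simp
  qed
  then show "\<tau> z + l \<bullet> (y - z) \<le> \<tau> y" by (simp add: eventually_const_iff)
qed

lemma flat_iff:
  assumes "z \<in> ball zb \<epsilon>" "z' \<in> ball zb \<epsilon>" "\<And>c. c \<in> S \<Longrightarrow> c \<bullet> (z - z') = 0"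
  shows "z \<in> edom \<theta> \<longleftrightarrow> z' \<in> edom \<theta>" "z \<in> edom \<theta> \<Longrightarrow> \<tau> z = \<tau> z'"
proof -
  have "\<theta> z = \<theta> z'" using flat assms by blast
  then show "z \<in> edom \<theta> \<longleftrightarrow> z' \<in> edom \<theta>" by (simp add: edom_def)
  with \<open>\<theta> z = \<theta> z'\<close> show "z \<in> edom \<theta> \<Longrightarrow> \<tau> z = \<tau> z'" by (simp add: \<theta>_eq[of z] \<theta>_eq[of z'])
qed

text \<open>By flatness \<theta> near \<open>z'\<close> is a translate of \<theta> near
  \<open>z\<close> by a vector orthogonal to \<open>S\<close>. The subgradient inequality moves
  along with it near \<open>z'\<close>, and convexity makes it global.\<close>

lemma sub_shift:
  assumes z: "z \<in> ball zb \<epsilon>" "z' \<in> ball zb \<epsilon>" and orth: "\<And>c. c \<in> S \<Longrightarrow> c \<bullet> (z - z') = 0"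
    and l: "l \<in> subdifferential \<theta> z"
  shows "l \<in> subdifferential \<theta> z'"
proof (rule sub_localI)
  have zd: "z \<in> edom \<theta>" using l by (simp add: sub_iff)
  show "z' \<in> edom \<theta>" using flat_iff[OF z orth] zd by blast
  have lim: "((\<lambda>y. y + (z - z')) \<longlongrightarrow> z) (nhds z')"
    by (rule tendsto_eq_intros filterlim_ident | simp)+
  have "\<forall>\<^sub>F y in nhds z'. y + (z - z') \<in> ball zb \<epsilon>"
    using eventually_compose_filterlim[OF eventually_nhds_in_open[OF open_ball z(1)] lim] .
  then show "\<forall>\<^sub>F y in nhds z'. y \<in> edom \<theta> \<longrightarrow> \<tau> z' + l \<bullet> (y - z') \<le> \<tau> y"
    using eventually_nhds_in_open[OF open_ball z(2)]
  proof eventually_elim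
    case (elim y)
    show ?case
    proof
      assume y: "y \<in> edom \<theta>"
      have o: "c \<bullet> (y - (y + (z - z'))) = 0" if "c \<in> S" for c
        using orth[OF that] by (simp add: inner_diff_right inner_add_right)
      have "y + (z - z') \<in> edom \<theta>" "\<tau> y = \<tau> (y + (z - z'))"
        using flat_iff[OF elim(2,1) o] y by auto
      moreover from this have "\<tau> z + l \<bullet> (y + (z - z') - z) \<le> \<tau> (y + (z - z'))"
        using l unfolding sub_iff by blast
      moreover have "y + (z - z') - z = y - z'" by simp
      ultimately show "\<tau> z' + l \<bullet> (y - z') \<le> \<tau> y" using flat_iff(2)[OF z orth zd] by metis
    qed
  qed
qed

lemma sub_eq:
  assumes "z \<in> ball zb \<epsilon>" "z' \<in> ball zb \<epsilon>" "\<And>c. c \<in> S \<Longrightarrow> c \<bullet> (z - z') = 0"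
  shows "subdifferential \<theta> z = subdifferential \<theta> z'"
proof -
  have "c \<bullet> (z' - z) = 0" if "c \<in> S" for c using assms(3)[OF that] by (simp add: inner_diff_right)
  then show ?thesis using sub_shift[OF assms] sub_shift[OF assms(2,1)] by blast
qed

text \<open>Along the component u of \<open>l\<close> orthogonal to \<open>S\<close> the function
  \<tau> is locally constant, so the subgradient inequality forces l . u = |u|^2 to be at most 0.
  Thus the multipliers at all points near \<open>zb\<close>, not only those at \<open>zb\<close>,
  lie in \<open>S\<close>.\<close>

lemma sub_in_S:
  assumes z: "z \<in> ball zb \<epsilon>" and l: "l \<in> subdifferential \<theta> z"
  shows "l \<in> S"
proof -
  obtain s u where su: "s \<in> span S" "\<And>c. c \<in> span S \<Longrightarrow> orthogonal u c" "l = s + u"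
    using orthogonal_subspace_decomp_exists[of S l] by blast
  have sS: "span S = S" using S by (rule span_eq_iff[THEN iffD2])
  have uS: "c \<bullet> u = 0" if "c \<in> S" for c
    using su(2)[of c] that unfolding sS orthogonal_def by (simp add: inner_commute)
  have lim: "((\<lambda>t. z + t *\<^sub>R u) \<longlongrightarrow> z) (at_right 0)"
    by (rule tendsto_eq_intros | simp)+
  have "\<forall>\<^sub>F t in at_right (0::real). l \<bullet> u \<le> 0"
    using eventually_compose_filterlim[OF eventually_nhds_in_open[OF open_ball z] lim]
      eventually_at_right_less[of "0::real"]
  proof eventually_elim
    case (elim t)
    have o: "c \<bullet> (z - (z + t *\<^sub>R u)) = 0" if "c \<in> S" for c using uS[OF that] by simp
    have "z \<in> edom \<theta>" using l by (simp add: sub_iff)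
    then have "z + t *\<^sub>R u \<in> edom \<theta>" "\<tau> z = \<tau> (z + t *\<^sub>R u)"
      using flat_iff[OF z elim(1) o] by auto
    then have "\<tau> z + l \<bullet> (z + t *\<^sub>R u - z) \<le> \<tau> z" using l unfolding sub_iff by metis
    then show ?case using elim(2) by (simp add: mult_le_0_iff)
  qed
  then have "l \<bullet> u \<le> 0" by (simp add: eventually_const_iff)
  then have "u \<bullet> u \<le> 0" using uS su(1) sS by (simp add: su(3) inner_add_left)
  then have "u = 0" by (metis inner_ge_zero inner_eq_zero_iff order_antisym)
  then show ?thesis using su sS by simp
qed

lemma lb_S: "lb \<in> S"
  using sub_in_S[OF _ lb] \<epsilon> by simp

text \<open>The gradient in \<open>x\<close> of the Lagrangian; \<open>G'\<close> below is its strict derivative at \<open>(xb, wb, lb)\<close>.\<close>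

definition G :: "'x \<times> 'w \<Rightarrow> 'z \<Rightarrow> 'x" where
  "G p l = (\<Sum>b\<in>Basis. (D\<phi> p (b, 0) + l \<bullet> D\<Phi> p (b, 0)) *\<^sub>R b)"

lemma G_inner: "G p l \<bullet> a = D\<phi> p (a, 0) + l \<bullet> D\<Phi> p (a, 0)"
proof -
  have i: "bounded_linear (\<lambda>a::'x. (a, 0::'w))"
    by (rule bounded_linear_Pair[OF bounded_linear_ident bounded_linear_zero])
  have "linear (\<lambda>a. D\<phi> p (a, 0) + l \<bullet> D\<Phi> p (a, 0))"
    by (rule bounded_linear.linear[OF bounded_linear_add[OF
          bounded_linear_compose[OF blinfun.bounded_linear_right i]
          bounded_linear_compose[OF bounded_linear_inner_right
            bounded_linear_compose[OF blinfun.bounded_linear_right i]]]])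
  then show ?thesis unfolding G_def by (rule sum_Basis_inner)
qed

lemma G_eqI: "(\<And>a. v \<bullet> a = D\<phi> p (a, 0) + l \<bullet> D\<Phi> p (a, 0)) \<Longrightarrow> v = G p l"
  by (metis G_inner vector_eq_rdot)

lemma G_base: "G p0 lb = 0"
  using stationary by (intro G_eqI[symmetric]) simp

lemma Lagr_derivative:
  "((\<lambda>x. Lagr \<phi> \<Phi> x w l) has_derivative (\<lambda>a. a \<bullet> G (x, w) l)) (at x)"
proof -
  have d: "((\<lambda>x. (x, w)) has_derivative (\<lambda>a. (a, 0))) (at x)"
    by (auto intro!: derivative_eq_intros)
  show ?thesis
    unfolding Lagr_def
    by (rule derivative_eq_intros has_derivative_compose[OF d D\<phi>] has_derivative_compose[OF d D\<Phi>] refl)+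
      (simp add: inner_commute[of _ "G (x, w) l"] G_inner)
qed

lemma gradient_Lagr: "gradient (\<lambda>x. Lagr \<phi> \<Phi> x w l) x = G (x, w) l"
  using gradient_inner[OF Lagr_derivative] by (metis inner_commute vector_eq_rdot)

lemma partial_x_eq: "partial_x \<Phi> x w = (\<lambda>a. D\<Phi> (x, w) (a, 0))"
proof -
  have d: "((\<lambda>x. (x, w)) has_derivative (\<lambda>a. (a, 0))) (at x)"
    by (auto intro!: derivative_eq_intros)
  show ?thesis
    unfolding partial_x_def
    using frechet_derivative_at[OF has_derivative_compose[OF d D\<Phi>]] by simp
qed

definition G' :: "('x \<times> 'w) \<times> 'z \<Rightarrow> 'x" where
  "G' h = (\<Sum>b\<in>Basis. (D2\<phi> p0 (fst h) (b, 0) +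
      (lb \<bullet> D2\<Phi> p0 (fst h) (b, 0) + snd h \<bullet> D\<Phi> p0 (b, 0))) *\<^sub>R b)"

lemma strict_deriv_G: "strict_deriv (\<lambda>q. G (fst q) (snd q)) G' (p0, lb)"
proof -
  have 1: "strict_deriv (\<lambda>q::('x \<times> 'w) \<times> 'z. D\<phi> (fst q) (b, 0)) (\<lambda>h. D2\<phi> p0 (fst h) (b, 0)) (p0, lb)" for b
  proof -
    have "strict_deriv (\<lambda>q::('x \<times> 'w) \<times> 'z. D\<phi> (fst q)) (\<lambda>h. D2\<phi> p0 (fst h)) (p0, lb)"
      using strict_deriv_compose[OF strict_deriv_linear[OF bounded_linear_fst], of D\<phi> "blinfun_apply (D2\<phi> p0)" "(p0, lb)"]
        strict_deriv_C1[OF open_UNIV UNIV_I D2\<phi> D2\<phi>_cont, of p0] by simp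
    from strict_deriv_compose[OF this strict_deriv_linear[OF blinfun.bounded_linear_left[of "(b, 0)"]]]
    show ?thesis .
  qed
  have 2: "strict_deriv (\<lambda>q::('x \<times> 'w) \<times> 'z. D\<Phi> (fst q) (b, 0)) (\<lambda>h. D2\<Phi> p0 (fst h) (b, 0)) (p0, lb)" for b
  proof -
    have "strict_deriv (\<lambda>q::('x \<times> 'w) \<times> 'z. D\<Phi> (fst q)) (\<lambda>h. D2\<Phi> p0 (fst h)) (p0, lb)"
      using strict_deriv_compose[OF strict_deriv_linear[OF bounded_linear_fst], of D\<Phi> "blinfun_apply (D2\<Phi> p0)" "(p0, lb)"]
        strict_deriv_C1[OF open_UNIV UNIV_I D2\<Phi> D2\<Phi>_cont, of p0] by simp
    from strict_deriv_compose[OF this strict_deriv_linear[OF blinfun.bounded_linear_left[of "(b, 0)"]]]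
    show ?thesis .
  qed
  show ?thesis
    unfolding G_def G'_def
  proof (rule strict_deriv_sum)
    fix b :: 'x
    have "strict_deriv (\<lambda>q::('x \<times> 'w) \<times> 'z. snd q \<bullet> D\<Phi> (fst q) (b, 0))
      (\<lambda>h. lb \<bullet> D2\<Phi> p0 (fst h) (b, 0) + snd h \<bullet> D\<Phi> p0 (b, 0)) (p0, lb)"
      using strict_deriv_bilinear[OF bounded_bilinear_inner strict_deriv_linear[OF bounded_linear_snd] 2[of b]] by simp
    from strict_deriv_compose[OF strict_deriv_add[OF 1[of b] this] strict_deriv_linear[OF bounded_linear_scaleR_left[of b]]]
    show "strict_deriv (\<lambda>q::('x \<times> 'w) \<times> 'z. (D\<phi> (fst q) (b, 0) + snd q \<bullet> D\<Phi> (fst q) (b, 0)) *\<^sub>R b)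
      (\<lambda>h. (D2\<phi> p0 (fst h) (b, 0) + (lb \<bullet> D2\<Phi> p0 (fst h) (b, 0) + snd h \<bullet> D\<Phi> p0 (b, 0))) *\<^sub>R b) (p0, lb)" .
  qed
qed

lemma linear_G': "linear G'"
  using strict_deriv_bounded_linear[OF strict_deriv_G] by (simp add: linear_conv_bounded_linear)

lemma G'_mult: "G' (0, \<mu>) = adjoint A \<mu>"
proof -
  have "G' (0, \<mu>) \<bullet> a = adjoint A \<mu> \<bullet> a" for a
  proof -
    have "G' (0, \<mu>) = (\<Sum>b\<in>Basis. (\<mu> \<bullet> A b) *\<^sub>R b)"
      unfolding G'_def A_def by simp
    also have "\<dots> \<bullet> a = \<mu> \<bullet> A a"
      by (rule sum_Basis_inner) (auto intro!: linearI simp: linear_add[OF linear_A] linear_cmul[OF linear_A] inner_add_right)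
    finally show ?thesis by (simp add: adjoint_clauses(2)[OF linear_A])
  qed
  then show ?thesis by (metis vector_eq_rdot)
qed

lemma hessian_eq: "hessian (\<lambda>x. Lagr \<phi> \<Phi> x wb lb) xb = (\<lambda>a. G' ((a, 0), 0))"
proof -
  have d: "((\<lambda>x. ((x, wb), lb)) has_derivative (\<lambda>a. ((a, 0), 0))) (at xb)"
    by (auto intro!: derivative_eq_intros)
  have "gradient (\<lambda>x. Lagr \<phi> \<Phi> x wb lb) = (\<lambda>x. G (x, wb) lb)"
    by (simp add: gradient_Lagr fun_eq_iff)
  moreover have "((\<lambda>x. G (x, wb) lb) has_derivative (\<lambda>a. G' ((a, 0), 0))) (at xb)"
    using has_derivative_compose[OF d, of "\<lambda>q. G (fst q) (snd q)" G'] strict_deriv_has_derivative[OF strict_deriv_G] by simp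
  ultimately show ?thesis
    unfolding hessian_def by (simp add: frechet_derivative_at[symmetric])
qed

lemma linearized_iff:
  "(x, l) \<in> linearized_KKT_solutions \<phi> \<theta> \<Phi> xb wb lb (v1, v2) \<longleftrightarrow>
     v1 = G' ((x - xb, 0), l - lb) \<and> l \<in> subdifferential \<theta> (zb + A (x - xb) + v2)"
proof -
  have 1: "G' ((x - xb, 0), l - lb) = G' ((x - xb, 0), 0) + adjoint A (l - lb)"
    unfolding G'_mult[symmetric] linear_add[OF linear_G', symmetric] by simp
  have "v2 \<in> (\<lambda>z. - zb - A (x - xb) + z) ` {z. l \<in> subdifferential \<theta> z} \<longleftrightarrow>
      l \<in> subdifferential \<theta> (zb + A (x - xb) + v2)" (is "?L = ?R")
  proof
    assume ?R
    then show ?L by (intro image_eqI[of _ _ "zb + A (x - xb) + v2"]) auto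
  next
    assume ?L then show ?R by (auto simp: algebra_simps)
  qed
  then show ?thesis
    unfolding linearized_KKT_solutions_def inv_subdifferential_def hessian_eq partial_x_eq 1
    by (simp add: A_def[abs_def])
qed

text \<open>Solution map of the nonlinear system in both parameters, tilt first. Its localization at
  \<open>(0, wb)\<close> is the intermediate property to which strong regularity and full stability
  are both reduced.\<close>

definition KKT :: "'x \<times> 'w \<Rightarrow> ('x \<times> 'z) set" where
  "KKT u = {(x, l). fst u = G (x, snd u) l \<and> l \<in> subdifferential \<theta> (\<Phi> (x, snd u))}"

lemma KKT_base: "(xb, lb) \<in> KKT (0, wb)"
  by (simp add: KKT_def G_base lb)

end

section \<open>A chart straightening the constraint map modulo the orthogonal complement of
  S\<close>

locale reduced_problem =
  problem_data \<theta> \<tau> L\<tau> \<phi> \<Phi> D\<phi> D2\<phi> D\<Phi> D2\<Phi> xb wb lb S \<epsilon>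
  for \<theta> :: "'z::euclidean_space \<Rightarrow> ereal" and \<tau> L\<tau>
    and \<phi> :: "'x::euclidean_space \<times> 'w::euclidean_space \<Rightarrow> real" and \<Phi> D\<phi> D2\<phi> D\<Phi> D2\<Phi> xb wb lb S \<epsilon> +
  fixes R :: "'z \<Rightarrow> 'x"
  assumes R: "linear R" and ARS: "\<And>u c. c \<in> S \<Longrightarrow> c \<bullet> (D\<Phi> (xb, wb) (R u, 0) - u) = 0"
    and R0: "\<And>u. (\<And>c. c \<in> S \<Longrightarrow> c \<bullet> u = 0) \<Longrightarrow> R u = 0"
begin

lemma AR: "c \<in> S \<Longrightarrow> c \<bullet> A (R u) = c \<bullet> u"
  using ARS[of c u] by (simp add: A_def inner_diff_right)

text \<open>Chosen such that \<open>A \<Psi>(x, w)\<close> and \<open>\<Phi>(x, w) - zb\<close> differ by an element orthogonal to \<open>S\<close>, and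
  \<open>\<Psi>\<close> is the identity in \<open>x\<close> to first order.\<close>

definition \<Psi> :: "'x \<times> 'w \<Rightarrow> 'x \<times> 'w" where
  "\<Psi> p = (fst p - xb - R (A (fst p - xb)) + R (\<Phi> p - zb), snd p)"

lemma \<Psi>_base: "\<Psi> p0 = (0, wb)"
  by (simp add: \<Psi>_def linear_0[OF linear_A] linear_0[OF R])

lemma \<Psi>_orth: "c \<in> S \<Longrightarrow> c \<bullet> (zb + A (fst (\<Psi> p)) - \<Phi> p) = 0"
  by (simp add: \<Psi>_def linear_add[OF linear_A] linear_diff[OF linear_A] inner_add_right inner_diff_right AR)

text \<open>Encoded as a bounded linear function because the inverse function theorem asks for
  continuity of the derivative in operator norm. At \<open>p0\<close> it maps (a, b) to (a + R (B
  b), b).\<close>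

definition D\<Psi> :: "'x \<times> 'w \<Rightarrow> ('x \<times> 'w) \<Rightarrow>\<^sub>L ('x \<times> 'w)" where
  "D\<Psi> p = Blinfun (\<lambda>h. (fst h - R (A (fst h)), snd h)) + (Blinfun (\<lambda>u. (R u, 0)) o\<^sub>L D\<Phi> p)"

lemma bl_RA: "bounded_linear (\<lambda>x. R (A x))"
  by (rule bounded_linear_compose[OF linear_imp_bounded_linear[OF R] linear_imp_bounded_linear[OF linear_A]])

lemma D\<Psi>_apply: "D\<Psi> p h = (fst h - R (A (fst h)) + R (D\<Phi> p h), snd h)"
proof -
  have 1: "bounded_linear (\<lambda>h::'x \<times> 'w. (fst h - R (A (fst h)), snd h))"
    by (rule bounded_linear_Pair[OF bounded_linear_sub[OF bounded_linear_fst
        bounded_linear_compose[OF bl_RA bounded_linear_fst]] bounded_linear_snd])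
  have 2: "bounded_linear (\<lambda>u. (R u, 0::'w))"
    by (rule bounded_linear_Pair[OF linear_imp_bounded_linear[OF R] bounded_linear_zero])
  show ?thesis
    unfolding D\<Psi>_def blinfun.add_left blinfun_apply_blinfun_compose
      bounded_linear_Blinfun_apply[OF 1] bounded_linear_Blinfun_apply[OF 2] by simp
qed

lemma D\<Psi>: "(\<Psi> has_derivative D\<Psi> p) (at p)"
proof -
  have 1: "((\<lambda>p::'x \<times> 'w. fst p - xb) has_derivative fst) (at p)"
    by (auto intro!: derivative_eq_intros)
  have 2: "((\<lambda>p. \<Phi> p - zb) has_derivative D\<Phi> p) (at p)"
    using has_derivative_diff[OF D\<Phi>[of p] has_derivative_const[of zb]] by simp
  have "(\<Psi> has_derivative (\<lambda>h. (fst h - R (A (fst h)) + R (D\<Phi> p h), snd h))) (at p)"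
    unfolding \<Psi>_def
    by (rule has_derivative_Pair[OF has_derivative_add[OF has_derivative_diff[OF 1
        bounded_linear.has_derivative[OF bl_RA 1]] bounded_linear.has_derivative[OF linear_imp_bounded_linear[OF R] 2]]
        has_derivative_snd[OF has_derivative_ident]])
  then show ?thesis by (simp add: D\<Psi>_apply[abs_def])
qed

lemma continuous_D\<Phi>: "continuous_on UNIV D\<Phi>"
  using D2\<Phi> by (intro has_derivative_continuous_on[where f'="\<lambda>p. blinfun_apply (D2\<Phi> p)"])
    (auto intro: has_derivative_at_withinI)

lemma continuous_D\<Psi>: "continuous_on UNIV D\<Psi>"
  unfolding D\<Psi>_def
  by (rule continuous_on_add[OF continuous_on_const
      bounded_bilinear.continuous_on[OF bounded_bilinear_blinfun_compose continuous_on_const continuous_D\<Phi>]])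

text \<open>Inverse of \<open>D\<Psi> p0\<close>, hence the derivative of the inverse chart at the
  base point. The correction \<open>R (B b)\<close> records how the chart coordinate moves with the
  parameter.\<close>

definition E :: "'x \<times> 'w \<Rightarrow> 'x \<times> 'w" where
  "E h = (fst h - R (B (snd h)), snd h)"

lemma linear_E: "linear E"
  unfolding E_def by (rule linearI)
    (auto simp: linear_add[OF linear_B] linear_add[OF R] linear_cmul[OF linear_B] linear_cmul[OF R] algebra_simps)

lemma E_D\<Psi>: "E (D\<Psi> p0 h) = h"
  by (cases h) (simp add: E_def D\<Psi>_apply D\<Phi>_p0 linear_add[OF R])

lemma chart_exists:
  obtains N V g gd where "open N" "(xb, wb) \<in> N" "open V" "(0, wb) \<in> V" "homeomorphism N V \<Psi> g"
    "\<And>y. y \<in> V \<Longrightarrow> (g has_derivative gd y) (at y)"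
    "\<And>y. y \<in> V \<Longrightarrow> gd y = inv (blinfun_apply (D\<Psi> (g y)))"
    "\<And>y. y \<in> V \<Longrightarrow> bij (blinfun_apply (D\<Psi> (g y)))"
proof -
  have "Blinfun E o\<^sub>L D\<Psi> p0 = id_blinfun"
    by (rule blinfun_eqI) (simp add: bounded_linear_Blinfun_apply[OF linear_imp_bounded_linear[OF linear_E]] E_D\<Psi>)
  from inverse_function_theorem[OF open_UNIV D\<Psi> continuous_D\<Psi> UNIV_I this]
  show thesis
    using that unfolding \<Psi>_base by metis
qed

end

locale charted_problem = reduced_problem +
  fixes N V g gd
  assumes N: "open N" "(xb, wb) \<in> N" and V: "open V" "(0, wb) \<in> V"
    and hom: "homeomorphism N V \<Psi> g"
    and gd: "\<And>y. y \<in> V \<Longrightarrow> (g has_derivative gd y) (at y)"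
    and gd_eq: "\<And>y. y \<in> V \<Longrightarrow> gd y = inv (blinfun_apply (D\<Psi> (g y)))"
    and gd_bij: "\<And>y. y \<in> V \<Longrightarrow> bij (blinfun_apply (D\<Psi> (g y)))"
begin

lemma g_\<Psi>: "p \<in> N \<Longrightarrow> g (\<Psi> p) = p" "p \<in> N \<Longrightarrow> \<Psi> p \<in> V"
  and \<Psi>_g: "y \<in> V \<Longrightarrow> \<Psi> (g y) = y" "y \<in> V \<Longrightarrow> g y \<in> N"
  using hom unfolding homeomorphism_def by auto

lemma g_base: "g (0, wb) = p0"
  using g_\<Psi>(1)[OF N(2)] by (simp add: \<Psi>_base)

lemma snd_g: "y \<in> V \<Longrightarrow> snd (g y) = snd y"
  using \<Psi>_g(1)[of y] by (metis \<Psi>_def snd_conv)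

lemma \<Psi>_eq: "\<Psi> (x, w) = (fst (\<Psi> (x, w)), w)"
  by (simp add: \<Psi>_def)

lemma g_eq: "(\<xi>, w) \<in> V \<Longrightarrow> g (\<xi>, w) = (fst (g (\<xi>, w)), w)"
  using snd_g[of "(\<xi>, w)"] by (metis prod.collapse snd_conv)

lemma strict_deriv_\<Psi>: "strict_deriv \<Psi> (D\<Psi> p0) p0"
  by (rule strict_deriv_C1[OF open_UNIV UNIV_I D\<Psi> continuous_D\<Psi>])

lemma isCont_g: "y \<in> V \<Longrightarrow> isCont g y"
  using gd has_derivative_continuous by blast

lemma strict_deriv_g: "strict_deriv g E (0, wb)"
  using strict_deriv_inverse[OF strict_deriv_\<Psi> linear_imp_bounded_linear[OF linear_E] E_D\<Psi>, of g] isCont_g[OF V(2)] g_base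
    eventually_mono[OF eventually_nhds_in_open[OF V] \<Psi>_g(1)]
  by (simp add: \<Psi>_base)

lemma lip_near_\<Psi>: "lip_near \<Psi> p0"
  by (rule strict_deriv_lip_near[OF strict_deriv_\<Psi>])

lemma lip_near_g: "lip_near g (0, wb)"
  by (rule strict_deriv_lip_near[OF strict_deriv_g])

lemma strict_deriv_\<Phi>: "strict_deriv \<Phi> (D\<Phi> p0) p0"
  by (rule strict_deriv_C1[OF open_UNIV UNIV_I D\<Phi> continuous_D\<Phi>])

lemma lip_near_\<Phi>: "lip_near \<Phi> p0"
  by (rule strict_deriv_lip_near[OF strict_deriv_\<Phi>])

lemma ev_ball: "lip_near f p \<Longrightarrow> f p = zb \<Longrightarrow> \<forall>\<^sub>F z in nhds p. f z \<in> ball zb \<epsilon>"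
  using isCont_within_ball[OF lip_near_isCont \<epsilon>, of f p] by (simp add: dist_commute)

lemma sub_chart:
  assumes "zb + A (fst (\<Psi> p)) \<in> ball zb \<epsilon>" "\<Phi> p \<in> ball zb \<epsilon>"
  shows "subdifferential \<theta> (zb + A (fst (\<Psi> p))) = subdifferential \<theta> (\<Phi> p)"
  using sub_eq[OF assms] \<Psi>_orth by blast

section \<open>Transfer of localizations between the linearized and the nonlinear system\<close>

text \<open>A point \<open>(\<xi>, l, w)\<close> consists of the chart coordinate of \<open>x\<close>, the multiplier and the parameter.
  The equation \<open>Gc q = (v, w)\<close> on \<open>Q\<close> is the KKT system, and \<open>Gl q = (v, w)\<close> its linearization, where
  \<open>w\<close> is kept as an unknown so that both sides depend on it through the strict derivative \<open>Gc'\<close>.\<close>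

definition Q :: "('b \<times> 'a \<times> 'c) set" where
  "Q = {q. fst (snd q) \<in> subdifferential \<theta> (zb + A (fst q))}"

definition Gc :: "'b \<times> 'a \<times> 'c \<Rightarrow> 'b \<times> 'c" where
  "Gc q = (G (g (fst q, snd (snd q))) (fst (snd q)), snd (snd q))"

definition Gc' :: "'b \<times> 'a \<times> 'c \<Rightarrow> 'b \<times> 'c" where
  "Gc' q = (G' (E (fst q, snd (snd q)), fst (snd q)), snd (snd q))"

definition Gl :: "'b \<times> 'a \<times> 'c \<Rightarrow> 'b \<times> 'c" where
  "Gl q = (G' (E (fst q, snd (snd q) - wb), fst (snd q) - lb), snd (snd q))"

abbreviation "q0 \<equiv> (0, lb, wb)"

lemma strict_deriv_Gc: "strict_deriv Gc Gc' q0"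
proof -
  have 1: "bounded_linear (\<lambda>q::'b \<times> 'a \<times> 'c. (fst q, snd (snd q)))"
    "bounded_linear (\<lambda>q::'b \<times> 'a \<times> 'c. fst (snd q))"
    "bounded_linear (\<lambda>q::'b \<times> 'a \<times> 'c. snd (snd q))"
    by (intro bounded_linear_Pair bounded_linear_fst bounded_linear_snd
        bounded_linear_compose[OF bounded_linear_fst bounded_linear_snd]
        bounded_linear_compose[OF bounded_linear_snd bounded_linear_snd])+
  have 2: "strict_deriv (\<lambda>q. g (fst q, snd (snd q))) (\<lambda>q. E (fst q, snd (snd q))) q0"
    by (rule strict_deriv_compose[OF strict_deriv_linear[OF 1(1)]]) (simp add: strict_deriv_g)
  have 3: "strict_deriv (\<lambda>q. (g (fst q, snd (snd q)), fst (snd q)))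
      (\<lambda>q. (E (fst q, snd (snd q)), fst (snd q))) q0"
    by (rule strict_deriv_Pair[OF 2 strict_deriv_linear[OF 1(2)]])
  have 4: "strict_deriv (\<lambda>q. G (g (fst q, snd (snd q))) (fst (snd q)))
      (\<lambda>q. G' (E (fst q, snd (snd q)), fst (snd q))) q0"
    using strict_deriv_compose[OF 3, of "\<lambda>q. G (fst q) (snd q)" G'] strict_deriv_G by (simp add: g_base)
  show ?thesis
    unfolding Gc_def Gc'_def by (rule strict_deriv_Pair[OF 4 strict_deriv_linear[OF 1(3)]])
qed

text \<open>\<open>Gl\<close> is affine with linear part \<open>Gc'\<close>, so
  \<open>Gc - Gl\<close> has strict derivative zero at \<open>q0\<close>; this is the smallness that
  perturbation requires in either direction.\<close>

lemma Gl_diff: "Gl a - Gl b = Gc' (a - b)"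
proof -
  have "E (fst a, snd (snd a) - wb) - E (fst b, snd (snd b) - wb) = E (fst a - fst b, snd (snd a) - snd (snd b))"
    unfolding linear_diff[OF linear_E, symmetric] by simp
  then show ?thesis
    unfolding Gl_def Gc'_def by (simp add: linear_diff[OF linear_G', symmetric])
qed

lemma strict_deriv_Gl: "strict_deriv Gl Gc' q0"
  unfolding strict_deriv_def Gl_diff using strict_deriv_bounded_linear[OF strict_deriv_Gc] by (auto intro: zero_less_one)

lemma G'_0: "G' ((0, 0), 0) = 0"
  using linear_0[OF linear_G'] by (simp add: zero_prod_def)

lemma E_x: "E (\<xi>, 0) = (\<xi>, 0)"
  by (simp add: E_def linear_0[OF linear_B] linear_0[OF R])

lemma Gl_base: "Gl q0 = (0, wb)"
  by (simp add: Gl_def E_x G'_0)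

lemma Gc_base: "Gc q0 = (0, wb)"
  by (simp add: Gc_def g_base G_base)

lemma Q_base: "q0 \<in> Q"
  by (simp add: Q_def linear_0[OF linear_A] lb)

lemma loc_Gl_iff_Gc:
  "lipschitz_localization (\<lambda>p. {q \<in> Q. Gl q = p}) (0, wb) q0 \<longleftrightarrow>
   lipschitz_localization (\<lambda>p. {q \<in> Q. Gc q = p}) (0, wb) q0"
proof -
  have small: "\<exists>\<delta>>0. \<forall>a\<in>ball q0 \<delta>. \<forall>b\<in>ball q0 \<delta>. norm ((Gc a - Gc b) - (Gl a - Gl b)) \<le> e * norm (a - b)"
    if "e > 0" for e
    using strict_deriv_Gc that unfolding strict_deriv_def Gl_diff by blast
  have small': "\<exists>\<delta>>0. \<forall>a\<in>ball q0 \<delta>. \<forall>b\<in>ball q0 \<delta>. norm ((Gl a - Gl b) - (Gc a - Gc b)) \<le> e * norm (a - b)"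
    if "e > 0" for e
    using small[OF that] by (simp only: norm_minus_commute)
  note c = lip_near_isCont[OF strict_deriv_lip_near[OF strict_deriv_Gc]] lip_near_isCont[OF strict_deriv_lip_near[OF strict_deriv_Gl]]
  show ?thesis
    using lipschitz_localization_perturb[of Q Gl q0 Gc, OF _ Q_base c(2) small]
      lipschitz_localization_perturb[of Q Gc q0 Gl, OF _ Q_base c(1) small']
    unfolding Gl_base Gc_base by blast
qed

lemma lin_base: "(xb, lb) \<in> linearized_KKT_solutions \<phi> \<theta> \<Phi> xb wb lb (0, 0)"
  unfolding linearized_iff by (simp add: linear_0[OF linear_A] lb G'_0)

text \<open>Isolates the contribution of the parameter, which can then be moved into the first
  canonical perturbation.\<close>

lemma G'_E: "G' (E (\<xi>, \<omega>), \<mu>) = G' ((\<xi>, 0), \<mu>) + G' (E (0, \<omega>), 0)"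
proof -
  have "E (\<xi>, \<omega>) = (\<xi>, 0) + E (0, \<omega>)" by (simp add: E_def)
  then show ?thesis by (simp add: linear_add[OF linear_G', symmetric])
qed

lemmas lip_A = lip_near_linear[OF linear_A]
lemmas lip_R = lip_near_linear[OF R]
lemmas lip_intros = lip_near_bounded_linear[OF bounded_linear_fst] lip_near_bounded_linear[OF bounded_linear_snd] lip_near_id lip_near_const lip_near_Pair lip_near_add lip_near_diff
  lip_near_fst lip_near_snd lip_A lip_R

lemma lip_G'E: "lip_near (\<lambda>u. G' (E (0, snd u - wb), 0)) p" for p :: "'b \<times> 'c"
  by (intro lip_near_linear[OF linear_G'] lip_near_linear[OF linear_E] lip_near_Pair lip_near_const
      lip_near_diff lip_near_snd lip_near_id)

lemma lip_G'R: "lip_near (\<lambda>u. G' ((R (snd u), 0), 0)) p" for p :: "'b \<times> 'a"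
  by (intro lip_near_linear[OF linear_G'] lip_near_linear[OF R] lip_near_Pair lip_near_const
      lip_near_snd lip_near_id)

text \<open>Solving \<open>Gl q = (v, w)\<close> on \<open>Q\<close> amounts to the linearized
  system with first perturbation \<open>v - G' (E (0, w - wb), 0)\<close> and second perturbation 0,
  after the shift of \<open>x\<close> by \<open>xb\<close>.\<close>

lemma loc_lin_imp_Gl:
  assumes "lipschitz_localization (linearized_KKT_solutions \<phi> \<theta> \<Phi> xb wb lb) (0, 0) (xb, lb)"
  shows "lipschitz_localization (\<lambda>p. {q \<in> Q. Gl q = p}) (0, wb) q0"
proof (rule lipschitz_localization_transport[OF assms lin_base,
      where a = "\<lambda>u. (fst u - G' (E (0, snd u - wb), 0), 0)"
        and b = "\<lambda>u y. (fst y - xb, snd y, snd u)"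
        and c = "\<lambda>u q. (xb + fst q, fst (snd q))"])
  show "lip_near (\<lambda>u. (fst u - G' (E (0, snd u - wb), 0), 0)) (0, wb)"
    by (intro lip_near_Pair lip_near_diff lip_near_fst lip_near_id lip_near_const lip_G'E)
  show "(fst (0, wb) - G' (E (0, snd (0, wb) - wb), 0), 0) = (0, 0)"
    by (simp add: E_x G'_0)
  show "lip_near (\<lambda>z. (fst (snd z) - xb, snd (snd z), snd (fst z))) ((0::'b, wb), xb, lb)"
    by (intro lip_intros)
  show "isCont (\<lambda>z. (xb + fst (snd z), fst (snd (snd z)))) ((0, wb), q0)"
    by (intro continuous_intros)
  have 1: "(fst y - xb, snd y, snd u) \<in> {q \<in> Q. Gl q = u}"
    if "y \<in> linearized_KKT_solutions \<phi> \<theta> \<Phi> xb wb lb (fst u - G' (E (0, snd u - wb), 0), 0)" for u y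
    using that linearized_iff[of "fst y" "snd y"]
    by (auto simp: Q_def Gl_def G'_E[of _ "_ - wb" "_ - lb"] diff_eq_eq prod_eq_iff)
  then show "\<forall>\<^sub>F z in nhds ((0, wb), xb, lb). snd z \<in> linearized_KKT_solutions \<phi> \<theta> \<Phi> xb wb lb
      (fst (fst z) - G' (E (0, snd (fst z) - wb), 0), 0) \<longrightarrow>
      (fst (snd z) - xb, snd (snd z), snd (fst z)) \<in> {q \<in> Q. Gl q = fst z}"
    by (intro always_eventually) blast
  have 2: "(xb + fst q, fst (snd q)) \<in> linearized_KKT_solutions \<phi> \<theta> \<Phi> xb wb lb
      (fst u - G' (E (0, snd u - wb), 0), 0) \<and>
      (fst (xb + fst q, fst (snd q)) - xb, snd (xb + fst q, fst (snd q)), snd u) = q"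
    if "q \<in> {q \<in> Q. Gl q = u}" for u q
    using that by (auto simp: linearized_iff Q_def Gl_def G'_E[of _ "_ - wb" "_ - lb"])
  then show "\<forall>\<^sub>F z in nhds ((0, wb), q0). snd z \<in> {q \<in> Q. Gl q = fst z} \<longrightarrow>
      (xb + fst (snd z), fst (snd (snd z))) \<in> linearized_KKT_solutions \<phi> \<theta> \<Phi> xb wb lb
        (fst (fst z) - G' (E (0, snd (fst z) - wb), 0), 0) \<and>
      (fst (xb + fst (snd z), fst (snd (snd z))) - xb,
        snd (xb + fst (snd z), fst (snd (snd z))), snd (fst z)) = snd z"
    by (intro always_eventually) blast
qed simp_all

text \<open>The substitution \<xi> = x - xb + R v2 works because \<open>A (R v2) - v2\<close> is
  orthogonal to \<open>S\<close>, which leaves the subdifferential unchanged near \<open>zb\<close>;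
  the price is the term \<open>G' ((R v2, 0), 0)\<close> added to the tilt. The parameter stays at
  \<open>wb\<close>.\<close>

lemma loc_Gl_imp_lin:
  assumes "lipschitz_localization (\<lambda>p. {q \<in> Q. Gl q = p}) (0, wb) q0"
  shows "lipschitz_localization (linearized_KKT_solutions \<phi> \<theta> \<Phi> xb wb lb) (0, 0) (xb, lb)"
proof (rule lipschitz_localization_transport[OF assms,
      where a = "\<lambda>u. (fst u + G' ((R (snd u), 0), 0), wb)"
        and b = "\<lambda>u q. (xb + fst q - R (snd u), fst (snd q))"
        and c = "\<lambda>u y. (fst y - xb + R (snd u), snd y, wb)"])
  let ?T = "linearized_KKT_solutions \<phi> \<theta> \<Phi> xb wb lb"
  show "q0 \<in> {q \<in> Q. Gl q = (0, wb)}" by (simp add: Q_base Gl_base)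
  show "lip_near (\<lambda>u. (fst u + G' ((R (snd u), 0), 0), wb)) (0::'b, 0::'a)"
    by (intro lip_near_Pair lip_near_add lip_near_fst lip_near_id lip_near_const lip_G'R)
  show "(fst (0::'b, 0::'a) + G' ((R (snd (0::'b, 0::'a)), 0), 0), wb) = (0, wb)"
    by (simp add: linear_0[OF R] G'_0)
  show "lip_near (\<lambda>z. (xb + fst (snd z) - R (snd (fst z)), fst (snd (snd z)))) ((0::'b, 0::'a), q0)"
    by (intro lip_intros)
  show "(xb + fst q0 - R (snd (0::'b, 0::'a)), fst (snd q0)) = (xb, lb)"
    "(fst (xb, lb) - xb + R (snd (0::'b, 0::'a)), snd (xb, lb), wb) = q0"
    by (simp_all add: linear_0[OF R])
  show "isCont (\<lambda>z. (fst (snd z) - xb + R (snd (fst z)), snd (snd z), wb)) ((0::'b, 0::'a), xb, lb)"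
    by (rule lip_near_isCont) (intro lip_intros)
  have orth: "c \<bullet> (zb + A \<xi> - (zb + A (\<xi> - R v) + v)) = 0" if "c \<in> S" for c \<xi> v
    using AR[OF that, of v] by (simp add: linear_diff[OF linear_A] inner_diff_right inner_add_right)
  have G'_split: "G' ((\<xi> + \<eta>, 0), \<mu>) = G' ((\<xi>, 0), \<mu>) + G' ((\<eta>, 0), 0)" for \<xi> \<eta> \<mu>
    by (simp add: linear_add[OF linear_G', symmetric])
  have b1: "\<forall>\<^sub>F z in nhds ((0::'b, 0::'a), q0). zb + A (fst (snd z)) \<in> ball zb \<epsilon>"
    by (rule ev_ball) (intro lip_intros, simp add: linear_0[OF linear_A])
  have b2: "\<forall>\<^sub>F z in nhds ((0::'b, 0::'a), q0). zb + A (fst (snd z) - R (snd (fst z))) + snd (fst z) \<in> ball zb \<epsilon>"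
    by (rule ev_ball) (intro lip_intros, simp add: linear_0[OF linear_A] linear_0[OF R])
  show "\<forall>\<^sub>F z in nhds ((0::'b, 0::'a), q0). snd z \<in> {q \<in> Q. Gl q = (fst (fst z) + G' ((R (snd (fst z)), 0), 0), wb)} \<longrightarrow>
      (xb + fst (snd z) - R (snd (fst z)), fst (snd (snd z))) \<in> ?T (fst z)"
    using b1 b2
  proof eventually_elim
    case (elim z)
    obtain v1 v2 \<xi> l w where z: "z = ((v1, v2), \<xi>, l, w)" by (metis prod.collapse)
    have "l \<in> subdifferential \<theta> (zb + A \<xi>) \<longleftrightarrow> l \<in> subdifferential \<theta> (zb + A (\<xi> - R v2) + v2)"
      using sub_eq[OF elim orth] z by simp
    then show ?case
      using G'_split[of "\<xi> - R v2" "R v2" "l - lb"]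
      by (auto simp: z Q_def Gl_def linearized_iff E_x)
  qed
  have b3: "\<forall>\<^sub>F z in nhds ((0::'b, 0::'a), xb, lb). zb + A (fst (snd z) - xb + R (snd (fst z))) \<in> ball zb \<epsilon>"
    by (rule ev_ball) (intro lip_intros, simp add: linear_0[OF linear_A] linear_0[OF R])
  have b4: "\<forall>\<^sub>F z in nhds ((0::'b, 0::'a), xb, lb). zb + A (fst (snd z) - xb) + snd (fst z) \<in> ball zb \<epsilon>"
    by (rule ev_ball) (intro lip_intros, simp add: linear_0[OF linear_A] linear_0[OF R])
  show "\<forall>\<^sub>F z in nhds ((0::'b, 0::'a), xb, lb). snd z \<in> ?T (fst z) \<longrightarrow>
      (fst (snd z) - xb + R (snd (fst z)), snd (snd z), wb)
        \<in> {q \<in> Q. Gl q = (fst (fst z) + G' ((R (snd (fst z)), 0), 0), wb)} \<and>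
      (xb + fst (fst (snd z) - xb + R (snd (fst z)), snd (snd z), wb) - R (snd (fst z)),
        fst (snd (fst (snd z) - xb + R (snd (fst z)), snd (snd z), wb))) = snd z"
    using b3 b4
  proof eventually_elim
    case (elim z)
    obtain v1 v2 x l where z: "z = ((v1, v2), x, l)" by (metis prod.collapse)
    have "c \<bullet> (zb + A (x - xb + R v2) - (zb + A (x - xb) + v2)) = 0" if "c \<in> S" for c
      using orth[OF that, of "x - xb + R v2" v2] by simp
    then have "l \<in> subdifferential \<theta> (zb + A (x - xb + R v2)) \<longleftrightarrow> l \<in> subdifferential \<theta> (zb + A (x - xb) + v2)"
      using sub_eq[of "zb + A (x - xb + R v2)" "zb + A (x - xb) + v2"] elim z by simp
    then show ?case
      using G'_split[of "x - xb" "R v2" "l - lb"]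
      by (auto simp: z Q_def Gl_def linearized_iff E_x)
  qed
qed

lemma lip_b: "lip_near (\<lambda>z. (fst (g (fst (snd z), snd (snd (snd z)))), fst (snd (snd z)))) ((0::'b, wb), q0)"
  (is "lip_near _ ?p")
proof -
  have "lip_near (\<lambda>z. g (fst (snd z), snd (snd (snd z)))) ?p"
    by (rule lip_near_compose[of "\<lambda>z. (fst (snd z), snd (snd (snd z)))"], intro lip_intros)
      (simp add: lip_near_g)
  then show ?thesis by (intro lip_intros)
qed

lemma lip_c: "lip_near (\<lambda>z. (fst (\<Psi> (fst (snd z), snd (fst z))), snd (snd z), snd (fst z))) ((0::'b, wb), xb, lb)"
  (is "lip_near _ ?p")
proof -
  have "lip_near (\<lambda>z. \<Psi> (fst (snd z), snd (fst z))) ?p"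
    by (rule lip_near_compose[of "\<lambda>z. (fst (snd z), snd (fst z))"], intro lip_intros)
      (simp add: lip_near_\<Psi>)
  then show ?thesis by (intro lip_intros)
qed

text \<open>Stated for nearby points only: the inverse chart acts on \<open>V\<close>, and the two
  subdifferentials agree when both constraint points lie in the flatness ball. The second component
  of \<open>Gc\<close> forces the unknown parameter to equal the prescribed one, so no information
  is lost when it is dropped.\<close>

lemma ev_Gc_KKT:
  "\<forall>\<^sub>F z in nhds ((0, wb), q0). snd z \<in> {q \<in> Q. Gc q = fst z} \<longrightarrow>
     (fst (g (fst (snd z), snd (snd (snd z)))), fst (snd (snd z))) \<in> KKT (fst z) \<and>
     (fst (\<Psi> (fst (g (fst (snd z), snd (snd (snd z)))), snd (fst z))), fst (snd (snd z)), snd (fst z)) = snd z"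
proof -
  let ?p = "((0, wb), q0) :: ('b \<times> 'c) \<times> 'b \<times> 'a \<times> 'c"
  have l1: "lip_near (\<lambda>z::('b \<times> 'c) \<times> 'b \<times> 'a \<times> 'c. (fst (snd z), snd (snd (snd z)))) ?p"
    by (intro lip_intros)
  have l2: "lip_near (\<lambda>z::('b \<times> 'c) \<times> 'b \<times> 'a \<times> 'c. \<Phi> (g (fst (snd z), snd (snd (snd z))))) ?p"
    using lip_near_compose[OF lip_near_compose[OF l1, of g], of \<Phi>] lip_near_g lip_near_\<Phi> by (simp add: g_base)
  have b0: "\<forall>\<^sub>F z in nhds ?p. (fst (snd z), snd (snd (snd z))) \<in> V"
    using eventually_compose_filterlim[OF eventually_nhds_in_open[OF V(1)] lip_near_filterlim[OF l1]] V(2) by simp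
  have b1: "\<forall>\<^sub>F z in nhds ?p. zb + A (fst (snd z)) \<in> ball zb \<epsilon>"
    by (rule ev_ball) (intro lip_intros, simp add: linear_0[OF linear_A])
  have b2: "\<forall>\<^sub>F z in nhds ?p. \<Phi> (g (fst (snd z), snd (snd (snd z)))) \<in> ball zb \<epsilon>"
    by (rule ev_ball[OF l2]) (simp add: g_base)
  show ?thesis
    using b0 b1 b2
  proof eventually_elim
    case (elim z)
    obtain v w \<xi> l w' where z: "z = ((v, w), \<xi>, l, w')" by (metis prod.collapse)
    have inV: "(\<xi>, w') \<in> V" using elim z by simp
    have "subdifferential \<theta> (zb + A \<xi>) = subdifferential \<theta> (\<Phi> (g (\<xi>, w')))"
      using sub_chart[of "g (\<xi>, w')"] elim z by (simp add: \<Psi>_g(1))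
    then show ?case
      using \<Psi>_g(1)[OF inV] g_eq[OF inV] by (auto simp: z Q_def Gc_def KKT_def)
  qed
qed

lemma ev_KKT_Gc:
  "\<forall>\<^sub>F z in nhds ((0, wb), xb, lb). snd z \<in> KKT (fst z) \<longrightarrow>
     (fst (\<Psi> (fst (snd z), snd (fst z))), snd (snd z), snd (fst z)) \<in> {q \<in> Q. Gc q = fst z} \<and>
     (fst (g (fst (\<Psi> (fst (snd z), snd (fst z))), snd (fst z))), snd (snd z)) = snd z"
proof -
  let ?p = "((0, wb), xb, lb) :: ('b \<times> 'c) \<times> 'b \<times> 'a"
  have l1: "lip_near (\<lambda>z::('b \<times> 'c) \<times> 'b \<times> 'a. (fst (snd z), snd (fst z))) ?p"
    by (intro lip_intros)
  have l2: "lip_near (\<lambda>z::('b \<times> 'c) \<times> 'b \<times> 'a. \<Phi> (fst (snd z), snd (fst z))) ?p"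
    using lip_near_compose[OF l1, of \<Phi>] lip_near_\<Phi> by simp
  have l3: "lip_near (\<lambda>z::('b \<times> 'c) \<times> 'b \<times> 'a. \<Psi> (fst (snd z), snd (fst z))) ?p"
    using lip_near_compose[OF l1, of \<Psi>] lip_near_\<Psi> by simp
  have b0: "\<forall>\<^sub>F z in nhds ?p. (fst (snd z), snd (fst z)) \<in> N"
    using eventually_compose_filterlim[OF eventually_nhds_in_open[OF N(1)] lip_near_filterlim[OF l1]] N(2) by simp
  have b1: "\<forall>\<^sub>F z in nhds ?p. zb + A (fst (\<Psi> (fst (snd z), snd (fst z)))) \<in> ball zb \<epsilon>"
    by (rule ev_ball) (intro lip_intros l3, simp add: \<Psi>_base linear_0[OF linear_A])
  have b2: "\<forall>\<^sub>F z in nhds ?p. \<Phi> (fst (snd z), snd (fst z)) \<in> ball zb \<epsilon>"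
    by (rule ev_ball[OF l2]) simp
  show ?thesis
    using b0 b1 b2
  proof eventually_elim
    case (elim z)
    obtain v w x l where z: "z = ((v, w), x, l)" by (metis prod.collapse)
    have inN: "(x, w) \<in> N" using elim z by simp
    have gx: "g (fst (\<Psi> (x, w)), w) = (x, w)"
      using g_\<Psi>(1)[OF inN] \<Psi>_eq[of x w] by metis
    have "subdifferential \<theta> (zb + A (fst (\<Psi> (x, w)))) = subdifferential \<theta> (\<Phi> (x, w))"
      using sub_chart[of "(x, w)"] elim z by simp
    then show ?case
      using gx by (auto simp: z Q_def Gc_def KKT_def)
  qed
qed

lemma loc_Gc_iff_KKT:
  "lipschitz_localization (\<lambda>p. {q \<in> Q. Gc q = p}) (0, wb) q0 \<longleftrightarrow>
   lipschitz_localization KKT (0, wb) (xb, lb)"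
proof
  assume loc: "lipschitz_localization (\<lambda>p. {q \<in> Q. Gc q = p}) (0, wb) q0"
  show "lipschitz_localization KKT (0, wb) (xb, lb)"
  proof (rule lipschitz_localization_transport[OF loc, where a = "\<lambda>u. u"
        and b = "\<lambda>u q. (fst (g (fst q, snd (snd q))), fst (snd q))"
        and c = "\<lambda>u y. (fst (\<Psi> (fst y, snd u)), snd y, snd u)"])
    show "\<forall>\<^sub>F z in nhds ((0, wb), q0). snd z \<in> {q \<in> Q. Gc q = fst z} \<longrightarrow>
      (fst (g (fst (snd z), snd (snd (snd z)))), fst (snd (snd z))) \<in> KKT (fst z)"
      using ev_Gc_KKT by eventually_elim blast
    show "\<forall>\<^sub>F z in nhds ((0, wb), xb, lb). snd z \<in> KKT (fst z) \<longrightarrow>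
      (fst (\<Psi> (fst (snd z), snd (fst z))), snd (snd z), snd (fst z)) \<in> {q \<in> Q. Gc q = fst z} \<and>
      (fst (g (fst (fst (\<Psi> (fst (snd z), snd (fst z))), snd (snd z), snd (fst z)),
          snd (snd (fst (\<Psi> (fst (snd z), snd (fst z))), snd (snd z), snd (fst z))))),
        fst (snd (fst (\<Psi> (fst (snd z), snd (fst z))), snd (snd z), snd (fst z)))) = snd z"
      using ev_KKT_Gc by eventually_elim simp
  qed (simp_all add: Q_base Gc_base g_base \<Psi>_base lip_near_id lip_b lip_near_isCont[OF lip_c])
next
  assume loc: "lipschitz_localization KKT (0, wb) (xb, lb)"
  show "lipschitz_localization (\<lambda>p. {q \<in> Q. Gc q = p}) (0, wb) q0"
  proof (rule lipschitz_localization_transport[OF loc KKT_base, where a = "\<lambda>u. u"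
        and c = "\<lambda>u q. (fst (g (fst q, snd (snd q))), fst (snd q))"
        and b = "\<lambda>u y. (fst (\<Psi> (fst y, snd u)), snd y, snd u)"])
    show "\<forall>\<^sub>F z in nhds ((0, wb), xb, lb). snd z \<in> KKT (fst z) \<longrightarrow>
      (fst (\<Psi> (fst (snd z), snd (fst z))), snd (snd z), snd (fst z)) \<in> {q \<in> Q. Gc q = fst z}"
      using ev_KKT_Gc by eventually_elim blast
    show "\<forall>\<^sub>F z in nhds ((0, wb), q0). snd z \<in> {q \<in> Q. Gc q = fst z} \<longrightarrow>
      (fst (g (fst (snd z), snd (snd (snd z)))), fst (snd (snd z))) \<in> KKT (fst z) \<and>
      (fst (\<Psi> (fst (fst (g (fst (snd z), snd (snd (snd z)))), fst (snd (snd z))), snd (fst z))),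
       snd (fst (g (fst (snd z), snd (snd (snd z)))), fst (snd (snd z))), snd (fst z)) = snd z"
      using ev_Gc_KKT by eventually_elim simp
  qed (simp_all add: Q_base Gc_base g_base \<Psi>_base lip_near_id lip_c lip_near_isCont[OF lip_b])
qed

theorem loc_linearized_iff_KKT:
  "lipschitz_localization (linearized_KKT_solutions \<phi> \<theta> \<Phi> xb wb lb) (0, 0) (xb, lb) \<longleftrightarrow>
   lipschitz_localization KKT (0, wb) (xb, lb)"
  using loc_lin_imp_Gl loc_Gl_imp_lin loc_Gl_iff_Gc loc_Gc_iff_KKT by blast

section \<open>Optimality conditions and multipliers\<close>

definition \<psi> :: "'c \<Rightarrow> 'b \<Rightarrow> 'b \<Rightarrow> real" where
  "\<psi> w v x = \<phi> (x, w) + \<tau> (\<Phi> (x, w)) - v \<bullet> x"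

lemma objective_eq:
  "objective \<phi> \<theta> \<Phi> w v x = (if \<Phi> (x, w) \<in> edom \<theta> then ereal (\<psi> w v x) else \<infinity>)"
  unfolding objective_def \<psi>_def by (subst \<theta>_eq) simp

lemma isCont_\<Phi>: "isCont \<Phi> p"
  using D\<Phi> has_derivative_continuous by blast

lemma isCont_\<phi>: "isCont \<phi> p"
  using D\<phi> has_derivative_continuous by blast

text \<open>Along the preimage of a segment in the chart \<open>\<tau> \<circ> \<Phi>\<close> is convex, so a local minimum yields
  a first order inequality with a finite, not only infinitesimal, increment of \<open>\<tau>\<close>.\<close>

lemma segment_slope_nonneg:
  fixes p v d
  defines "y0 \<equiv> \<Psi> p"
  defines "k \<equiv> \<lambda>d. D\<phi> p (gd y0 (d, 0)) - v \<bullet> fst (gd y0 (d, 0))"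
  assumes pN: "p \<in> N" and balls: "\<Phi> p \<in> ball zb \<epsilon>" "zb + A (fst y0) \<in> ball zb \<epsilon>"
    and dom: "\<Phi> p \<in> edom \<theta>"
    and min: "\<forall>\<^sub>F x in nhds (fst p). \<Phi> (x, snd p) \<in> edom \<theta> \<longrightarrow> \<psi> (snd p) v (fst p) \<le> \<psi> (snd p) v x"
    and d: "zb + A (fst y0 + d) \<in> edom \<theta>"
  shows "0 \<le> k d + \<tau> (zb + A (fst y0 + d)) - \<tau> (zb + A (fst y0))"
proof -
  define \<xi> w z where "\<xi> = fst y0" and "w = snd p" and "z = zb + A \<xi>"
  have y0: "y0 = (\<xi>, w)" by (simp add: y0_def \<xi>_def w_def \<Psi>_def)
  have y0V: "y0 \<in> V" and gy0: "g y0 = p" using g_\<Psi>[OF pN] by (simp_all add: y0_def)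
  define c where "c t = g (\<xi> + t *\<^sub>R d, w)" for t :: real
  have c0: "c 0 = p" by (simp add: c_def y0[symmetric] gy0)
  define h where "h t = \<phi> (c t) - v \<bullet> fst (c t)" for t
  interpret gd: linear "gd y0" using gd[OF y0V] by (rule has_derivative_linear)
  have k_scale: "k (s *\<^sub>R d) = s * k d" for s
  proof -
    have "gd y0 (s *\<^sub>R d, 0) = s *\<^sub>R gd y0 (d, 0)" using gd.scale[of s "(d, 0)"] by simp
    then show ?thesis by (simp add: k_def blinfun.scaleR_right algebra_simps)
  qed
  have line: "((\<lambda>t. (\<xi> + t *\<^sub>R d, w)) has_derivative (\<lambda>s. (s *\<^sub>R d, 0))) (at (0::real))"
    by (auto intro!: derivative_eq_intros)
  have c_der: "(c has_derivative (\<lambda>s. gd y0 (s *\<^sub>R d, 0))) (at 0)"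
    unfolding c_def using has_derivative_compose[OF line, of g "gd y0"] gd[OF y0V] y0 by simp
  have "(h has_derivative (\<lambda>s. k (s *\<^sub>R d))) (at 0)"
    unfolding h_def k_def
    by (intro has_derivative_diff has_derivative_inner_right has_derivative_fst c_der
        has_derivative_compose[OF c_der, of \<phi> "D\<phi> p"]) (simp add: c0 D\<phi>)
  then have "(h has_real_derivative k d) (at 0)"
    unfolding has_field_derivative_def k_scale by (simp add: mult_commute_abs)
  then have h_lim: "((\<lambda>t. (h t - h 0) / t) \<longlongrightarrow> k d) (at_right 0)"
    unfolding DERIV_def by (auto intro: tendsto_mono[OF at_le[OF subset_UNIV]])
  have line_lim: "((\<lambda>t. (\<xi> + t *\<^sub>R d, w)) \<longlongrightarrow> y0) (at_right 0)"
    unfolding y0 by (rule tendsto_eq_intros | simp)+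
  have c_lim: "(c \<longlongrightarrow> p) (at_right 0)"
    using isCont_tendsto_compose[OF isCont_g[OF y0V] line_lim] by (simp add: c_def[abs_def] gy0)
  have evV: "\<forall>\<^sub>F t in at_right 0. (\<xi> + t *\<^sub>R d, w) \<in> V"
    using eventually_compose_filterlim[OF eventually_nhds_in_open[OF V(1) y0V] line_lim] .
  have evmin: "\<forall>\<^sub>F t in at_right 0. \<Phi> (fst (c t), w) \<in> edom \<theta> \<longrightarrow> \<psi> w v (fst p) \<le> \<psi> w v (fst (c t))"
    using eventually_compose_filterlim[OF min tendsto_fst[OF c_lim]] by (simp add: w_def)
  have ev1: "\<forall>\<^sub>F t in at_right 0. \<Phi> (c t) \<in> ball zb \<epsilon>"
    using eventually_compose_filterlim[OF eventually_nhds_in_open[OF open_ball balls(1)]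
        isCont_tendsto_compose[OF isCont_\<Phi> c_lim]] .
  have "((\<lambda>t. zb + A (\<xi> + t *\<^sub>R d)) \<longlongrightarrow> zb + A \<xi>) (at_right 0)"
    using tendsto_fst[OF line_lim] y0
    by (intro tendsto_intros bounded_linear.tendsto[OF linear_imp_bounded_linear[OF linear_A]]) simp
  then have ev2: "\<forall>\<^sub>F t in at_right 0. zb + A (\<xi> + t *\<^sub>R d) \<in> ball zb \<epsilon>"
    using eventually_compose_filterlim[OF eventually_nhds_in_open[OF open_ball balls(2)]] by (simp add: \<xi>_def)
  have ev3: "\<forall>\<^sub>F t in at_right (0::real). t < 1"
    using eventually_at_right[of 0 1 "\<lambda>t::real. t < 1"] by (auto intro!: exI[of _ 1])
  have orth: "s \<bullet> (zb + A (fst (\<Psi> q)) - \<Phi> q) = 0" if "s \<in> S" for s q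
    using \<Psi>_orth[OF that] .
  have z: "z \<in> edom \<theta>" "\<tau> z = \<tau> (\<Phi> p)"
    using flat_iff[OF balls(2,1)] orth dom by (simp_all add: z_def \<xi>_def y0_def)
  have "\<forall>\<^sub>F t in at_right 0. 0 \<le> (h t - h 0) / t + (\<tau> (z + A d) - \<tau> z)"
    using evV evmin ev1 ev2 ev3 eventually_at_right_less[of "0::real"]
  proof eventually_elim
    case (elim t)
    have \<Psi>c: "\<Psi> (c t) = (\<xi> + t *\<^sub>R d, w)" and sc: "snd (c t) = w"
      using \<Psi>_g(1)[OF elim(1)] snd_g[OF elim(1)] by (simp_all add: c_def)
    have eq: "zb + A (\<xi> + t *\<^sub>R d) = (1 - t) *\<^sub>R z + t *\<^sub>R (z + A d)"
      by (simp add: z_def linear_add[OF linear_A] linear_cmul[OF linear_A] algebra_simps)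
    have d': "z + A d \<in> edom \<theta>"
      using d by (simp add: z_def \<xi>_def linear_add[OF linear_A] add.assoc)
    have e: "zb + A (\<xi> + t *\<^sub>R d) \<in> edom \<theta>"
      unfolding eq using convexD_alt[OF dom_convex z(1) d', of t] elim by simp
    \<comment> \<open>Flatness replaces \<Phi> along the curve by its affine representative, on
      which convexity of \<tau> can be used.\<close>
    have f: "\<Phi> (c t) \<in> edom \<theta>" "\<tau> (\<Phi> (c t)) = \<tau> (zb + A (\<xi> + t *\<^sub>R d))"
      using flat_iff[OF elim(4,3)] orth[of _ "c t"] e \<Psi>c by simp_all
    have ct: "c t = (fst (c t), w)" "p = (fst p, w)" using sc by (simp_all add: prod_eq_iff w_def)
    have "\<psi> w v (fst p) \<le> \<psi> w v (fst (c t))" using elim(2) f(1) ct by metis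
    then have "h 0 + \<tau> z \<le> h t + \<tau> (zb + A (\<xi> + t *\<^sub>R d))"
      unfolding \<psi>_def using ct f(2) z(2) by (simp add: h_def c0)
    also have "\<tau> (zb + A (\<xi> + t *\<^sub>R d)) \<le> (1 - t) * \<tau> z + t * \<tau> (z + A d)"
      unfolding eq using convex_onD[OF \<tau>_convex, of t z "z + A d"] elim by simp
    finally have "0 \<le> (h t - h 0) + t * (\<tau> (z + A d) - \<tau> z)"
      by (simp add: algebra_simps)
    then show ?case using elim(6) by (simp add: field_simps)
  qed
  moreover have "((\<lambda>t. (h t - h 0) / t + (\<tau> (z + A d) - \<tau> z)) \<longlongrightarrow> k d + (\<tau> (z + A d) - \<tau> z)) (at_right 0)"
    by (intro tendsto_intros h_lim)
  ultimately have "0 \<le> k d + (\<tau> (z + A d) - \<tau> z)"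
    by (intro tendsto_lowerbound) auto
  then show ?thesis by (simp add: z_def \<xi>_def linear_add[OF linear_A] add.assoc)
qed

text \<open>The derivative \<open>k\<close> of the smooth part in the chart coordinate is balanced
  against finite increments of \<tau>. Directions in which \<tau> is flat show that \<open>k\<close>
  factors through \<open>A\<close> modulo the orthogonal complement of \<open>S\<close>, and the
  factor yields the multiplier. The neighborhood is chosen before the tilt, so it is uniform in
  \<open>v\<close>.\<close>

lemma necessary:
  "\<forall>\<^sub>F p in nhds p0. \<forall>v. \<Phi> p \<in> edom \<theta> \<longrightarrow>
     (\<forall>\<^sub>F x in nhds (fst p). \<Phi> (x, snd p) \<in> edom \<theta> \<longrightarrow> \<psi> (snd p) v (fst p) \<le> \<psi> (snd p) v x) \<longrightarrow>
     (\<exists>l. (fst p, l) \<in> KKT (v, snd p))"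
proof -
  have b0: "\<forall>\<^sub>F p in nhds p0. p \<in> N"
    by (rule eventually_nhds_in_open[OF N])
  have b1: "\<forall>\<^sub>F p in nhds p0. zb + A (fst (\<Psi> p)) \<in> ball zb \<epsilon>"
    by (rule ev_ball) (intro lip_intros lip_near_\<Psi>, simp add: \<Psi>_base linear_0[OF linear_A])
  have b2: "\<forall>\<^sub>F p in nhds p0. \<Phi> p \<in> ball zb \<epsilon>"
    by (rule ev_ball[OF lip_near_\<Phi>]) simp
  show ?thesis
    using b0 b1 b2
  proof (eventually_elim, intro allI impI)
    fix p v
    assume pN: "p \<in> N" and b: "zb + A (fst (\<Psi> p)) \<in> ball zb \<epsilon>" "\<Phi> p \<in> ball zb \<epsilon>" and dom: "\<Phi> p \<in> edom \<theta>"
      and min: "\<forall>\<^sub>F x in nhds (fst p). \<Phi> (x, snd p) \<in> edom \<theta> \<longrightarrow> \<psi> (snd p) v (fst p) \<le> \<psi> (snd p) v x"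
    define y0 z where "y0 = \<Psi> p" and "z = zb + A (fst y0)"
    define k where "k d = D\<phi> p (gd y0 (d, 0)) - v \<bullet> fst (gd y0 (d, 0))" for d
    have y0V: "y0 \<in> V" and gy0: "g y0 = p" using g_\<Psi>[OF pN] by (simp_all add: y0_def)
    have zA: "zb + A (fst y0 + d) = z + A d" for d
      by (simp add: z_def linear_add[OF linear_A] add.assoc)
    have slope: "0 \<le> k d + \<tau> (z + A d) - \<tau> z" if "z + A d \<in> edom \<theta>" for d
      using segment_slope_nonneg[OF pN b(2,1) dom min, of d] that
      by (simp add: k_def y0_def z_def linear_add[OF linear_A] add.assoc)
    have zball: "z \<in> ball zb \<epsilon>" using b(1) by (simp add: z_def y0_def)
    have zdom: "z \<in> edom \<theta>"
      using flat_iff[OF b] \<Psi>_orth dom by (simp add: z_def y0_def)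
    interpret gd: linear "gd y0" using gd[OF y0V] by (rule has_derivative_linear)
    have linear_k: "linear k"
    proof (rule linearI)
      show "k (a + b) = k a + k b" for a b
        using gd.add[of "(a, 0)" "(b, 0)"] by (simp add: k_def blinfun.add_right inner_add_right)
      show "k (r *\<^sub>R a) = r *\<^sub>R k a" for r a
        using gd.scale[of r "(a, 0)"] by (simp add: k_def blinfun.scaleR_right algebra_simps)
    qed
    have k_nonneg: "0 \<le> k d" if o: "\<And>s. s \<in> S \<Longrightarrow> s \<bullet> A d = 0" for d
    proof -
      have lim: "((\<lambda>t. z + t *\<^sub>R A d) \<longlongrightarrow> z) (at_right 0)"
        by (rule tendsto_eq_intros | simp)+
      have "\<forall>\<^sub>F t in at_right (0::real). 0 \<le> k d"
        using eventually_compose_filterlim[OF eventually_nhds_in_open[OF open_ball zball] lim]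
          eventually_at_right_less[of "0::real"]
      proof eventually_elim
        case (elim t)
        have o': "s \<bullet> (z - (z + t *\<^sub>R A d)) = 0" if "s \<in> S" for s using o[OF that] by simp
        have "z + A (t *\<^sub>R d) \<in> edom \<theta>" "\<tau> z = \<tau> (z + A (t *\<^sub>R d))"
          using flat_iff[OF zball elim(1) o'] zdom by (simp_all add: linear_cmul[OF linear_A])
        then have "0 \<le> k (t *\<^sub>R d)" using slope[of "t *\<^sub>R d"] by simp
        then show ?case using elim(2) by (simp add: linear_cmul[OF linear_k] zero_le_mult_iff)
      qed
      then show ?thesis by (simp add: eventually_const_iff)
    qed
    \<comment> \<open>The condition on \<open>d\<close> is invariant under sign, so the one-sided
      inequality holds for \<open>d\<close> and for \<open>- d\<close>.\<close>
    have k_zero: "k d = 0" if o: "\<And>s. s \<in> S \<Longrightarrow> s \<bullet> A d = 0" for d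
      using k_nonneg[OF o] k_nonneg[of "- d"] o
      by (simp add: linear_neg[OF linear_k] linear_neg[OF linear_A])
    \<comment> \<open>The multiplier represents minus \<open>k\<close> composed with
      \<open>R\<close>. Because \<open>k\<close> vanishes on d - R (A d), this gives k d = - l . A
      d, and the slope inequality turns into a subgradient inequality.\<close>
    define l where "l = (\<Sum>b\<in>Basis. (- k (R b)) *\<^sub>R b)"
    have l: "l \<bullet> u = - k (R u)" for u
      unfolding l_def by (rule sum_Basis_inner)
        (auto intro!: linearI simp: linear_add[OF R] linear_cmul[OF R] linear_add[OF linear_k] linear_cmul[OF linear_k])
    have kl: "k d = - (l \<bullet> A d)" for d
    proof -
      have "k (d - R (A d)) = 0"
        using AR by (intro k_zero) (simp add: linear_diff[OF linear_A] inner_diff_right)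
      then show ?thesis by (simp add: l linear_diff[OF linear_k])
    qed
    have l_sub: "l \<in> subdifferential \<theta> z"
    proof (rule sub_localI[OF zdom])
      have lim: "((\<lambda>y. z + A (R (y - z))) \<longlongrightarrow> z + A (R (z - z))) (nhds z)"
        by (intro tendsto_intros filterlim_ident bounded_linear.tendsto[OF linear_imp_bounded_linear[OF linear_A]]
            bounded_linear.tendsto[OF linear_imp_bounded_linear[OF R]])
      have "z + A (R (z - z)) \<in> ball zb \<epsilon>"
        using zball linear_0[OF R] linear_0[OF linear_A] by simp
      from eventually_compose_filterlim[OF eventually_nhds_in_open[OF open_ball this] lim]
        eventually_nhds_in_open[OF open_ball zball]
      show "\<forall>\<^sub>F y in nhds z. y \<in> edom \<theta> \<longrightarrow> \<tau> z + l \<bullet> (y - z) \<le> \<tau> y"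
      proof eventually_elim
        case (elim y)
        show ?case
        proof
          assume y: "y \<in> edom \<theta>"
          have o: "s \<bullet> (y - (z + A (R (y - z)))) = 0" if "s \<in> S" for s
            using AR[OF that, of "y - z"] by (simp add: inner_diff_right inner_add_right)
          have "z + A (R (y - z)) \<in> edom \<theta>" "\<tau> y = \<tau> (z + A (R (y - z)))"
            using flat_iff[OF elim(2,1) o] y by auto
          then show "\<tau> z + l \<bullet> (y - z) \<le> \<tau> y"
            using slope[of "R (y - z)"] l[of "y - z"] by simp
        qed
      qed
    qed
    have lS: "l \<in> S" by (rule sub_in_S[OF zball l_sub])
    have "l \<in> subdifferential \<theta> (\<Phi> p)"
      using l_sub sub_chart[OF b] by (simp add: z_def y0_def)
    moreover have "v = G p l"
    proof (rule G_eqI)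
      fix a
      \<comment> \<open>The chart direction that corresponds to \<open>a\<close>: the derivative of
        the inverse chart takes it back to \<open>a\<close>, so \<open>k d\<close> is the derivative
        of the tilted smooth part along \<open>a\<close>.\<close>
      define d where "d = fst (D\<Psi> p (a, 0))"
      have d: "D\<Psi> p (a, 0) = (d, 0)" by (simp add: d_def D\<Psi>_apply)
      have "bij (blinfun_apply (D\<Psi> p))" using gd_bij[OF y0V] by (simp add: gy0)
      then have "gd y0 (d, 0) = (a, 0)"
        unfolding gd_eq[OF y0V] gy0 d[symmetric] by (intro inv_f_f bij_is_inj)
      then have "k d = D\<phi> p (a, 0) - v \<bullet> a" by (simp add: k_def)
      moreover have "l \<bullet> A d = l \<bullet> D\<Phi> p (a, 0)"
        using AR[OF lS] by (simp add: d_def D\<Psi>_apply linear_add[OF linear_A] linear_diff[OF linear_A]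
            inner_add_right inner_diff_right)
      ultimately show "v \<bullet> a = D\<phi> p (a, 0) + l \<bullet> D\<Phi> p (a, 0)" using kl[of d] by simp
    qed
    ultimately show "\<exists>l. (fst p, l) \<in> KKT (v, snd p)" by (auto simp: KKT_def)
  qed
qed

lemma lip_near_G: "lip_near (\<lambda>q. G (fst q) (snd q)) (p0, lb)"
  by (rule strict_deriv_lip_near[OF strict_deriv_G])

text \<open>For l in \<open>S\<close> the identity |l|^2 = l . A (R l) bounds |l| by the norm of the
  adjoint of \<open>A\<close> at l; passing to a nearby derivative costs at most |l|/2, which is
  absorbed. Only the reference multiplier has to be near \<open>lb\<close>. The other one is
  arbitrary in \<open>S\<close>, so the estimate also localizes multipliers about which nothing is
  known.\<close>

lemma multiplier_bound:
  obtains c where "c > 0" "\<forall>\<^sub>F z in nhds (p0, p0, lb). \<forall>l\<in>S. snd (snd z) \<in> S \<longrightarrow>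
    norm (l - snd (snd z)) \<le> c * (norm (G (fst z) l - G (fst (snd z)) (snd (snd z))) + norm (fst z - fst (snd z)))"
proof -
  obtain K where K: "K > 0" "\<And>u. norm (R u) \<le> norm u * K"
    using bounded_linear.pos_bounded[OF linear_imp_bounded_linear[OF R]] by blast
  obtain L U where U: "open U" "(p0, lb) \<in> U" "L-lipschitz_on U (\<lambda>q. G (fst q) (snd q))"
    using lip_near_G unfolding lip_near_def by blast
  have L: "L \<ge> 0" using lipschitz_on_nonneg[OF U(3)] .
  define P where "P = (p0, p0, lb)"
  have "isCont D\<Phi> p0" using continuous_D\<Phi> by (simp add: continuous_on_eq_continuous_at)
  then have "\<forall>\<^sub>F p in nhds p0. dist (D\<Phi> p) (D\<Phi> p0) < 1 / (2 * K)"
    using K(1) by (intro isCont_within_ball) auto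
  then have e1: "\<forall>\<^sub>F z in nhds P. dist (D\<Phi> (fst z)) (D\<Phi> p0) < 1 / (2 * K)"
    unfolding P_def nhds_prod by (rule eventually_compose_filterlim[OF _ filterlim_fst])
  have l2: "filterlim (\<lambda>z. (fst z, snd (snd z))) (nhds (p0, lb)) (nhds P)"
    unfolding P_def nhds_prod
    by (intro filterlim_Pair filterlim_fst filterlim_compose[OF filterlim_snd filterlim_snd])
  have e2: "\<forall>\<^sub>F z in nhds P. (fst z, snd (snd z)) \<in> U"
    using eventually_compose_filterlim[OF eventually_nhds_in_open[OF U(1,2)] l2] .
  have l3: "filterlim snd (nhds (p0, lb)) (nhds P)"
    unfolding P_def nhds_prod by (rule filterlim_snd)
  have e3: "\<forall>\<^sub>F z in nhds P. snd z \<in> U"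
    using eventually_compose_filterlim[OF eventually_nhds_in_open[OF U(1,2)] l3] .
  have "\<forall>\<^sub>F z in nhds P. \<forall>l\<in>S. snd (snd z) \<in> S \<longrightarrow> norm (l - snd (snd z)) \<le>
      (2 * K * (1 + L)) * (norm (G (fst z) l - G (fst (snd z)) (snd (snd z))) + norm (fst z - fst (snd z)))"
    using e1 e2 e3
  proof (eventually_elim, intro ballI impI)
    fix z l1
    assume a1: "dist (D\<Phi> (fst z)) (D\<Phi> p0) < 1 / (2 * K)" and a2: "(fst z, snd (snd z)) \<in> U" and a3: "snd z \<in> U"
      and l1: "l1 \<in> S" and l2S: "snd (snd z) \<in> S"
    obtain p1 p2 l2 where z: "z = (p1, p2, l2)" by (metis prod.collapse)
    define l where "l = l1 - l2"
    have lS: "l \<in> S" using subspace_diff[OF S l1 l2S] by (simp add: l_def z)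
    define u where "u = G p1 l1 - G p1 l2"
    have u: "u \<bullet> a = l \<bullet> D\<Phi> p1 (a, 0)" for a
      by (simp add: u_def l_def inner_diff_left G_inner)
    have DP: "norm ((D\<Phi> p0 - D\<Phi> p1) (R l, 0)) \<le> norm l / 2"
    proof -
      have "norm ((D\<Phi> p0 - D\<Phi> p1) (R l, 0)) \<le> norm (D\<Phi> p0 - D\<Phi> p1) * norm (R l, 0::'c)"
        by (rule norm_blinfun)
      also have "\<dots> \<le> 1 / (2 * K) * (norm l * K)"
        using a1 K by (intro mult_mono) (auto simp: z dist_norm norm_minus_commute norm_Pair)
      finally show ?thesis using K(1) by simp
    qed
    have "norm l * norm l = l \<bullet> A (R l)"
      using AR[OF lS, of l] by (simp add: power2_norm_eq_inner[symmetric] power2_eq_square)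
    also have "\<dots> = u \<bullet> R l + l \<bullet> ((D\<Phi> p0 - D\<Phi> p1) (R l, 0))"
      by (simp add: u A_def blinfun.diff_left inner_diff_right)
    also have "\<dots> \<le> norm u * (norm l * K) + norm l * (norm l / 2)"
      by (intro add_mono order_trans[OF norm_cauchy_schwarz] mult_left_mono K DP) auto
    finally have "norm l * norm l \<le> norm l * (2 * K * norm u)" by (simp add: algebra_simps)
    then have nl: "norm l \<le> 2 * K * norm u"
      using K(1) by (cases "norm l = 0") (auto simp: mult_le_cancel_left)
    \<comment> \<open>The reference multiplier is moved from \<open>p2\<close> to \<open>p1\<close>,
      at the price of the Lipschitz constant of \<open>G\<close> in its point.\<close>
    have "norm (G p1 l2 - G p2 l2) \<le> L * norm (p1 - p2)"
      using lipschitz_onD[OF U(3) a2 a3] by (simp add: z dist_norm norm_Pair)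
    moreover have "u = (G p1 l1 - G p2 l2) - (G p1 l2 - G p2 l2)" by (simp add: u_def)
    ultimately have "norm u \<le> norm (G p1 l1 - G p2 l2) + L * norm (p1 - p2)"
      by (metis add_left_mono norm_triangle_ineq4 order_trans)
    also have "\<dots> \<le> (1 + L) * (norm (G p1 l1 - G p2 l2) + norm (p1 - p2))"
      using L by (simp add: algebra_simps)
    finally have "2 * K * norm u \<le> 2 * K * ((1 + L) * (norm (G p1 l1 - G p2 l2) + norm (p1 - p2)))"
      using K(1) by (intro mult_left_mono) auto
    then show "norm (l1 - snd (snd z)) \<le> 2 * K * (1 + L) *
        (norm (G (fst z) l1 - G (fst (snd z)) (snd (snd z))) + norm (fst z - fst (snd z)))"
      using nl by (simp add: z l_def mult.assoc)
  qed
  then show thesis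
    using K(1) L by (intro that[of "2 * K * (1 + L)"]) (auto simp: P_def)
qed

text \<open>With tilt \<open>G p l\<close> the subgradient inequality for \<tau> reduces the claim
  to the Lagrangian, whose \<open>x\<close>-gradient is Lipschitz with constant L near the base
  point. The mean value theorem on the segment leaves an error of at most L |d|^2; the constant L +
  1 is used so that it is positive.\<close>

lemma prox_regular:
  obtains r where "r > 0" "\<forall>\<^sub>F z in nhds (p0, lb, xb).
    fst (snd z) \<in> subdifferential \<theta> (\<Phi> (fst z)) \<longrightarrow> \<Phi> (snd (snd z), snd (fst z)) \<in> edom \<theta> \<longrightarrow>
    \<psi> (snd (fst z)) (G (fst z) (fst (snd z))) (fst (fst z)) - r * (norm (snd (snd z) - fst (fst z)))\<^sup>2
      \<le> \<psi> (snd (fst z)) (G (fst z) (fst (snd z))) (snd (snd z))"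
proof -
  obtain L U where U: "open U" "(p0, lb) \<in> U" "L-lipschitz_on U (\<lambda>q. G (fst q) (snd q))"
    using lip_near_G unfolding lip_near_def by blast
  have L: "L \<ge> 0" using lipschitz_on_nonneg[OF U(3)] .
  obtain \<delta> where \<delta>: "\<delta> > 0" "ball (p0, lb) \<delta> \<subseteq> U"
    using U(1,2) open_contains_ball by metis
  define P where "P = (p0, lb, xb)"
  have l1: "filterlim (\<lambda>z. (fst z, fst (snd z))) (nhds (p0, lb)) (nhds P)"
    unfolding P_def nhds_prod
    by (intro filterlim_Pair filterlim_fst filterlim_compose[OF filterlim_fst filterlim_snd])
  have e1: "\<forall>\<^sub>F z in nhds P. (fst z, fst (snd z)) \<in> ball (p0, lb) \<delta>"
    using \<delta>(1) by (intro eventually_compose_filterlim[OF eventually_nhds_in_open[OF open_ball] l1]) auto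
  have l2: "filterlim (\<lambda>z. ((snd (snd z), snd (fst z)), fst (snd z))) (nhds (p0, lb)) (nhds P)"
    unfolding P_def nhds_prod
    by (intro filterlim_Pair filterlim_compose[OF filterlim_fst filterlim_snd]
        filterlim_compose[OF filterlim_snd filterlim_snd] filterlim_compose[OF filterlim_snd filterlim_fst])
  have e2: "\<forall>\<^sub>F z in nhds P. ((snd (snd z), snd (fst z)), fst (snd z)) \<in> ball (p0, lb) \<delta>"
    using \<delta>(1) by (intro eventually_compose_filterlim[OF eventually_nhds_in_open[OF open_ball] l2]) auto
  have "\<forall>\<^sub>F z in nhds P.
    fst (snd z) \<in> subdifferential \<theta> (\<Phi> (fst z)) \<longrightarrow> \<Phi> (snd (snd z), snd (fst z)) \<in> edom \<theta> \<longrightarrow>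
    \<psi> (snd (fst z)) (G (fst z) (fst (snd z))) (fst (fst z)) - (L + 1) * (norm (snd (snd z) - fst (fst z)))\<^sup>2
      \<le> \<psi> (snd (fst z)) (G (fst z) (fst (snd z))) (snd (snd z))"
    using e1 e2
  proof (eventually_elim, intro impI)
    fix z
    assume a1: "(fst z, fst (snd z)) \<in> ball (p0, lb) \<delta>"
      and a2: "((snd (snd z), snd (fst z)), fst (snd z)) \<in> ball (p0, lb) \<delta>"
      and sub: "fst (snd z) \<in> subdifferential \<theta> (\<Phi> (fst z))"
      and dom: "\<Phi> (snd (snd z), snd (fst z)) \<in> edom \<theta>"
    obtain x w l x' where z: "z = ((x, w), l, x')" by (metis prod.collapse)
    define d where "d = x' - x"
    define h where "h t = Lagr \<phi> \<Phi> (x + t *\<^sub>R d) w l" for t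
    have line: "((\<lambda>t. x + t *\<^sub>R d) has_derivative (\<lambda>s. s *\<^sub>R d)) (at t)" for t
      by (auto intro!: derivative_eq_intros)
    have "(h has_real_derivative (d \<bullet> G (x + t *\<^sub>R d, w) l)) (at t)" for t
      unfolding h_def has_field_derivative_def
      using has_derivative_compose[OF line Lagr_derivative[of w l]] by (simp add: mult_commute_abs)
    then obtain t where t: "0 < t" "t < 1" "h 1 - h 0 = (1 - 0) * (d \<bullet> G (x + t *\<^sub>R d, w) l)"
      using MVT2[of 0 1 h "\<lambda>t. d \<bullet> G (x + t *\<^sub>R d, w) l"] by auto
    have seg: "((x + t *\<^sub>R d, w), l) \<in> U" "((x, w), l) \<in> U"
    proof -
      have "((x + t *\<^sub>R d, w), l) = (1 - t) *\<^sub>R ((x, w), l) + t *\<^sub>R ((x', w), l)"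
        by (simp add: d_def algebra_simps scaleR_add_left[symmetric])
      also have "\<dots> \<in> ball (p0, lb) \<delta>"
        using convexD_alt[OF convex_ball, of "((x, w), l)" "(p0, lb)" \<delta> "((x', w), l)" t] a1 a2 t by (simp add: z)
      finally show "((x + t *\<^sub>R d, w), l) \<in> U" using \<delta>(2) by blast
      show "((x, w), l) \<in> U" using a1 \<delta>(2) by (auto simp: z)
    qed
    have "norm (G (x + t *\<^sub>R d, w) l - G (x, w) l) \<le> L * norm (t *\<^sub>R d)"
      using lipschitz_onD[OF U(3) seg] by (simp add: dist_norm norm_Pair)
    also have "\<dots> \<le> L * norm d"
      using t L by (intro mult_left_mono) (auto simp: mult_left_le_one_le)
    finally have "norm d * norm (G (x + t *\<^sub>R d, w) l - G (x, w) l) \<le> norm d * (L * norm d)"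
      by (intro mult_left_mono) auto
    then have "\<bar>d \<bullet> (G (x + t *\<^sub>R d, w) l - G (x, w) l)\<bar> \<le> L * (norm d)\<^sup>2"
      using Cauchy_Schwarz_ineq2[of d "G (x + t *\<^sub>R d, w) l - G (x, w) l"]
      by (simp add: power2_eq_square algebra_simps)
    also have "\<dots> \<le> (L + 1) * (norm d)\<^sup>2" by (simp add: algebra_simps)
    finally have "d \<bullet> G (x, w) l - (L + 1) * (norm d)\<^sup>2 \<le> h 1 - h 0"
      using t(3) by (simp add: inner_diff_right abs_le_iff)
    moreover have "\<tau> (\<Phi> (x, w)) + l \<bullet> (\<Phi> (x', w) - \<Phi> (x, w)) \<le> \<tau> (\<Phi> (x', w))"
      using sub dom by (simp add: z sub_iff)
    moreover have "h 1 = \<phi> (x', w) + l \<bullet> \<Phi> (x', w)" "h 0 = \<phi> (x, w) + l \<bullet> \<Phi> (x, w)"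
      by (simp_all add: h_def d_def Lagr_def)
    ultimately show "\<psi> (snd (fst z)) (G (fst z) (fst (snd z))) (fst (fst z))
        - (L + 1) * (norm (snd (snd z) - fst (fst z)))\<^sup>2
        \<le> \<psi> (snd (fst z)) (G (fst z) (fst (snd z))) (snd (snd z))"
      by (simp add: z \<psi>_def d_def inner_diff_right inner_diff_left inner_commute)
  qed
  then show thesis using L by (intro that[of "L + 1"]) (auto simp: P_def)
qed

end

section \<open>Nondegeneracy and full stability\<close>

lemma lip_nearI:
  assumes "\<forall>\<^sub>F z in nhds (p, p). dist (f (fst z)) (f (snd z)) \<le> K * dist (fst z) (snd z)"
  shows "lip_near f p"
proof -
  obtain P Q where P: "eventually P (nhds p)" and Q: "eventually Q (nhds p)"
    and PQ: "\<And>x y. P x \<Longrightarrow> Q y \<Longrightarrow> dist (f x) (f y) \<le> K * dist x y"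
    using assms unfolding nhds_prod eventually_prod_filter by auto
  obtain U where U: "open U" "p \<in> U" "\<And>x. x \<in> U \<Longrightarrow> P x \<and> Q x"
    using eventually_conj[OF P Q] unfolding eventually_nhds by blast
  have "\<bar>K\<bar>-lipschitz_on U f"
  proof (rule lipschitz_onI)
    fix x y assume "x \<in> U" "y \<in> U"
    then have "dist (f x) (f y) \<le> K * dist x y" using U(3) PQ by blast
    also have "\<dots> \<le> \<bar>K\<bar> * dist x y" by (intro mult_right_mono) auto
    finally show "dist (f x) (f y) \<le> \<bar>K\<bar> * dist x y" .
  qed simp
  then show ?thesis unfolding lip_near_def using U by blast
qed

text \<open>Tube lemma in filter form; it makes a stable inequality at each point of a sphere
  uniform over the sphere.\<close>

lemma eventually_ball_compact:
  assumes K: "compact K" and ev: "\<And>x. x \<in> K \<Longrightarrow> \<forall>\<^sub>F z in nhds (u0, x). P (fst z) (snd z)"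
  shows "\<forall>\<^sub>F u in nhds u0. \<forall>x\<in>K. P u x"
proof -
  define W where "W = \<Union>{T. open T \<and> (\<forall>z\<in>T. P (fst z) (snd z))}"
  have "open W" unfolding W_def by (intro open_Union) auto
  moreover have "{u0} \<times> K \<subseteq> W"
    using ev unfolding W_def eventually_nhds by fastforce
  ultimately obtain X where X: "u0 \<in> X" "open X" "X \<times> K \<subseteq> W"
    using Elementary_Topology.tube_lemma[OF K, of W u0] by blast
  have "\<forall>x\<in>K. P u x" if "u \<in> X" for u
    using X(3) that unfolding W_def by fastforce
  then show ?thesis unfolding eventually_nhds using X by blast
qed

context problem_data
begin

lemma convex_sub: "convex (subdifferential \<theta> z)"
proof (rule convexI)
  fix x y and u v :: real
  assume xy: "x \<in> subdifferential \<theta> z" "y \<in> subdifferential \<theta> z" and uv: "0 \<le> u" "0 \<le> v" "u + v = 1"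
  have "\<tau> z + (u *\<^sub>R x + v *\<^sub>R y) \<bullet> (q - z) \<le> \<tau> q" if q: "q \<in> edom \<theta>" for q
  proof -
    have "\<tau> z + (u *\<^sub>R x + v *\<^sub>R y) \<bullet> (q - z) = u * (\<tau> z + x \<bullet> (q - z)) + v * (\<tau> z + y \<bullet> (q - z))"
      using uv(3) by (simp add: inner_add_left distrib_left) (metis distrib_right mult_1)
    also have "\<dots> \<le> u * \<tau> q + v * \<tau> q"
      using xy q uv by (intro add_mono mult_left_mono) (auto simp: sub_iff)
    also have "\<dots> = \<tau> q" using uv(3) by (metis distrib_right mult_1)
    finally show ?thesis .
  qed
  then show "u *\<^sub>R x + v *\<^sub>R y \<in> subdifferential \<theta> z" using xy(1) by (simp add: sub_iff)
qed

text \<open>A nonzero \<open>\<mu>\<close> in \<open>S\<close> with \<open>A\<^sup>* \<mu> = 0\<close> would give two nearby solutions for the same data: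
  move a multiplier from the relative interior of the subdifferential along \<open>\<mu>\<close>.\<close>

lemma localization_imp_nondegenerate:
  assumes hull: "S = affine hull (subdifferential \<theta> zb)"
    and loc: "lipschitz_localization (linearized_KKT_solutions \<phi> \<theta> \<Phi> xb wb lb) (0, 0) (xb, lb)"
  shows "S \<inter> {l. adjoint A l = 0} = {0}"
proof (intro equalityI subsetI)
  fix \<mu> assume "\<mu> \<in> S \<inter> {l. adjoint A l = 0}"
  then have \<mu>: "\<mu> \<in> S" "adjoint A \<mu> = 0" by auto
  let ?T = "linearized_KKT_solutions \<phi> \<theta> \<Phi> xb wb lb" and ?C = "subdifferential \<theta> zb"
  \<comment> \<open>The perturbation for which \<open>(xb, l)\<close> solves the linearized system;
    its first component is the adjoint of \<open>A\<close> applied to l - lb, so it does not change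
    when l moves along \<mu>.\<close>
  define h where "h l = (G' ((0, 0), l - lb), 0 :: 'z)" for l
  have G'0: "G' ((0, 0), 0) = 0" using linear_0[OF linear_G'] by (simp add: zero_prod_def)
  have mem: "(xb, l) \<in> ?T (h l) \<longleftrightarrow> l \<in> ?C" for l
    by (simp add: h_def linearized_iff linear_0[OF linear_A])
  have "(xb, lb) \<in> ?T (0, 0)"
    using mem[of lb] lb by (simp add: h_def G'0)
  then obtain s where "\<forall>\<^sub>F z in nhds ((0, 0), (xb, lb)). snd z \<in> ?T (fst z) \<longrightarrow> snd z = s (fst z)"
    using lipschitz_localizationE[OF loc] by blast
  moreover have "filterlim (\<lambda>l. (h l, (xb, l))) (nhds ((0, 0), (xb, lb))) (nhds lb)"
  proof -
    have "lip_near (\<lambda>l. (h l, (xb, l))) lb"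
      unfolding h_def
      by (intro lip_near_Pair lip_near_linear[OF linear_G'] lip_near_const lip_near_diff lip_near_id)
    from lip_near_filterlim[OF this] show ?thesis by (simp add: h_def G'0)
  qed
  ultimately have "\<forall>\<^sub>F l in nhds lb. l \<in> ?C \<longrightarrow> (xb, l) = s (h l)"
    using eventually_compose_filterlim[where P = "\<lambda>z. snd z \<in> ?T (fst z) \<longrightarrow> snd z = s (fst z)"]
    by (fastforce simp: mem)
  then obtain \<delta> where \<delta>: "\<delta> > 0" "\<And>l. l \<in> ball lb \<delta> \<Longrightarrow> l \<in> ?C \<Longrightarrow> (xb, l) = s (h l)"
    unfolding eventually_nhds_metric by (auto simp: dist_commute)
  \<comment> \<open>\<open>lb\<close> itself may lie on the relative boundary. A nearby relative
    interior point has room in every direction of \<open>S\<close>, because \<open>S\<close> is the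
    affine hull.\<close>
  have "lb \<in> closure (rel_interior ?C)"
    using lb closure_subset[of ?C] convex_closure_rel_interior[OF convex_sub] by blast
  then obtain l1 where l1: "l1 \<in> rel_interior ?C" "dist l1 lb < \<delta>"
    using \<delta>(1) unfolding closure_approachable by blast
  then obtain e where e: "e > 0" "cball l1 e \<inter> S \<subseteq> ?C" and l1C: "l1 \<in> ?C"
    unfolding mem_rel_interior_cball hull by blast
  have "\<forall>\<^sub>F t in at_right (0::real). t * norm \<mu> < e"
    by (rule order_tendstoD(2)[where y = 0], (rule tendsto_eq_intros | simp add: e)+)
  moreover have "\<forall>\<^sub>F t in at_right 0. l1 + t *\<^sub>R \<mu> \<in> ball lb \<delta>"
  proof (rule topological_tendstoD)
    show "((\<lambda>t. l1 + t *\<^sub>R \<mu>) \<longlongrightarrow> l1) (at_right 0)"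
      by (rule tendsto_eq_intros | simp)+
  qed (use l1 in \<open>auto simp: dist_commute\<close>)
  ultimately have "\<forall>\<^sub>F t in at_right (0::real). \<mu> = 0"
    using eventually_at_right_less[of "0::real"]
  proof eventually_elim
    case (elim t)
    have "l1 \<in> S" using l1C hull_subset[of ?C affine] by (auto simp: hull)
    then have "l1 + t *\<^sub>R \<mu> \<in> S" using \<mu>(1) S by (simp add: subspace_add subspace_mul)
    moreover have "l1 + t *\<^sub>R \<mu> \<in> cball l1 e" using elim by (simp add: dist_norm)
    ultimately have C: "l1 + t *\<^sub>R \<mu> \<in> ?C" using e(2) by blast
    have "G' ((0, 0), l1 + t *\<^sub>R \<mu> - lb) = G' ((0, 0), l1 - lb) + t *\<^sub>R G' ((0, 0), \<mu>)"
      unfolding linear_cmul[OF linear_G', symmetric] linear_add[OF linear_G', symmetric]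
      by (simp add: algebra_simps)
    also have "G' ((0, 0), \<mu>) = 0" using G'_mult[of \<mu>] \<mu>(2) by (simp add: zero_prod_def)
    finally have "h (l1 + t *\<^sub>R \<mu>) = h l1" by (simp add: h_def)
    then have "(xb, l1 + t *\<^sub>R \<mu>) = (xb, l1)"
      using \<delta>(2)[OF elim(2) C] \<delta>(2)[OF _ l1C] l1(2) by (simp add: dist_commute)
    then show ?case using elim(3) by simp
  qed
  then show "\<mu> \<in> {0}" by (simp add: eventually_const_iff)
next
  fix l :: 'z assume "l \<in> {0}"
  then show "l \<in> S \<inter> {l. adjoint A l = 0}"
    using subspace_0[OF S] linear_0[OF adjoint_linear[OF linear_A]] by simp
qed

end

section \<open>From a localization of the KKT system to full stability\<close>

context charted_problem
begin

lemma M_set_iff: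
  "x \<in> M_set \<phi> \<theta> \<Phi> xb \<gamma> w v \<longleftrightarrow> x \<in> cball xb \<gamma> \<and> \<Phi> (x, w) \<in> edom \<theta> \<and>
     (\<forall>y\<in>cball xb \<gamma>. \<Phi> (y, w) \<in> edom \<theta> \<longrightarrow> \<psi> w v x \<le> \<psi> w v y)" (is "_ \<longleftrightarrow> ?R")
proof
  assume "x \<in> M_set \<phi> \<theta> \<Phi> xb \<gamma> w v"
  then have x: "x \<in> cball xb \<gamma>" "objective \<phi> \<theta> \<Phi> w v x = m_val \<phi> \<theta> \<Phi> xb \<gamma> w v"
    "objective \<phi> \<theta> \<Phi> w v x < \<infinity>" by (auto simp: M_set_def)
  then have d: "\<Phi> (x, w) \<in> edom \<theta>" by (auto simp: objective_eq split: if_splits)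
  have "\<psi> w v x \<le> \<psi> w v y" if "y \<in> cball xb \<gamma>" "\<Phi> (y, w) \<in> edom \<theta>" for y
  proof -
    have "objective \<phi> \<theta> \<Phi> w v x \<le> objective \<phi> \<theta> \<Phi> w v y"
      unfolding x(2) m_val_def by (rule INF_lower[OF that(1)])
    then show ?thesis using d that by (simp add: objective_eq)
  qed
  then show ?R using x d by blast
next
  assume R: ?R
  have "objective \<phi> \<theta> \<Phi> w v x = m_val \<phi> \<theta> \<Phi> xb \<gamma> w v"
    unfolding m_val_def
  proof (rule antisym)
    show "objective \<phi> \<theta> \<Phi> w v x \<le> (INF x\<in>cball xb \<gamma>. objective \<phi> \<theta> \<Phi> w v x)"
      using R by (intro INF_greatest) (auto simp: objective_eq)
    show "(INF x\<in>cball xb \<gamma>. objective \<phi> \<theta> \<Phi> w v x) \<le> objective \<phi> \<theta> \<Phi> w v x"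
      using R by (intro INF_lower) auto
  qed
  moreover have "objective \<phi> \<theta> \<Phi> w v x < \<infinity>"
    using R by (simp add: objective_eq)
  ultimately show "x \<in> M_set \<phi> \<theta> \<Phi> xb \<gamma> w v"
    using R unfolding M_set_def by blast
qed

lemma m_val_eq: "x \<in> M_set \<phi> \<theta> \<Phi> xb \<gamma> w v \<Longrightarrow> m_val \<phi> \<theta> \<Phi> xb \<gamma> w v = ereal (\<psi> w v x)"
proof -
  assume x: "x \<in> M_set \<phi> \<theta> \<Phi> xb \<gamma> w v"
  then have "objective \<phi> \<theta> \<Phi> w v x = m_val \<phi> \<theta> \<Phi> xb \<gamma> w v" unfolding M_set_def by blast
  then show ?thesis using x unfolding M_set_iff objective_eq by simp
qed

lemma \<psi>_tilt: "\<psi> w v' x = \<psi> w v x - (v' - v) \<bullet> x"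
  by (simp add: \<psi>_def inner_diff_left)

lemma isCont_\<psi>: "isCont (\<lambda>z. \<psi> (fst (fst z)) (snd (fst z)) (snd z)) q"
proof -
  have \<tau>: "isCont \<tau> z" for z
    using lipschitz_on_continuous_on[OF \<tau>_lip] by (simp add: continuous_on_eq_continuous_at)
  have 1: "isCont (\<lambda>z::('c \<times> 'b) \<times> 'b. (snd z, fst (fst z))) q"
    by (intro continuous_intros)
  show ?thesis
    unfolding \<psi>_def
    by (intro continuous_intros isCont_o2[OF 1 isCont_\<phi>] isCont_o2[OF isCont_o2[OF 1 isCont_\<Phi>] \<tau>])
qed

lemma ev_\<Phi>_ball: "\<forall>\<^sub>F p in nhds p0. \<Phi> p \<in> ball zb \<epsilon>"
  by (rule ev_ball[OF lip_near_\<Phi>]) simp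

theorem localization_imp_fully_stable:
  assumes loc: "lipschitz_localization KKT (0, wb) (xb, lb)"
    and \<gamma>0: "\<gamma>0 > 0" "xb \<in> M_set \<phi> \<theta> \<Phi> xb \<gamma>0 wb 0"
  shows "fully_stable \<phi> \<theta> \<Phi> xb wb 0"
proof -
  obtain s where s: "lip_near s (0, wb)" "s (0, wb) = (xb, lb)" "\<forall>\<^sub>F u in nhds (0, wb). s u \<in> KKT u"
    "\<forall>\<^sub>F z in nhds ((0, wb), (xb, lb)). snd z \<in> KKT (fst z) \<longrightarrow> snd z = s (fst z)"
    using lipschitz_localizationE[OF loc KKT_base] by blast
  define sol where "sol u = fst (s u)" for u
  have sol_lip: "lip_near sol (0, wb)" unfolding sol_def by (intro lip_near_fst s(1))
  have sol_base: "sol (0, wb) = xb" by (simp add: sol_def s(2))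
  have sol_lim: "filterlim sol (nhds xb) (nhds (0, wb))"
    using lip_near_filterlim[OF sol_lip] by (simp add: sol_base)
  have sol_feas: "\<forall>\<^sub>F u in nhds (0, wb). \<Phi> (sol u, snd u) \<in> edom \<theta>"
    using s(3) by eventually_elim (auto simp: KKT_def sol_def sub_iff split: prod.splits)
  obtain c where c: "c > 0" "\<forall>\<^sub>F z in nhds (p0, p0, lb). \<forall>l\<in>S. snd (snd z) \<in> S \<longrightarrow>
    norm (l - snd (snd z)) \<le> c * (norm (G (fst z) l - G (fst (snd z)) (snd (snd z))) + norm (fst z - fst (snd z)))"
    using multiplier_bound by blast
  obtain P1 P2 P3 where P: "eventually P1 (nhds (0, wb))" "eventually P2 (nhds xb)" "eventually P3 (nhds lb)"
    and P_uniq: "\<And>u x l. P1 u \<Longrightarrow> P2 x \<Longrightarrow> P3 l \<Longrightarrow> (x, l) \<in> KKT u \<Longrightarrow> (x, l) = s u"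
  proof -
    obtain P1 P' where 1: "eventually P1 (nhds (0, wb))" "eventually P' (nhds (xb, lb))"
      "\<And>u y. P1 u \<Longrightarrow> P' y \<Longrightarrow> y \<in> KKT u \<Longrightarrow> y = s u"
      using s(4) unfolding nhds_prod[of "(0, wb)"] eventually_prod_filter by auto
    obtain P2 P3 where 2: "eventually P2 (nhds xb)" "eventually P3 (nhds lb)" "\<And>x l. P2 x \<Longrightarrow> P3 l \<Longrightarrow> P' (x, l)"
      using 1(2) unfolding nhds_prod eventually_prod_filter by auto
    show thesis using that[OF 1(1) 2(1,2)] 1(3) 2(3) by blast
  qed
  obtain \<delta> where \<delta>: "\<delta> > 0" "\<And>l. norm (l - lb) < \<delta> \<Longrightarrow> P3 l"
    using P(3) unfolding eventually_nhds_metric dist_norm by blast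
  \<comment> \<open>A local minimizer near \<open>xb\<close> has some multiplier; the estimate
    against the pair of \<open>p0\<close> and \<open>lb\<close> places it near \<open>lb\<close>
    however it was obtained, and then the uniqueness part of the localization applies.\<close>
  have locmin: "\<forall>\<^sub>F z in nhds ((0, wb), xb). \<Phi> (snd z, snd (fst z)) \<in> edom \<theta> \<longrightarrow>
      (\<forall>\<^sub>F x in nhds (snd z). \<Phi> (x, snd (fst z)) \<in> edom \<theta> \<longrightarrow>
         \<psi> (snd (fst z)) (fst (fst z)) (snd z) \<le> \<psi> (snd (fst z)) (fst (fst z)) x) \<longrightarrow>
      snd z = sol (fst z)"
  proof -
    let ?F = "nhds ((0, wb), xb) :: (('b \<times> 'c) \<times> 'b) filter"
    have lp: "lip_near (\<lambda>z::('b \<times> 'c) \<times> 'b. (snd z, snd (fst z))) ((0, wb), xb)" by (intro lip_intros)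
    have lim_p: "filterlim (\<lambda>z. (snd z, snd (fst z))) (nhds p0) ?F"
      using lip_near_filterlim[OF lp] by simp
    have lq: "lip_near (\<lambda>z::('b \<times> 'c) \<times> 'b. ((snd z, snd (fst z)), p0, lb)) ((0, wb), xb)" by (intro lip_intros)
    have lim_q: "filterlim (\<lambda>z. ((snd z, snd (fst z)), p0, lb)) (nhds (p0, p0, lb)) ?F"
      using lip_near_filterlim[OF lq] by simp
    have "((\<lambda>z::('b \<times> 'c) \<times> 'b. c * (norm (fst (fst z)) + norm ((snd z, snd (fst z)) - p0)))
        \<longlongrightarrow> c * (norm (fst (fst ((0::'b, wb), xb))) + norm (p0 - p0))) ?F"
      by (intro tendsto_intros filterlim_ident lim_p)
    then have small: "\<forall>\<^sub>F z in ?F. c * (norm (fst (fst z)) + norm ((snd z, snd (fst z)) - p0)) < \<delta>"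
      using \<delta>(1) by (intro order_tendstoD(2)) auto
    have eP: "\<forall>\<^sub>F z in ?F. P1 (fst z) \<and> P2 (snd z)"
      unfolding nhds_prod[of "(0, wb)"] using P(1,2) by (rule eventually_prodI)
    show ?thesis
      using eventually_compose_filterlim[OF necessary lim_p] eventually_compose_filterlim[OF c(2) lim_q]
        eventually_compose_filterlim[OF ev_\<Phi>_ball lim_p] small eP
    proof eventually_elim
      case (elim z)
      obtain v w x where z: "z = ((v, w), x)" by (metis prod.collapse)
      note nec = elim(1) and bd = elim(2) and ball = elim(3) and sm = elim(4) and PP = elim(5)
      show ?case
      proof (intro impI)
        assume dom: "\<Phi> (snd z, snd (fst z)) \<in> edom \<theta>"
          and lm: "\<forall>\<^sub>F x in nhds (snd z). \<Phi> (x, snd (fst z)) \<in> edom \<theta> \<longrightarrow>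
           \<psi> (snd (fst z)) (fst (fst z)) (snd z) \<le> \<psi> (snd (fst z)) (fst (fst z)) x"
        obtain l where l: "(x, l) \<in> KKT (v, w)"
          using nec dom lm by (auto simp: z)
        then have G: "v = G (x, w) l" and sub: "l \<in> subdifferential \<theta> (\<Phi> (x, w))" by (auto simp: KKT_def)
        have "l \<in> S" using sub_in_S[OF _ sub] ball by (simp add: z)
        then have "norm (l - lb) < \<delta>"
          using bd sm lb_S by (auto simp: z G_base G[symmetric])
        then have "(x, l) = s (v, w)" using P_uniq[OF _ _ \<delta>(2) l] PP by (simp add: z)
        then show "snd z = sol (fst z)" by (simp add: z sol_def) (metis fst_conv)
      qed
    qed
  qed
  obtain Q1 Q2 where Q: "eventually Q1 (nhds (0, wb))" "eventually Q2 (nhds xb)"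
    and Q_locmin: "\<And>u x. Q1 u \<Longrightarrow> Q2 x \<Longrightarrow> \<Phi> (x, snd u) \<in> edom \<theta> \<Longrightarrow>
      (\<forall>\<^sub>F y in nhds x. \<Phi> (y, snd u) \<in> edom \<theta> \<longrightarrow> \<psi> (snd u) (fst u) x \<le> \<psi> (snd u) (fst u) y) \<Longrightarrow> x = sol u"
    using locmin unfolding nhds_prod[of "(0, wb)"] eventually_prod_filter by auto
  obtain d where d: "d > 0" "\<And>x. dist x xb < d \<Longrightarrow> Q2 x"
    using Q(2) unfolding eventually_nhds_metric by blast
  \<comment> \<open>Boundary points of the smaller ball are interior to the ball of radius
    \<open>\<gamma>0\<close>, over which \<open>xb\<close> is minimal. A minimizer at the base
    parameter is therefore a free local minimizer and must be \<open>xb\<close>.\<close>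
  define \<gamma> where "\<gamma> = min (\<gamma>0 / 2) (d / 2)"
  have \<gamma>: "\<gamma> > 0" "\<gamma> < \<gamma>0" "\<And>x. x \<in> cball xb \<gamma> \<Longrightarrow> Q2 x"
    using \<gamma>0(1) d by (auto simp: \<gamma>_def dist_commute)
  have xb_min: "xb \<in> M_set \<phi> \<theta> \<Phi> xb \<gamma> wb 0"
    using \<gamma>0(2) \<gamma> by (auto simp: M_set_iff)
  have M_base: "x = xb" if x: "x \<in> M_set \<phi> \<theta> \<Phi> xb \<gamma> wb 0" for x
  proof -
    have "\<psi> wb 0 x \<le> \<psi> wb 0 xb" using x xb_min by (auto simp: M_set_iff)
    then have glob: "\<psi> wb 0 x \<le> \<psi> wb 0 y" if "y \<in> cball xb \<gamma>0" "\<Phi> (y, wb) \<in> edom \<theta>" for y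
      using \<gamma>0(2) that unfolding M_set_iff by force
    have "x \<in> ball xb \<gamma>0" using x \<gamma>(2) by (auto simp: M_set_iff)
    then have "\<forall>\<^sub>F y in nhds x. y \<in> ball xb \<gamma>0" by (intro eventually_nhds_in_open) auto
    then have "\<forall>\<^sub>F y in nhds x. \<Phi> (y, wb) \<in> edom \<theta> \<longrightarrow> \<psi> wb 0 x \<le> \<psi> wb 0 y"
      by eventually_elim (use glob in auto)
    then have "x = sol (0, wb)"
      using Q_locmin[of "(0, wb)" x] eventually_nhds_x_imp_x[OF Q(1)] \<gamma>(3)[of x] x
      by (simp add: M_set_iff)
    then show ?thesis by (simp add: sol_base)
  qed
  \<comment> \<open>At the base parameter \<open>xb\<close> beats every feasible point of the sphere
    strictly, and infeasible points stay infeasible since the domain is closed. Hence minimizers for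
    nearby parameters avoid the sphere and are free local minimizers.\<close>
  have sphere: "\<forall>\<^sub>F u in nhds (0, wb). \<forall>x\<in>sphere xb \<gamma>.
      \<Phi> (x, snd u) \<in> edom \<theta> \<longrightarrow> \<psi> (snd u) (fst u) (sol u) < \<psi> (snd u) (fst u) x"
  proof (rule eventually_ball_compact)
    fix x assume x: "x \<in> sphere xb \<gamma>"
    let ?F = "nhds ((0, wb), x) :: (('b \<times> 'c) \<times> 'b) filter"
    have lp: "lip_near (\<lambda>z::('b \<times> 'c) \<times> 'b. (snd z, snd (fst z))) ((0, wb), x)" by (intro lip_intros)
    have lim_\<Phi>: "filterlim (\<lambda>z. \<Phi> (snd z, snd (fst z))) (nhds (\<Phi> (x, wb))) ?F"
      using filterlim_compose[OF isCont_filterlim_nhds[OF isCont_\<Phi>] lip_near_filterlim[OF lp]] by simp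
    show "\<forall>\<^sub>F z in ?F. \<Phi> (snd z, snd (fst z)) \<in> edom \<theta> \<longrightarrow>
        \<psi> (snd (fst z)) (fst (fst z)) (sol (fst z)) < \<psi> (snd (fst z)) (fst (fst z)) (snd z)"
    proof (cases "\<Phi> (x, wb) \<in> edom \<theta>")
      case False
      then have "\<forall>\<^sub>F z in ?F. \<Phi> (snd z, snd (fst z)) \<in> - edom \<theta>"
        using dom_closed by (intro eventually_compose_filterlim[OF eventually_nhds_in_open lim_\<Phi>]) auto
      then show ?thesis by eventually_elim auto
    next
      case True
      have "x \<noteq> xb" using x \<gamma>(1) by auto
      then have "x \<notin> M_set \<phi> \<theta> \<Phi> xb \<gamma> wb 0" using M_base by blast
      then obtain y where "y \<in> cball xb \<gamma>" "\<Phi> (y, wb) \<in> edom \<theta>" "\<psi> wb 0 y < \<psi> wb 0 x"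
        using True x by (auto simp: M_set_iff not_le)
      then have lt: "\<psi> wb 0 xb < \<psi> wb 0 x" using xb_min unfolding M_set_iff by force
      have l1: "filterlim (\<lambda>z. ((snd (fst z), fst (fst z)), snd z)) (nhds ((wb, 0), x)) ?F"
      proof -
        have "lip_near (\<lambda>z::('b \<times> 'c) \<times> 'b. ((snd (fst z), fst (fst z)), snd z)) ((0, wb), x)"
          by (intro lip_intros)
        from lip_near_filterlim[OF this] show ?thesis by simp
      qed
      have l2: "filterlim (\<lambda>z. ((snd (fst z), fst (fst z)), sol (fst z))) (nhds ((wb, 0), xb)) ?F"
      proof -
        have "lip_near (\<lambda>z::('b \<times> 'c) \<times> 'b. sol (fst z)) ((0, wb), x)"
          by (rule lip_near_compose[of fst], intro lip_intros) (simp add: sol_lip)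
        then have "lip_near (\<lambda>z::('b \<times> 'c) \<times> 'b. ((snd (fst z), fst (fst z)), sol (fst z))) ((0, wb), x)"
          by (intro lip_intros)
        from lip_near_filterlim[OF this] show ?thesis by (simp add: sol_base)
      qed
      have "((\<lambda>z. \<psi> (snd (fst z)) (fst (fst z)) (snd z) - \<psi> (snd (fst z)) (fst (fst z)) (sol (fst z)))
          \<longlongrightarrow> \<psi> wb 0 x - \<psi> wb 0 xb) ?F"
        using filterlim_compose[OF isCont_filterlim_nhds[OF isCont_\<psi>] l1]
          filterlim_compose[OF isCont_filterlim_nhds[OF isCont_\<psi>] l2]
        by (intro tendsto_diff) simp_all
      then have "\<forall>\<^sub>F z in ?F. 0 < \<psi> (snd (fst z)) (fst (fst z)) (snd z) - \<psi> (snd (fst z)) (fst (fst z)) (sol (fst z))"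
        using lt by (intro order_tendstoD(1)) auto
      then show ?thesis by eventually_elim auto
    qed
  qed simp
  have sol_ball: "\<forall>\<^sub>F u in nhds (0, wb). sol u \<in> cball xb \<gamma>"
    using isCont_within_ball[OF lip_near_isCont[OF sol_lip] \<gamma>(1)]
    by eventually_elim (simp add: sol_base dist_commute)
  have argmin: "\<forall>\<^sub>F u in nhds (0, wb). M_set \<phi> \<theta> \<Phi> xb \<gamma> (snd u) (fst u) = {sol u}"
    using Q(1) sphere sol_ball sol_feas
  proof eventually_elim
    case (elim u)
    obtain v w where u: "u = (v, w)" by (metis prod.collapse)
    have sub: "x = sol u" if x: "x \<in> M_set \<phi> \<theta> \<Phi> xb \<gamma> w v" for x
    proof -
      have "\<psi> w v x \<le> \<psi> w v (sol u)" using x elim by (simp add: M_set_iff u)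
      then have "x \<notin> sphere xb \<gamma>" using elim(2) x by (auto simp: u M_set_iff)
      then have "x \<in> ball xb \<gamma>" using x by (auto simp: M_set_iff)
      then have "\<forall>\<^sub>F y in nhds x. y \<in> ball xb \<gamma>" by (intro eventually_nhds_in_open) auto
      then have "\<forall>\<^sub>F y in nhds x. \<Phi> (y, w) \<in> edom \<theta> \<longrightarrow> \<psi> w v x \<le> \<psi> w v y"
        by eventually_elim (use x in \<open>auto simp: M_set_iff\<close>)
      then show ?thesis
        using Q_locmin[OF elim(1) \<gamma>(3)] x by (auto simp: u M_set_iff)
    qed
    define K where "K = cball xb \<gamma> \<inter> (\<lambda>x. \<Phi> (x, w)) -` edom \<theta>"
    have 1: "isCont (\<lambda>x. \<Phi> (x, w)) x" for x
      by (rule isCont_o2[OF _ isCont_\<Phi>]) (intro continuous_intros)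
    have "closed ((\<lambda>x. \<Phi> (x, w)) -` edom \<theta>)"
      using 1 dom_closed by (intro continuous_closed_vimage) auto
    then have "compact K" unfolding K_def by (intro compact_Int_closed) auto
    moreover have "K \<noteq> {}" using elim by (auto simp: K_def u)
    moreover have "isCont (\<psi> w v) x" for x
    proof -
      have "isCont (\<lambda>x. ((w, v), x)) x" by (intro continuous_intros)
      from isCont_o2[OF this isCont_\<psi>] show ?thesis by simp
    qed
    then have "continuous_on K (\<psi> w v)" by (simp add: continuous_at_imp_continuous_on)
    ultimately obtain x where "x \<in> K" "\<forall>y\<in>K. \<psi> w v x \<le> \<psi> w v y"
      using continuous_attains_inf by blast
    then have "x \<in> M_set \<phi> \<theta> \<Phi> xb \<gamma> w v" by (auto simp: M_set_iff K_def)
    then show ?case using sub by (auto simp: u)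
  qed
  \<comment> \<open>Full stability orders the parameters as \<open>(w, v)\<close>, the KKT map as
    \<open>(v, w)\<close>.\<close>
  let ?sw = "\<lambda>z::'c \<times> 'b. (snd z, fst z)"
  define val where "val z = \<psi> (fst z) (snd z) (sol (?sw z))" for z
  have solsw: "lip_near (\<lambda>z. sol (?sw z)) (wb, 0)"
    by (rule lip_near_compose[of ?sw], intro lip_intros) (simp add: sol_lip)
  have "lip_near val (wb, 0)"
  proof -
    have x: "lip_near (\<lambda>z. (sol (?sw z), fst z)) (wb, 0)"
      by (intro lip_intros solsw)
    have \<phi>: "lip_near (\<lambda>z. \<phi> (sol (?sw z), fst z)) (wb, 0)"
    proof (rule lip_near_compose[OF x])
      have "continuous_on UNIV D\<phi>"
        using D2\<phi> by (intro has_derivative_continuous_on[where f'="\<lambda>p. blinfun_apply (D2\<phi> p)"])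
          (auto intro: has_derivative_at_withinI)
      from strict_deriv_lip_near[OF strict_deriv_C1[OF open_UNIV UNIV_I D\<phi> this]]
      show "lip_near \<phi> (sol (?sw (wb, 0)), fst (wb, 0))" .
    qed
    have "lip_near (\<lambda>z. \<Phi> (sol (?sw z), fst z)) (wb, 0)"
      by (rule lip_near_compose[OF x]) (simp add: sol_base lip_near_\<Phi>)
    then have \<tau>: "lip_near (\<lambda>z. \<tau> (\<Phi> (sol (?sw z), fst z))) (wb, 0)"
      by (rule lip_near_compose) (use \<tau>_lip in \<open>auto simp: lip_near_def\<close>)
    have inner: "lip_near (\<lambda>y::'b \<times> 'b. fst y \<bullet> snd y) q" for q
      by (rule strict_deriv_lip_near[OF strict_deriv_bilinear[OF bounded_bilinear_inner strict_deriv_linear[OF bounded_linear_fst]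
            strict_deriv_linear[OF bounded_linear_snd]]])
    have "lip_near (\<lambda>z. (snd z, sol (?sw z))) (wb, 0)" by (intro lip_intros solsw)
    from lip_near_compose[OF this inner] have "lip_near (\<lambda>z. snd z \<bullet> sol (?sw z)) (wb, 0)"
      by simp
    then show ?thesis unfolding val_def \<psi>_def by (intro lip_near_diff lip_near_add \<phi> \<tau>)
  qed
  with solsw have both: "lip_near (\<lambda>z. (sol (?sw z), val z)) (wb, 0)" by (rule lip_near_Pair)
  have "filterlim ?sw (nhds (0, wb)) (nhds (wb, 0))"
  proof -
    have "lip_near ?sw (wb, 0)" by (intro lip_intros)
    from lip_near_filterlim[OF this] show ?thesis by simp
  qed
  from eventually_compose_filterlim[OF argmin this]
  have "\<forall>\<^sub>F z in nhds (wb, 0). M_set \<phi> \<theta> \<Phi> xb \<gamma> (fst z) (snd z) = {sol (?sw z)}" by simp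
  then obtain U K where U: "open U" "(wb, 0) \<in> U" "K > 0" "K-lipschitz_on U (\<lambda>z. (sol (?sw z), val z))"
    "\<And>z. z \<in> U \<Longrightarrow> M_set \<phi> \<theta> \<Phi> xb \<gamma> (fst z) (snd z) = {sol (?sw z)}"
    by (rule lip_near_eventually[OF both]) (rule that)
  obtain W Vv where WV: "open W" "open Vv" "(wb, 0) \<in> W \<times> Vv" "W \<times> Vv \<subseteq> U"
    by (rule open_prod_elim[OF U(1,2)])
  have M: "M_set \<phi> \<theta> \<Phi> xb \<gamma> w v = {sol (v, w)}" if "w \<in> W" "v \<in> Vv" for w v
    using U(5)[of "(w, v)"] WV(4) that by auto
  have m: "m_val \<phi> \<theta> \<Phi> xb \<gamma> w v = ereal (val (w, v))" if "w \<in> W" "v \<in> Vv" for w v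
    using m_val_eq[of "sol (v, w)" \<gamma> w v] M[OF that] by (simp add: val_def)
  have lipU: "K-lipschitz_on (W \<times> Vv) (\<lambda>z. (sol (?sw z), val z))"
    using lipschitz_on_subset[OF U(4) WV(4)] .
  have lipsol: "K-lipschitz_on (W \<times> Vv) (\<lambda>z. sol (?sw z))"
  proof (rule lipschitz_onI)
    fix y z assume "y \<in> W \<times> Vv" "z \<in> W \<times> Vv"
    from lipschitz_onD[OF lipU this]
    show "dist (sol (?sw y)) (sol (?sw z)) \<le> K * dist y z"
      using dist_fst_le[of "(sol (?sw y), val y)" "(sol (?sw z), val z)"] by simp
  qed (use U(3) in simp)
  have lipval: "K-lipschitz_on (W \<times> Vv) val"
  proof (rule lipschitz_onI)
    fix y z assume "y \<in> W \<times> Vv" "z \<in> W \<times> Vv"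
    from lipschitz_onD[OF lipU this]
    show "dist (val y) (val z) \<le> K * dist y z"
      using dist_snd_le[of "(sol (?sw y), val y)" "(sol (?sw z), val z)"] by simp
  qed (use U(3) in simp)
  have lipm: "K-lipschitz_on (W \<times> Vv) (\<lambda>(w, v). real_of_ereal (m_val \<phi> \<theta> \<Phi> xb \<gamma> w v))"
    by (rule lipschitz_on_transform[OF lipval]) (auto simp: m)
  show ?thesis
    unfolding fully_stable_def
  proof (rule exI[of _ \<gamma>], rule conjI[OF \<gamma>(1)], rule exI[of _ W], rule exI[of _ Vv], intro conjI WV(1,2))
    show "\<exists>s. (\<forall>w\<in>W. \<forall>v\<in>Vv. M_set \<phi> \<theta> \<Phi> xb \<gamma> w v = {s (w, v)}) \<and> (\<exists>K. K-lipschitz_on (W \<times> Vv) s)"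
      using lipsol M by (intro exI[of _ "\<lambda>z. sol (?sw z)"]) auto
    show "M_set \<phi> \<theta> \<Phi> xb \<gamma> wb 0 = {xb}" using xb_min M_base by blast
    show "\<forall>w\<in>W. \<forall>v\<in>Vv. \<bar>m_val \<phi> \<theta> \<Phi> xb \<gamma> w v\<bar> \<noteq> \<infinity>" by (simp add: m)
    show "\<exists>K. K-lipschitz_on (W \<times> Vv) (\<lambda>(w, v). real_of_ereal (m_val \<phi> \<theta> \<Phi> xb \<gamma> w v))"
      using lipm by blast
  qed (use WV in auto)
qed

section \<open>From full stability to a localization of the KKT system\<close>

text \<open>Uniqueness of a KKT pair is split in two: the point is identified with the minimizer by
  the tilt comparison, and for a given point the multiplier is unique because
  \<open>multiplier_bound\<close> has right-hand side zero.\<close>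

theorem fully_stable_imp_localization:
  assumes "fully_stable \<phi> \<theta> \<Phi> xb wb 0"
  shows "lipschitz_localization KKT (0, wb) (xb, lb)"
proof -
  obtain \<gamma> W Vv s K K' where \<gamma>: "\<gamma> > 0" and W: "open W" "wb \<in> W" and Vv: "open Vv" "0 \<in> Vv"
    and M: "\<And>w v. w \<in> W \<Longrightarrow> v \<in> Vv \<Longrightarrow> M_set \<phi> \<theta> \<Phi> xb \<gamma> w v = {s (w, v)}"
    and lip_s: "K-lipschitz_on (W \<times> Vv) s" and M0: "M_set \<phi> \<theta> \<Phi> xb \<gamma> wb 0 = {xb}"
    and lip_m: "K'-lipschitz_on (W \<times> Vv) (\<lambda>(w, v). real_of_ereal (m_val \<phi> \<theta> \<Phi> xb \<gamma> w v))"
    using assms unfolding fully_stable_def by metis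
  define \<sigma> where "\<sigma> u = s (snd u, fst u)" for u
  have \<sigma>M: "\<sigma> (v, w) \<in> M_set \<phi> \<theta> \<Phi> xb \<gamma> w v" if "w \<in> W" "v \<in> Vv" for w v
    using M[OF that] by (simp add: \<sigma>_def)
  have \<sigma>_base: "\<sigma> (0, wb) = xb"
    using \<sigma>M[OF W(2) Vv(2)] M0 by simp
  have sw: "lip_near (\<lambda>u::'b \<times> 'c. (snd u, fst u)) (0, wb)" by (intro lip_intros)
  have \<sigma>_lip: "lip_near \<sigma> (0, wb)"
    unfolding \<sigma>_def
  proof (rule lip_near_compose[OF sw])
    show "lip_near s (snd (0, wb), fst (0, wb))"
      unfolding lip_near_def using lip_s W Vv by (intro exI[of _ K] exI[of _ "W \<times> Vv"]) (auto intro: open_Times)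
  qed
  have evVW: "\<forall>\<^sub>F u in nhds (0, wb). fst u \<in> Vv \<and> snd u \<in> W"
    unfolding nhds_prod by (intro eventually_prodI eventually_nhds_in_open W Vv)
  define pt where "pt u = (\<sigma> u, snd u)" for u
  have pt_lip: "lip_near pt (0, wb)" unfolding pt_def by (intro lip_intros \<sigma>_lip)
  have pt_lim: "filterlim pt (nhds p0) (nhds (0, wb))"
    using lip_near_filterlim[OF pt_lip] by (simp add: pt_def \<sigma>_base)
  \<comment> \<open>An arbitrary choice of multiplier; the multiplier estimate shows afterwards that
    it is Lipschitz near the base parameter.\<close>
  define \<Lambda> where "\<Lambda> u = (SOME l. (\<sigma> u, l) \<in> KKT u)" for u
  have \<sigma>_ball: "\<forall>\<^sub>F u in nhds (0, wb). \<sigma> u \<in> ball xb \<gamma>"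
    using isCont_within_ball[OF lip_near_isCont[OF \<sigma>_lip] \<gamma>]
    by eventually_elim (simp add: \<sigma>_base dist_commute)
  have \<Lambda>_KKT: "\<forall>\<^sub>F u in nhds (0, wb). (\<sigma> u, \<Lambda> u) \<in> KKT u"
    using eventually_compose_filterlim[OF necessary pt_lim] evVW \<sigma>_ball
  proof eventually_elim
    case (elim u)
    obtain v w where u: "u = (v, w)" by (metis prod.collapse)
    have x: "\<sigma> u \<in> M_set \<phi> \<theta> \<Phi> xb \<gamma> w v" using \<sigma>M elim by (simp add: u)
    have "\<forall>\<^sub>F y in nhds (\<sigma> u). y \<in> ball xb \<gamma>" using elim by (intro eventually_nhds_in_open) auto
    then have "\<forall>\<^sub>F y in nhds (\<sigma> u). \<Phi> (y, w) \<in> edom \<theta> \<longrightarrow> \<psi> w v (\<sigma> u) \<le> \<psi> w v y"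
      by eventually_elim (use x in \<open>auto simp: M_set_iff\<close>)
    then have "\<exists>l. (\<sigma> u, l) \<in> KKT u"
      using elim(1) x by (auto simp: pt_def u M_set_iff)
    then show ?case unfolding \<Lambda>_def by (rule someI_ex)
  qed
  have \<Lambda>_S: "\<forall>\<^sub>F u in nhds (0, wb). \<Lambda> u \<in> S"
    using \<Lambda>_KKT eventually_compose_filterlim[OF ev_\<Phi>_ball pt_lim]
    by eventually_elim (auto simp: KKT_def pt_def intro: sub_in_S)
  have \<Lambda>_G: "\<forall>\<^sub>F u in nhds (0, wb). G (pt u) (\<Lambda> u) = fst u"
    using \<Lambda>_KKT by eventually_elim (auto simp: KKT_def pt_def)
  obtain c where c: "c > 0" "\<forall>\<^sub>F z in nhds (p0, p0, lb). \<forall>l\<in>S. snd (snd z) \<in> S \<longrightarrow>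
    norm (l - snd (snd z)) \<le> c * (norm (G (fst z) l - G (fst (snd z)) (snd (snd z))) + norm (fst z - fst (snd z)))"
    using multiplier_bound by blast
  \<comment> \<open>The comparison with \<open>lb\<close> comes before the Lipschitz estimate: it
    gives convergence of \<Lambda> to \<open>lb\<close>, which is needed to use two values of
    \<Lambda> in \<open>multiplier_bound\<close>.\<close>
  have \<Lambda>_bound0: "\<forall>\<^sub>F u in nhds (0, wb). norm (\<Lambda> u - lb) \<le> c * (norm (fst u) + norm (pt u - p0))"
  proof -
    have "filterlim (\<lambda>u. (pt u, p0, lb)) (nhds (p0, p0, lb)) (nhds (0, wb))"
      unfolding nhds_prod[of p0] by (intro filterlim_Pair pt_lim tendsto_const)
    from eventually_compose_filterlim[OF c(2) this] \<Lambda>_S \<Lambda>_G show ?thesis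
      by eventually_elim (use lb_S G_base in auto)
  qed
  have "((\<lambda>u. c * (norm (fst u) + norm (pt u - p0))) \<longlongrightarrow> c * (norm (fst (0::'b, wb)) + norm (p0 - p0))) (nhds (0, wb))"
    by (intro tendsto_intros pt_lim filterlim_ident)
  then have "((\<lambda>u. c * (norm (fst u) + norm (pt u - p0))) \<longlongrightarrow> 0) (nhds (0, wb))"
    by simp
  from Lim_null_comparison[OF \<Lambda>_bound0 this] have \<Lambda>_lim: "(\<Lambda> \<longlongrightarrow> lb) (nhds (0, wb))"
    by (rule LIM_zero_cancel)
  have \<Lambda>_base: "\<Lambda> (0, wb) = lb"
    using eventually_nhds_x_imp_x[OF \<Lambda>_bound0] by (simp add: pt_def \<sigma>_base)
  obtain Kp Up where Up: "open Up" "(0, wb) \<in> Up" "Kp > 0" "Kp-lipschitz_on Up pt"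
    "\<And>u. u \<in> Up \<Longrightarrow> \<Lambda> u \<in> S \<and> G (pt u) (\<Lambda> u) = fst u"
    by (rule lip_near_eventually[OF pt_lip eventually_conj[OF \<Lambda>_S \<Lambda>_G]]) (rule that)
  have \<Lambda>_lip: "lip_near \<Lambda> (0, wb)"
  proof (rule lip_nearI[where K = "c * (1 + Kp)"])
    have lim: "filterlim (\<lambda>z. (pt (fst z), pt (snd z), \<Lambda> (snd z))) (nhds (p0, p0, lb)) (nhds ((0, wb), (0, wb)))"
      unfolding nhds_prod[of p0] nhds_prod[of "(0, wb)"]
      by (intro filterlim_Pair filterlim_compose[OF pt_lim filterlim_fst] filterlim_compose[OF pt_lim filterlim_snd]
          filterlim_compose[OF \<Lambda>_lim filterlim_snd])
    have ev: "\<forall>\<^sub>F z in nhds ((0, wb), (0, wb)). fst z \<in> Up \<and> snd z \<in> Up"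
      unfolding nhds_prod[of "(0, wb)"] by (intro eventually_prodI eventually_nhds_in_open Up)
    show "\<forall>\<^sub>F z in nhds ((0, wb), (0, wb)). dist (\<Lambda> (fst z)) (\<Lambda> (snd z)) \<le> c * (1 + Kp) * dist (fst z) (snd z)"
      using eventually_compose_filterlim[OF c(2) lim] ev
    proof eventually_elim
      case (elim z)
      obtain u u' where z: "z = (u, u')" by (metis prod.collapse)
      have "norm (\<Lambda> u - \<Lambda> u') \<le> c * (norm (fst u - fst u') + norm (pt u - pt u'))"
      proof -
        have "\<Lambda> u \<in> S" "G (pt u) (\<Lambda> u) = fst u" "\<Lambda> u' \<in> S" "G (pt u') (\<Lambda> u') = fst u'"
          using Up(5) elim(2) by (auto simp: z)
        then show ?thesis using bspec[OF elim(1), of "\<Lambda> u"] by (simp add: z)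
      qed
      also have "\<dots> \<le> c * (dist u u' + Kp * dist u u')"
        using c(1) lipschitz_onD[OF Up(4), of u u'] elim(2) dist_fst_le[of u u']
        by (intro mult_left_mono add_mono) (auto simp: z dist_norm[symmetric])
      finally show ?case by (simp add: z dist_norm[symmetric] algebra_simps)
    qed
  qed
  have uniq_l: "\<forall>\<^sub>F z in nhds ((0, wb), (xb, lb)). snd z \<in> KKT (fst z) \<longrightarrow> fst (snd z) = \<sigma> (fst z) \<longrightarrow>
      snd (snd z) = \<Lambda> (fst z)"
  proof -
    have lim: "filterlim (\<lambda>z. (pt (fst z), pt (fst z), snd (snd z))) (nhds (p0, p0, lb)) (nhds ((0, wb), (xb, lb)))"
      unfolding nhds_prod[of p0] nhds_prod[of "(0, wb)"]
      by (intro filterlim_Pair filterlim_compose[OF pt_lim filterlim_fst])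
        (unfold nhds_prod, intro filterlim_compose[OF filterlim_snd filterlim_snd])
    have ev: "\<forall>\<^sub>F z in nhds ((0, wb), (xb, lb)). fst z \<in> Up"
      unfolding nhds_prod[of "(0, wb)"]
      by (intro eventually_compose_filterlim[OF eventually_nhds_in_open[OF Up(1,2)] filterlim_fst])
    have ball: "\<forall>\<^sub>F z in nhds ((0, wb), (xb, lb)). \<Phi> (pt (fst z)) \<in> ball zb \<epsilon>"
      unfolding nhds_prod[of "(0, wb)"]
      by (intro eventually_compose_filterlim[OF eventually_compose_filterlim[OF ev_\<Phi>_ball pt_lim] filterlim_fst])
    show ?thesis
      using eventually_compose_filterlim[OF c(2) lim] ev ball
    proof eventually_elim
      case (elim z)
      note bd = elim(1) and up = elim(2) and b = elim(3)
      show ?case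
      proof (intro impI)
        assume k: "snd z \<in> KKT (fst z)" and x: "fst (snd z) = \<sigma> (fst z)"
        have kk: "G (pt (fst z)) (snd (snd z)) = fst (fst z)" "snd (snd z) \<in> subdifferential \<theta> (\<Phi> (pt (fst z)))"
          using k x by (auto simp: KKT_def pt_def split: prod.splits)
        have "norm (\<Lambda> (fst z) - snd (snd z)) \<le> 0"
          using bd Up(5)[OF up] sub_in_S[OF b kk(2)] kk(1) by auto
        then show "snd (snd z) = \<Lambda> (fst z)" by simp
      qed
    qed
  qed
  obtain r where r: "r > 0" "\<forall>\<^sub>F z in nhds (p0, lb, xb).
    fst (snd z) \<in> subdifferential \<theta> (\<Phi> (fst z)) \<longrightarrow> \<Phi> (snd (snd z), snd (fst z)) \<in> edom \<theta> \<longrightarrow>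
    \<psi> (snd (fst z)) (G (fst z) (fst (snd z))) (fst (fst z)) - r * (norm (snd (snd z) - fst (fst z)))\<^sup>2
      \<le> \<psi> (snd (fst z)) (G (fst z) (fst (snd z))) (snd (snd z))"
    using prox_regular by blast
  obtain P1 P2 where P: "eventually P1 (nhds (p0, lb))" "eventually P2 (nhds xb)"
    and prox: "\<And>x w l x'. P1 ((x, w), l) \<Longrightarrow> P2 x' \<Longrightarrow> (x, l) \<in> KKT (G (x, w) l, w) \<Longrightarrow> \<Phi> (x', w) \<in> edom \<theta> \<Longrightarrow>
      \<psi> w (G (x, w) l) x - r * (norm (x' - x))\<^sup>2 \<le> \<psi> w (G (x, w) l) x'"
  proof -
    have "filterlim (\<lambda>z. (fst (fst z), snd (fst z), snd z)) (nhds (p0, lb, xb)) (nhds ((p0, lb), xb))"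
    proof -
      have "lip_near (\<lambda>z::(('b \<times> 'c) \<times> 'a) \<times> 'b. (fst (fst z), snd (fst z), snd z)) ((p0, lb), xb)"
        by (intro lip_intros)
      from lip_near_filterlim[OF this] show ?thesis by simp
    qed
    from eventually_compose_filterlim[OF r(2) this]
    obtain P1 P2 where "eventually P1 (nhds (p0, lb))" "eventually P2 (nhds xb)"
      "\<And>q x'. P1 q \<Longrightarrow> P2 x' \<Longrightarrow> snd q \<in> subdifferential \<theta> (\<Phi> (fst q)) \<Longrightarrow> \<Phi> (x', snd (fst q)) \<in> edom \<theta> \<Longrightarrow>
        \<psi> (snd (fst q)) (G (fst q) (snd q)) (fst (fst q)) - r * (norm (x' - fst (fst q)))\<^sup>2
        \<le> \<psi> (snd (fst q)) (G (fst q) (snd q)) x'"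
      unfolding nhds_prod[of "(p0, lb)"] eventually_prod_filter by auto
    then show thesis using that[of P1 P2] by (auto simp: KKT_def)
  qed
  \<comment> \<open>Strictly larger than the prox-regularity constant, which makes the final
    comparison decisive.\<close>
  define r' where "r' = r + 1"
  have r': "r' > 0" "r' > r" using r(1) by (simp_all add: r'_def)
  have "\<forall>\<^sub>F u in nhds (0, wb). P2 (\<sigma> u) \<and> fst u \<in> Vv \<and> snd u \<in> W"
    using eventually_compose_filterlim[OF P(2) lip_near_filterlim[OF \<sigma>_lip, unfolded \<sigma>_base]] evVW
    by (rule eventually_conj)
  then obtain P3 P4 where P34: "eventually P3 (nhds 0)" "eventually P4 (nhds wb)"
    "\<And>v w. P3 v \<Longrightarrow> P4 w \<Longrightarrow> P2 (\<sigma> (v, w)) \<and> v \<in> Vv \<and> w \<in> W"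
    unfolding nhds_prod eventually_prod_filter by auto
  obtain \<rho>' where \<rho>': "\<rho>' > 0" "\<And>v. norm v < \<rho>' \<Longrightarrow> P3 v"
    using P34(1) unfolding eventually_nhds_metric by auto
  \<comment> \<open>Halved so that the closed ball of radius \<rho> stays inside the open ball of
    admissible tilts.\<close>
  define \<rho> where "\<rho> = \<rho>' / 2"
  have \<rho>: "\<rho> > 0" "\<And>v. v \<in> cball 0 \<rho> \<Longrightarrow> P3 v" using \<rho>' by (auto simp: \<rho>_def)
  have uniq_x: "\<forall>\<^sub>F z in nhds ((0, wb), (xb, lb)). snd z \<in> KKT (fst z) \<longrightarrow> fst (snd z) = \<sigma> (fst z)"
  proof -
    let ?F = "nhds ((0, wb), (xb, lb)) :: (('b \<times> 'c) \<times> 'b \<times> 'a) filter"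
    have lim1: "filterlim (\<lambda>z. ((fst (snd z), snd (fst z)), snd (snd z))) (nhds (p0, lb)) ?F"
    proof -
      have "lip_near (\<lambda>z::('b \<times> 'c) \<times> 'b \<times> 'a. ((fst (snd z), snd (fst z)), snd (snd z))) ((0, wb), (xb, lb))"
        by (intro lip_intros)
      from lip_near_filterlim[OF this] show ?thesis by simp
    qed
    have lim2: "filterlim (\<lambda>z. snd (fst z)) (nhds wb) ?F"
      using tendsto_snd[OF tendsto_fst[OF filterlim_ident[of "nhds ((0::'b, wb), (xb, lb))"]]] by simp
    have "filterlim (\<lambda>z. \<sigma> (0, snd (fst z))) (nhds (\<sigma> (0, wb))) ?F"
      by (intro filterlim_compose[OF lip_near_filterlim[OF \<sigma>_lip]] tendsto_Pair tendsto_const lim2)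
    \<comment> \<open>The limit is zero, since the minimizer at tilt 0 tends to \<open>xb\<close>;
      this supplies the bound \<rho>/2 under which the tilt equation is solvable.\<close>
    then have lim3: "((\<lambda>z. norm (fst (fst z) + r' *\<^sub>R fst (snd z) - r' *\<^sub>R \<sigma> (0, snd (fst z))))
        \<longlongrightarrow> norm (fst (fst ((0::'b, wb), (xb, lb))) + r' *\<^sub>R fst (snd ((0::'b, wb), (xb, lb))) - r' *\<^sub>R \<sigma> (0, wb))) ?F"
      by (intro tendsto_intros filterlim_ident)
    then have e3: "\<forall>\<^sub>F z in ?F. norm (fst (fst z) + r' *\<^sub>R fst (snd z) - r' *\<^sub>R \<sigma> (0, snd (fst z))) < \<rho> / 2"
      using \<rho>(1) by (intro order_tendstoD(2)) (auto simp: \<sigma>_base)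
    have e4: "\<forall>\<^sub>F z in ?F. fst (snd z) \<in> ball xb \<gamma>"
      using \<gamma> tendsto_fst[OF tendsto_snd[OF filterlim_ident[of ?F]]]
      by (intro topological_tendstoD[of _ xb]) auto
    show ?thesis
      using eventually_compose_filterlim[OF P(1) lim1] eventually_compose_filterlim[OF P34(2) lim2] e3 e4
    proof (eventually_elim, intro impI)
      fix z :: "('b \<times> 'c) \<times> 'b \<times> 'a"
      assume p1: "P1 ((fst (snd z), snd (fst z)), snd (snd z))" and p4: "P4 (snd (fst z))"
        and n: "norm (fst (fst z) + r' *\<^sub>R fst (snd z) - r' *\<^sub>R \<sigma> (0, snd (fst z))) < \<rho> / 2"
        and xg: "fst (snd z) \<in> ball xb \<gamma>" and k: "snd z \<in> KKT (fst z)"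
      obtain v w x l where z: "z = ((v, w), (x, l))" by (metis prod.collapse)
      have wW: "w \<in> W" using P34(3)[OF \<rho>(2)[of 0]] p4 \<rho>(1) by (auto simp: z)
      have vV: "v' \<in> Vv" "P2 (\<sigma> (v', w))" if "v' \<in> cball 0 \<rho>" for v'
        using P34(3)[OF \<rho>(2)[OF that]] p4 by (auto simp: z)
      have vx: "v = G (x, w) l" and xd: "\<Phi> (x, w) \<in> edom \<theta>" using k by (auto simp: z KKT_def sub_iff)
      define m where "m v' = \<psi> w v' (\<sigma> (v', w))" for v'
      have cont_pair: "continuous_on (cball 0 \<rho>) (\<lambda>v'. (w, v'))" by (intro continuous_intros)
      have sub: "(\<lambda>v'. (w, v')) ` cball 0 \<rho> \<subseteq> W \<times> Vv" using wW vV by auto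
      have "continuous_on (cball 0 \<rho>) (\<lambda>v'. real_of_ereal (m_val \<phi> \<theta> \<Phi> xb \<gamma> w v'))"
        using continuous_on_compose2[OF lipschitz_on_continuous_on[OF lip_m] cont_pair sub] by simp
      moreover have "m v' = real_of_ereal (m_val \<phi> \<theta> \<Phi> xb \<gamma> w v')" if "v' \<in> cball 0 \<rho>" for v'
        using m_val_eq[OF \<sigma>M[OF wW vV(1)[OF that]]] by (simp add: m_def)
      ultimately have cm: "continuous_on (cball 0 \<rho>) m"
        by (metis (no_types, lifting) continuous_on_cong)
      have cs: "continuous_on (cball 0 \<rho>) (\<lambda>v'. \<sigma> (v', w))"
        using continuous_on_compose2[OF lipschitz_on_continuous_on[OF lip_s] cont_pair sub] by (simp add: \<sigma>_def)
      have super: "m v2 \<le> m v1 - (v2 - v1) \<bullet> \<sigma> (v1, w)" if "v1 \<in> cball 0 \<rho>" "v2 \<in> cball 0 \<rho>" for v1 v2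
      proof -
        have "m v2 \<le> \<psi> w v2 (\<sigma> (v1, w))"
          using \<sigma>M[OF wW vV(1)[OF that(1)]] \<sigma>M[OF wW vV(1)[OF that(2)]] by (auto simp: m_def M_set_iff)
        then show ?thesis by (simp add: m_def \<psi>_tilt[of w v2 _ v1])
      qed
      obtain v' where v': "v' \<in> ball 0 \<rho>" "v' + r' *\<^sub>R \<sigma> (v', w) = v + r' *\<^sub>R x"
        using minty_surjective[OF \<rho>(1) r'(1) cm cs super, of "v + r' *\<^sub>R x"] n by (auto simp: z)
      define x' where "x' = \<sigma> (v', w)"
      have v'c: "v' \<in> cball 0 \<rho>" using v'(1) by simp
      have x'M: "x' \<in> M_set \<phi> \<theta> \<Phi> xb \<gamma> w v'" using \<sigma>M[OF wW vV(1)[OF v'c]] by (simp add: x'_def)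
      have dv: "v - v' = r' *\<^sub>R (x' - x)" using v'(2) by (simp add: x'_def algebra_simps)
      have "\<psi> w v x - r * (norm (x' - x))\<^sup>2 \<le> \<psi> w v x'"
        using prox[of x w l x'] p1 vV(2)[OF v'c] k x'M unfolding vx[symmetric] by (simp add: z x'_def M_set_iff)
      moreover have "\<psi> w v' x' \<le> \<psi> w v' x" using x'M xg xd by (auto simp: M_set_iff z)
      \<comment> \<open>Adding prox-regularity at the KKT point \<open>x\<close> with tilt
        \<open>v\<close> to minimality of \<open>x'\<close> for the tilt \<open>v'\<close> leaves
        only the tilt difference, which the choice of \<open>v'\<close> makes equal to
        \<open>r' *\<^sub>R (x' - x)\<close>.\<close>
      ultimately have "(v - v') \<bullet> (x' - x) \<le> r * (norm (x' - x))\<^sup>2"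
        using \<psi>_tilt[of w v x v'] \<psi>_tilt[of w v x' v'] by (simp add: inner_diff_right)
      then have "r' * (norm (x' - x))\<^sup>2 \<le> r * (norm (x' - x))\<^sup>2"
        unfolding dv by (simp add: power2_norm_eq_inner)
      then have "(norm (x' - x))\<^sup>2 \<le> 0" by (simp add: r'_def algebra_simps)
      then have "x' = x" by simp
      moreover from this have "v = v'" using dv by simp
      ultimately show "fst (snd z) = \<sigma> (fst z)" by (simp add: z x'_def)
    qed
  qed
  show ?thesis
  proof (rule lipschitz_localizationI)
    show "lip_near (\<lambda>u. (\<sigma> u, \<Lambda> u)) (0, wb)" by (rule lip_near_Pair[OF \<sigma>_lip \<Lambda>_lip])
    show "(\<sigma> (0, wb), \<Lambda> (0, wb)) = (xb, lb)" by (simp add: \<sigma>_base \<Lambda>_base)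
    show "\<forall>\<^sub>F u in nhds (0, wb). (\<sigma> u, \<Lambda> u) \<in> KKT u" by (rule \<Lambda>_KKT)
    show "\<forall>\<^sub>F z in nhds ((0, wb), (xb, lb)). snd z \<in> KKT (fst z) \<longrightarrow> snd z = (\<sigma> (fst z), \<Lambda> (fst z))"
      using uniq_x uniq_l by eventually_elim (auto simp: prod_eq_iff)
  qed
qed

end

text \<open>An affine set through the origin is a subspace and parallel to itself; this is how the
  standing assumption is used.\<close>

lemma S_space_eq_hull:
  assumes "0 \<in> affine hull (subdifferential \<theta> z)"
  shows "subspace (affine hull (subdifferential \<theta> z))"
    "S_space \<theta> z = affine hull (subdifferential \<theta> z)"
proof -
  let ?S = "affine hull (subdifferential \<theta> z)"
  show S: "subspace ?S" using affine_hull_span_0[OF assms] by simp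
  have par: "affine_parallel ?S ?S"
    unfolding affine_parallel_def by (intro exI[of _ 0]) simp
  show "S_space \<theta> z = ?S"
    unfolding S_space_def parallel_space_def
  proof (rule the1_equality)
    have "?S \<noteq> {}" using assms by blast
    then show "\<exists>!L. subspace L \<and> affine_parallel ?S L"
      by (rule affine_parallel_subspace[OF affine_affine_hull])
  qed (use S par in simp)
qed

theorem theorem3p3:
  fixes \<theta> :: "real ^ 'm \<Rightarrow> ereal"
    and \<phi>\<^sub>0 :: "(real ^ 'n) \<times> (real ^ 'd) \<Rightarrow> real"
    and \<Phi> :: "(real ^ 'n) \<times> (real ^ 'd) \<Rightarrow> real ^ 'm"
    and wb :: "real ^ 'd" and xb :: "real ^ 'n" and zb lb :: "real ^ 'm"
  assumes "CPWL \<theta>"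
    and "C2_smooth \<phi>\<^sub>0" and "C2_smooth \<Phi>"
    and "zb = \<Phi> (xb, wb)" and "zb \<in> edom \<theta>"
    and "0 \<in> (\<lambda>l. gradient (\<lambda>x. \<phi>\<^sub>0 (x, wb)) xb + adjoint (partial_x \<Phi> xb wb) l)
               ` subdifferential \<theta> zb"
    and "lb \<in> subdifferential \<theta> zb"
    and "gradient (\<lambda>x. \<phi>\<^sub>0 (x, wb)) xb + adjoint (partial_x \<Phi> xb wb) lb = 0"
    and "0 \<in> affine hull (subdifferential \<theta> zb)"
    and "singular_subdifferential \<theta> zb \<inter> ker_partial_x_adj \<Phi> xb wb = {0}"
  shows "(fully_stable \<phi>\<^sub>0 \<theta> \<Phi> xb wb 0 \<and> nondegenerate \<theta> \<Phi> xb wb) \<longleftrightarrow>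
         ((\<exists>\<gamma> > 0. xb \<in> M_set \<phi>\<^sub>0 \<theta> \<Phi> xb \<gamma> wb 0) \<and> strongly_regular \<phi>\<^sub>0 \<theta> \<Phi> xb wb lb)"
proof -
  define S where "S = affine hull (subdifferential \<theta> zb)"
  have Sp: "subspace S" "S_space \<theta> zb = S"
    using S_space_eq_hull[OF assms(9)] by (simp_all add: S_def)
  obtain \<tau> L where \<tau>: "convex_on UNIV \<tau>" "L-lipschitz_on UNIV \<tau>" "closed (edom \<theta>)" "convex (edom \<theta>)"
    "\<And>z. \<theta> z = (if z \<in> edom \<theta> then ereal (\<tau> z) else \<infinity>)"
    using CPWL_rep[OF assms(1)] by metis
  obtain \<epsilon> where \<epsilon>: "\<epsilon> > 0" "\<And>z z'. z \<in> ball zb \<epsilon> \<Longrightarrow> z' \<in> ball zb \<epsilon> \<Longrightarrow>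
      (\<And>c. c \<in> subdifferential \<theta> zb \<Longrightarrow> c \<bullet> (z - z') = 0) \<Longrightarrow> \<theta> z = \<theta> z'"
    using CPWL_locally_constant_orthogonal[OF assms(1,5)] by metis
  obtain D\<phi> D2\<phi> where D\<phi>: "\<And>p. (\<phi>\<^sub>0 has_derivative blinfun_apply (D\<phi> p)) (at p)"
    "\<And>p. (D\<phi> has_derivative blinfun_apply (D2\<phi> p)) (at p)" "continuous_on UNIV D2\<phi>"
    using assms(2) unfolding C2_smooth_def by blast
  obtain D\<Phi> D2\<Phi> where D\<Phi>: "\<And>p. (\<Phi> has_derivative blinfun_apply (D\<Phi> p)) (at p)"
    "\<And>p. (D\<Phi> has_derivative blinfun_apply (D2\<Phi> p)) (at p)" "continuous_on UNIV D2\<Phi>"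
    using assms(3) unfolding C2_smooth_def by blast
  have slice: "((\<lambda>x. (x, wb)) has_derivative (\<lambda>a. (a, 0))) (at xb)"
    by (auto intro!: derivative_eq_intros)
  have px: "partial_x \<Phi> xb wb = (\<lambda>a. D\<Phi> (xb, wb) (a, 0))"
    unfolding partial_x_def using frechet_derivative_at[OF has_derivative_compose[OF slice D\<Phi>(1)]] by simp
  have lin_px: "linear (partial_x \<Phi> xb wb)"
    unfolding px using has_derivative_linear[OF has_derivative_compose[OF slice D\<Phi>(1)]] .
  have stationary: "D\<phi> (xb, wb) (a, 0) + lb \<bullet> D\<Phi> (xb, wb) (a, 0) = 0" for a
  proof -
    have "0 = (gradient (\<lambda>x. \<phi>\<^sub>0 (x, wb)) xb + adjoint (partial_x \<Phi> xb wb) lb) \<bullet> a"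
      unfolding assms(8) by simp
    also have "\<dots> = D\<phi> (xb, wb) (a, 0) + lb \<bullet> partial_x \<Phi> xb wb a"
      using gradient_inner[OF has_derivative_compose[OF slice D\<phi>(1)], of a]
      by (simp add: inner_add_left adjoint_clauses(2)[OF lin_px])
    finally show ?thesis by (simp add: px)
  qed
  interpret problem_data \<theta> \<tau> L \<phi>\<^sub>0 \<Phi> D\<phi> D2\<phi> D\<Phi> D2\<Phi> xb wb lb S \<epsilon>
  proof
    fix z z' assume z: "z \<in> ball (\<Phi> (xb, wb)) \<epsilon>" "z' \<in> ball (\<Phi> (xb, wb)) \<epsilon>"
      "\<And>c. c \<in> S \<Longrightarrow> c \<bullet> (z - z') = 0"
    show "\<theta> z = \<theta> z'"
      using z unfolding assms(4)[symmetric] by (intro \<epsilon>(2)) (auto simp: S_def intro: hull_inc)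
  qed (use \<tau> D\<phi> D\<Phi> Sp(1) \<epsilon>(1) assms(4,7) stationary in auto)
  have nondeg: "nondegenerate \<theta> \<Phi> xb wb \<longleftrightarrow> S \<inter> {l. adjoint A l = 0} = {0}"
    unfolding nondegenerate_def ker_partial_x_adj_def assms(4)[symmetric] Sp(2) px A_def[abs_def] by simp
  have KKT_mem: "(xb, lb) \<in> KKT_solutions \<phi>\<^sub>0 \<theta> \<Phi> wb 0"
    using lb by (auto simp: KKT_solutions_def gradient_Lagr G_base inv_subdifferential_def
        intro!: image_eqI[of _ _ "\<Phi> (xb, wb)"])
  \<comment> \<open>Proved under nondegeneracy, on which the chart depends. One side of the theorem
    contains this condition, and on the other \<open>localization_imp_nondegenerate\<close> supplies
    it.\<close>
  have equiv: "fully_stable \<phi>\<^sub>0 \<theta> \<Phi> xb wb 0 \<longleftrightarrow>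
      (\<exists>\<gamma>>0. xb \<in> M_set \<phi>\<^sub>0 \<theta> \<Phi> xb \<gamma> wb 0) \<and>
      lipschitz_localization (linearized_KKT_solutions \<phi>\<^sub>0 \<theta> \<Phi> xb wb lb) (0, 0) (xb, lb)"
    if nd: "S \<inter> {l. adjoint A l = 0} = {0}"
  proof -
    obtain R where R: "linear R" "\<And>u c. c \<in> S \<Longrightarrow> c \<bullet> (A (R u) - u) = 0"
      "\<And>u. (\<And>c. c \<in> S \<Longrightarrow> c \<bullet> u = 0) \<Longrightarrow> R u = 0"
      using right_inverse_modulo_orthogonal[OF linear_A Sp(1)] nd by (metis order_refl)
    interpret reduced_problem \<theta> \<tau> L \<phi>\<^sub>0 \<Phi> D\<phi> D2\<phi> D\<Phi> D2\<Phi> xb wb lb S \<epsilon> R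
    proof (intro reduced_problem.intro problem_data_axioms reduced_problem_axioms.intro)
      show "c \<bullet> (D\<Phi> (xb, wb) (R u, 0) - u) = 0" if "c \<in> S" for c u
        using R(2)[OF that] by (simp add: A_def)
    qed (use R in blast)+
    obtain N V g gd where "open N" "(xb, wb) \<in> N" "open V" "(0, wb) \<in> V" "homeomorphism N V \<Psi> g"
      "\<And>y. y \<in> V \<Longrightarrow> (g has_derivative gd y) (at y)"
      "\<And>y. y \<in> V \<Longrightarrow> gd y = inv (blinfun_apply (D\<Psi> (g y)))"
      "\<And>y. y \<in> V \<Longrightarrow> bij (blinfun_apply (D\<Psi> (g y)))"
      by (rule chart_exists) (rule that)
    then interpret charted_problem \<theta> \<tau> L \<phi>\<^sub>0 \<Phi> D\<phi> D2\<phi> D\<Phi> D2\<Phi> xb wb lb S \<epsilon> R N V g gd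
      by unfold_locales
    have "\<exists>\<gamma>>0. xb \<in> M_set \<phi>\<^sub>0 \<theta> \<Phi> xb \<gamma> wb 0" if fs: "fully_stable \<phi>\<^sub>0 \<theta> \<Phi> xb wb 0"
    proof -
      obtain \<gamma> where "\<gamma> > 0" "M_set \<phi>\<^sub>0 \<theta> \<Phi> xb \<gamma> wb 0 = {xb}"
        using fs unfolding fully_stable_def by blast
      then show ?thesis by blast
    qed
    then show ?thesis
      using fully_stable_imp_localization localization_imp_fully_stable loc_linearized_iff_KKT
      by blast
  qed
  show ?thesis
    using equiv localization_imp_nondegenerate KKT_mem
    unfolding nondeg strongly_regular_def assms(4)[symmetric] S_def[symmetric] by metis
qed

end
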